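(* Let $\mathcal{S}\subset\mathscr{L}(X)$ be a bounded right amenable semigroup on a barrelled quasi-complete locally convex space $(X,\tau)$. Then the following assertions are equivalent. (i) There is a two-sided ergodic net $(T_\alpha)_{\alpha\in A}$ for $\mathcal{S}$ with respect to the weak topology such that $(T_\alpha x)_{\alpha\in A}$ converges weakly for each $x\in X$. (ii) The semigroup $\mathcal{S}$ is weakly mean ergodic. (iii) The semigroup $\mathcal{S}$ is strongly mean ergodic. (iv) The semigroup $\mathcal{K}(\mathrm{co}\,\mathcal{S};X,X')$ has a zero $P$. (v) The semigroup $\mathcal{K}(\mathrm{co}\,\mathcal{S}';X',X)$ has a zero $Q$ which is weak* continuous. (vi) The fixed space $\mathrm{fix}(\mathcal{S})$ separates $\mathrm{fix}(\mathcal{S}')$, i.e. for each $0\neq x'\in\mathrm{fix}(\mathcal{S}')$ there is $x\in\mathrm{fix}(\mathcal{S})$ with $\langle x,x'\rangle\neq0$. (vii) $X=\mathrm{fix}(\mathcal{S})\oplus\overline{\mathrm{lin}}\,\mathrm{rg}(\mathrm{Id}-\mathcal{S})$. If one of the assertions (i)–(vii) is valid, then, with $P$ the zero of $\mathcal{K}(\mathrm{co}\,\mathcal{S};X,X')$ from (iv), $\lim_\alpha T_\alpha x=Px$ for all $x\in X$ in the weak (resp. $\tau$) topology for each operator net $(T_\alpha)_{\alpha\in A}$ which is right ergodic for $\mathcal{S}$ with respect to the weak (resp. $\tau$) topology.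
   Context: All vector spaces are complex; topological vector spaces are Hausdorff. $\mathscr{L}(X)$ denotes the continuous linear operators on $X$. $X'$ is the dual of $(X,\tau)$; the weak topology on $X$ is $\sigma(X,X')$, the weak* topology on $X'$ is $\sigma(X',X)$. Barrelled: every radial (absorbing), convex, circled, closed set is a zero neighborhood. Quasi-complete: every closed bounded subset is complete. "Bounded" semigroup: $\{Sx\mid S\in\mathcal{S}\}$ is bounded for each $x\in X$. A semitopological semigroup $S$ (separately continuous multiplication) is right amenable if $\mathrm{C}_{\mathrm{b}}(S)$ (bounded continuous functions) has a right invariant mean: a positive $m\in\mathrm{C}_{\mathrm{b}}(S)'$ with $m(\mathbf{1})=1$ and $m(R_sf)=m(f)$ for all $f$, $s$, where $R_sf(t)=f(ts)$; for $\mathcal{S}\subset\mathscr{L}(X)$ this refers to the topology of pointwise convergence. $\mathcal{S}'=\{S'\mid S\in\mathcal{S}\}$ is the adjoint semigroup on $X'$; $\mathrm{co}$ is convex hull. $\mathcal{K}(\mathrm{co}\,\mathcal{S};X,X')$ is the closure of $\mathrm{co}\,\mathcal{S}$ in $X^X$ with the product topology of $\sigma(X,X')$; $\mathcal{K}(\mathrm{co}\,\mathcal{S}';X',X)$ is the closure of $\mathrm{co}\,\mathcal{S}'$ in $(X')^{X'}$ with the product topology of $\sigma(X',X)$; both are semigroups under composition. A zero of a semigroup is an element $Q$ with $QR=RQ=Q$ for all $R$. Ergodic nets: for a semigroup $\mathcal{S}$ of continuous operators on a locally convex space $Y$, a net $(T_\alpha)\subset\overline{\mathrm{co}\,\mathcal{S}}^{Y^Y}$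 (pointwise closure for the topology of $Y$) is left ergodic if $\lim_\alpha(\mathrm{Id}-T)T_\alpha y=0$, right ergodic if $\lim_\alpha T_\alpha(\mathrm{Id}-T)y=0$, for each $y\in Y$, $T\in\mathcal{S}$; two-sided ergodic if both. $\mathcal{S}$ is right mean ergodic if each right ergodic net is pointwise convergent. "With respect to a topology" means $Y$ carries that topology. $\mathcal{S}$ is weakly mean ergodic if it is right mean ergodic with respect to $\sigma(X,X')$, and strongly mean ergodic if it is right mean ergodic with respect to the given topology $\tau$. For a family $\mathcal{T}$ of operators: $\mathrm{fix}(\mathcal{T})=\{x\mid Tx=x\ \forall T\in\mathcal{T}\}$, $\mathrm{rg}(\mathcal{T})=\{Tx\mid x\in X,\,T\in\mathcal{T}\}$; $\mathrm{Id}-\mathcal{S}=\{\mathrm{Id}-S\mid S\in\mathcal{S}\}$; $\overline{\mathrm{lin}}$ is the closed linear span. *)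

theory Defs
  imports "HOL-Analysis.Analysis" "HOL-Library.Function_Algebras" "HOL-Library.Nonpos_Ints"
begin

section \<open>Complex locally convex spaces\<close>

text \<open>
  A complex vector space is a type of class \<open>ab_group_add\<close> with a scalar multiplication
  \<open>scl\<close> satisfying \<^term>\<open>vector_space scl\<close>. Topologies are values of type
  \<open>'a topology\<close>, because several of them occur on the same space.
\<close>

definition zero_nbhd :: "'a::ab_group_add topology \<Rightarrow> 'a set \<Rightarrow> bool" where
  "zero_nbhd \<tau> U \<longleftrightarrow> (\<exists>V. openin \<tau> V \<and> 0 \<in> V \<and> V \<subseteq> U)"

definition convex_wrt :: "(complex \<Rightarrow> 'a::ab_group_add \<Rightarrow> 'a) \<Rightarrow> 'a set \<Rightarrow> bool" where
  "convex_wrt scl C \<longleftrightarrow>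
     (\<forall>x\<in>C. \<forall>y\<in>C. \<forall>t::real. 0 \<le> t \<and> t \<le> 1 \<longrightarrow>
        scl (of_real t) x + scl (of_real (1 - t)) y \<in> C)"

definition complex_lcs :: "(complex \<Rightarrow> 'a::ab_group_add \<Rightarrow> 'a) \<Rightarrow> 'a topology \<Rightarrow> bool" where
  "complex_lcs scl \<tau> \<longleftrightarrow>
     vector_space scl \<and> topspace \<tau> = UNIV \<and> Hausdorff_space \<tau> \<and>
     continuous_map (prod_topology \<tau> \<tau>) \<tau> (\<lambda>(x, y). x + y) \<and>
     continuous_map (prod_topology euclidean \<tau>) \<tau> (\<lambda>(c, x). scl c x) \<and>
     (\<forall>U. zero_nbhd \<tau> U \<longrightarrow> (\<exists>V. zero_nbhd \<tau> V \<and> convex_wrt scl V \<and> V \<subseteq> U))"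

definition absorbs :: "(complex \<Rightarrow> 'a \<Rightarrow> 'a) \<Rightarrow> 'a set \<Rightarrow> 'a set \<Rightarrow> bool" where
  "absorbs scl U B \<longleftrightarrow> (\<exists>r>0. \<forall>c. r \<le> norm c \<longrightarrow> B \<subseteq> scl c ` U)"

definition radial :: "(complex \<Rightarrow> 'a \<Rightarrow> 'a) \<Rightarrow> 'a set \<Rightarrow> bool" where
  "radial scl U \<longleftrightarrow> (\<forall>x. absorbs scl U {x})"

definition circled :: "(complex \<Rightarrow> 'a \<Rightarrow> 'a) \<Rightarrow> 'a set \<Rightarrow> bool" where
  "circled scl U \<longleftrightarrow> (\<forall>c. norm c \<le> 1 \<longrightarrow> scl c ` U \<subseteq> U)"

definition barrelled :: "(complex \<Rightarrow> 'a::ab_group_add \<Rightarrow> 'a) \<Rightarrow> 'a topology \<Rightarrow> bool" where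
  "barrelled scl \<tau> \<longleftrightarrow>
     (\<forall>U. radial scl U \<and> convex_wrt scl U \<and> circled scl U \<and> closedin \<tau> U
        \<longrightarrow> zero_nbhd \<tau> U)"

definition tvs_bounded :: "(complex \<Rightarrow> 'a::ab_group_add \<Rightarrow> 'a) \<Rightarrow> 'a topology \<Rightarrow> 'a set \<Rightarrow> bool" where
  "tvs_bounded scl \<tau> B \<longleftrightarrow> (\<forall>U. zero_nbhd \<tau> U \<longrightarrow> absorbs scl U B)"

definition tvs_cauchy :: "'a::ab_group_add topology \<Rightarrow> 'a filter \<Rightarrow> bool" where
  "tvs_cauchy \<tau> F \<longleftrightarrow> (\<forall>U. zero_nbhd \<tau> U \<longrightarrow> (\<forall>\<^sub>F (x, y) in F \<times>\<^sub>F F. x - y \<in> U))"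

definition tvs_complete :: "'a::ab_group_add topology \<Rightarrow> 'a set \<Rightarrow> bool" where
  "tvs_complete \<tau> C \<longleftrightarrow>
     (\<forall>F. F \<noteq> bot \<and> F \<le> principal C \<and> tvs_cauchy \<tau> F \<longrightarrow>
        (\<exists>x\<in>C. limitin \<tau> (\<lambda>y. y) x F))"

definition quasi_complete :: "(complex \<Rightarrow> 'a::ab_group_add \<Rightarrow> 'a) \<Rightarrow> 'a topology \<Rightarrow> bool" where
  "quasi_complete scl \<tau> \<longleftrightarrow>
     (\<forall>B. closedin \<tau> B \<and> tvs_bounded scl \<tau> B \<longrightarrow> tvs_complete \<tau> B)"

definition continuous_operators ::
    "(complex \<Rightarrow> 'a::ab_group_add \<Rightarrow> 'a) \<Rightarrow> 'a topology \<Rightarrow> ('a \<Rightarrow> 'a) set" where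
  "continuous_operators scl \<tau> =
     {T. Vector_Spaces.linear scl scl T \<and> continuous_map \<tau> \<tau> T}"


section \<open>Duality\<close>

definition dual :: "(complex \<Rightarrow> 'a::ab_group_add \<Rightarrow> 'a) \<Rightarrow> 'a topology \<Rightarrow> ('a \<Rightarrow> complex) set" where
  "dual scl \<tau> = {\<phi>. Vector_Spaces.linear scl (*) \<phi> \<and> continuous_map \<tau> euclidean \<phi>}"

definition weak_topology ::
    "(complex \<Rightarrow> 'a::ab_group_add \<Rightarrow> 'a) \<Rightarrow> 'a topology \<Rightarrow> 'a topology" where
  "weak_topology scl \<tau> =
     topology_generated_by {\<phi> -` U | \<phi> U. \<phi> \<in> dual scl \<tau> \<and> open U}"

text \<open>The underlying set of the weak* topology is the dual, not the whole type.\<close>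

definition weakstar_topology ::
    "(complex \<Rightarrow> 'a::ab_group_add \<Rightarrow> 'a) \<Rightarrow> 'a topology \<Rightarrow> ('a \<Rightarrow> complex) topology" where
  "weakstar_topology scl \<tau> =
     topology_generated_by {{\<phi> \<in> dual scl \<tau>. \<phi> x \<in> U} | x U. open U}"

text \<open>
  Maps from the dual to itself are represented by functions that are \<^term>\<open>undefined\<close>
  outside the dual, as in the library's \<^const>\<open>product_topology\<close> and \<^const>\<open>compose\<close>.
\<close>

definition adjoint_on :: "('a \<Rightarrow> complex) set \<Rightarrow> ('a \<Rightarrow> 'a) \<Rightarrow> ('a \<Rightarrow> complex) \<Rightarrow> ('a \<Rightarrow> complex)" where
  "adjoint_on X' T = (\<lambda>\<phi>\<in>X'. \<phi> \<circ> T)"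

definition adjoint_semigroup :: "(complex \<Rightarrow> 'a::ab_group_add \<Rightarrow> 'a) \<Rightarrow> 'a topology \<Rightarrow>
    ('a \<Rightarrow> 'a) set \<Rightarrow> (('a \<Rightarrow> complex) \<Rightarrow> ('a \<Rightarrow> complex)) set" where
  "adjoint_semigroup scl \<tau> S = adjoint_on (dual scl \<tau>) ` S"


section \<open>Right amenability\<close>

text \<open>
  Elements of $C_b(S)$ are complex functions on $S$ that are \<^term>\<open>undefined\<close> outside $S$,
  so that equality is equality on $S$.
\<close>

definition Cb :: "'s topology \<Rightarrow> ('s \<Rightarrow> complex) set" where
  "Cb T = {f \<in> extensional (topspace T). continuous_map T euclidean f \<and> bounded (f ` topspace T)}"

definition right_invariant_mean ::
    "'s topology \<Rightarrow> ('s \<Rightarrow> 's \<Rightarrow> 's) \<Rightarrow> (('s \<Rightarrow> complex) \<Rightarrow> complex) \<Rightarrow> bool" where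
  "right_invariant_mean T mul m \<longleftrightarrow>
     (\<forall>f\<in>Cb T. \<forall>g\<in>Cb T. m (\<lambda>t\<in>topspace T. f t + g t) = m f + m g) \<and>
     (\<forall>c. \<forall>f\<in>Cb T. m (\<lambda>t\<in>topspace T. c * f t) = c * m f) \<and>
     (\<exists>C. \<forall>f\<in>Cb T. norm (m f) \<le> C * (SUP t\<in>topspace T. norm (f t))) \<and>
     (\<forall>f\<in>Cb T. (\<forall>t\<in>topspace T. f t \<in> \<real>\<^sub>\<ge>\<^sub>0) \<longrightarrow> m f \<in> \<real>\<^sub>\<ge>\<^sub>0) \<and>
     m (\<lambda>t\<in>topspace T. 1) = 1 \<and>
     (\<forall>f\<in>Cb T. \<forall>s\<in>topspace T. m (\<lambda>t\<in>topspace T. f (mul t s)) = m f)"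

definition right_amenable :: "'s topology \<Rightarrow> ('s \<Rightarrow> 's \<Rightarrow> 's) \<Rightarrow> bool" where
  "right_amenable T mul \<longleftrightarrow> (\<exists>m. right_invariant_mean T mul m)"


section \<open>Semigroups of operators\<close>

definition operator_semigroup :: "('a \<Rightarrow> 'a) set \<Rightarrow> bool" where
  "operator_semigroup S \<longleftrightarrow> S \<noteq> {} \<and> (\<forall>R\<in>S. \<forall>T\<in>S. R \<circ> T \<in> S)"

definition bounded_semigroup ::
    "(complex \<Rightarrow> 'a::ab_group_add \<Rightarrow> 'a) \<Rightarrow> 'a topology \<Rightarrow> ('a \<Rightarrow> 'a) set \<Rightarrow> bool" where
  "bounded_semigroup scl \<tau> S \<longleftrightarrow> (\<forall>x. tvs_bounded scl \<tau> {T x | T. T \<in> S})"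

definition right_amenable_operators :: "'a topology \<Rightarrow> ('a \<Rightarrow> 'a) set \<Rightarrow> bool" where
  "right_amenable_operators \<tau> S \<longleftrightarrow>
     right_amenable (subtopology (product_topology (\<lambda>_. \<tau>) (topspace \<tau>)) S) (\<circ>)"

definition fun_scale :: "(complex \<Rightarrow> 'b \<Rightarrow> 'b) \<Rightarrow> complex \<Rightarrow> ('c \<Rightarrow> 'b) \<Rightarrow> 'c \<Rightarrow> 'b" where
  "fun_scale scl = (\<lambda>c f x. scl c (f x))"

text \<open>
  Addition of operators is pointwise. A convex combination of operators that are
  \<^term>\<open>undefined\<close> outside the dual is again \<^term>\<open>undefined\<close> there, so this is also the
  convex hull of a set of operators on the dual.
\<close>

definition co :: "(complex \<Rightarrow> 'b::ab_group_add \<Rightarrow> 'b) \<Rightarrow> ('b \<Rightarrow> 'b) set \<Rightarrow> ('b \<Rightarrow> 'b) set" where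
  "co scl S = convex_wrt (fun_scale scl) hull S"

definition pointwise_closure :: "'b topology \<Rightarrow> ('b \<Rightarrow> 'b) set \<Rightarrow> ('b \<Rightarrow> 'b) set" where
  "pointwise_closure T C = product_topology (\<lambda>_. T) (topspace T) closure_of C"

definition K_space :: "(complex \<Rightarrow> 'a::ab_group_add \<Rightarrow> 'a) \<Rightarrow> 'a topology \<Rightarrow>
    ('a \<Rightarrow> 'a) set \<Rightarrow> ('a \<Rightarrow> 'a) set" where
  "K_space scl \<tau> S = pointwise_closure (weak_topology scl \<tau>) (co scl S)"

definition K_dual :: "(complex \<Rightarrow> 'a::ab_group_add \<Rightarrow> 'a) \<Rightarrow> 'a topology \<Rightarrow>
    ('a \<Rightarrow> 'a) set \<Rightarrow> (('a \<Rightarrow> complex) \<Rightarrow> ('a \<Rightarrow> complex)) set" where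
  "K_dual scl \<tau> S = pointwise_closure (weakstar_topology scl \<tau>)
     (co (fun_scale (*)) (adjoint_semigroup scl \<tau> S))"

definition is_zero_on :: "'b set \<Rightarrow> ('b \<Rightarrow> 'b) set \<Rightarrow> ('b \<Rightarrow> 'b) \<Rightarrow> bool" where
  "is_zero_on Y K Q \<longleftrightarrow> Q \<in> K \<and> (\<forall>R\<in>K. compose Y Q R = Q \<and> compose Y R Q = Q)"

definition fix_on :: "'b set \<Rightarrow> ('b \<Rightarrow> 'b) set \<Rightarrow> 'b set" where
  "fix_on Y S = {y \<in> Y. \<forall>T\<in>S. T y = y}"

definition rg_Id_minus :: "('a::ab_group_add \<Rightarrow> 'a) set \<Rightarrow> 'a set" where
  "rg_Id_minus S = {x - T x | x T. T \<in> S}"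

definition closed_lin :: "(complex \<Rightarrow> 'a::ab_group_add \<Rightarrow> 'a) \<Rightarrow> 'a topology \<Rightarrow> 'a set \<Rightarrow> 'a set" where
  "closed_lin scl \<tau> A = \<tau> closure_of (module.span scl A)"

definition direct_sum_decomposition :: "'a::ab_group_add set \<Rightarrow> 'a set \<Rightarrow> bool" where
  "direct_sum_decomposition U V \<longleftrightarrow> (\<forall>x. \<exists>u\<in>U. \<exists>v\<in>V. x = u + v) \<and> U \<inter> V = {0}"


section \<open>Nets and mean ergodicity\<close>

text \<open>A net is a map \<open>N\<close> on a set \<open>A\<close> directed by \<open>le\<close>; limits are taken along the filter
  of tails of \<open>A\<close>.\<close>

definition directed :: "'i set \<Rightarrow> ('i \<Rightarrow> 'i \<Rightarrow> bool) \<Rightarrow> bool" where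
  "directed A le \<longleftrightarrow> A \<noteq> {} \<and> (\<forall>a\<in>A. le a a) \<and>
     (\<forall>a\<in>A. \<forall>b\<in>A. \<forall>c\<in>A. le a b \<and> le b c \<longrightarrow> le a c) \<and>
     (\<forall>a\<in>A. \<forall>b\<in>A. \<exists>c\<in>A. le a c \<and> le b c)"

definition tails :: "'i set \<Rightarrow> ('i \<Rightarrow> 'i \<Rightarrow> bool) \<Rightarrow> 'i filter" where
  "tails A le = (INF a\<in>A. principal {b \<in> A. le a b})"

definition operator_net :: "(complex \<Rightarrow> 'a::ab_group_add \<Rightarrow> 'a) \<Rightarrow> 'a topology \<Rightarrow> ('a \<Rightarrow> 'a) set \<Rightarrow>
    'i set \<Rightarrow> ('i \<Rightarrow> 'i \<Rightarrow> bool) \<Rightarrow> ('i \<Rightarrow> 'a \<Rightarrow> 'a) \<Rightarrow> bool" where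
  "operator_net scl T S A le N \<longleftrightarrow>
     directed A le \<and> (\<forall>\<alpha>\<in>A. N \<alpha> \<in> pointwise_closure T (co scl S))"

definition left_ergodic_net :: "(complex \<Rightarrow> 'a::ab_group_add \<Rightarrow> 'a) \<Rightarrow> 'a topology \<Rightarrow> ('a \<Rightarrow> 'a) set \<Rightarrow>
    'i set \<Rightarrow> ('i \<Rightarrow> 'i \<Rightarrow> bool) \<Rightarrow> ('i \<Rightarrow> 'a \<Rightarrow> 'a) \<Rightarrow> bool" where
  "left_ergodic_net scl T S A le N \<longleftrightarrow> operator_net scl T S A le N \<and>
     (\<forall>y. \<forall>R\<in>S. limitin T (\<lambda>\<alpha>. N \<alpha> y - R (N \<alpha> y)) 0 (tails A le))"

definition right_ergodic_net :: "(complex \<Rightarrow> 'a::ab_group_add \<Rightarrow> 'a) \<Rightarrow> 'a topology \<Rightarrow> ('a \<Rightarrow> 'a) set \<Rightarrow>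
    'i set \<Rightarrow> ('i \<Rightarrow> 'i \<Rightarrow> bool) \<Rightarrow> ('i \<Rightarrow> 'a \<Rightarrow> 'a) \<Rightarrow> bool" where
  "right_ergodic_net scl T S A le N \<longleftrightarrow> operator_net scl T S A le N \<and>
     (\<forall>y. \<forall>R\<in>S. limitin T (\<lambda>\<alpha>. N \<alpha> (y - R y)) 0 (tails A le))"

definition two_sided_ergodic_net :: "(complex \<Rightarrow> 'a::ab_group_add \<Rightarrow> 'a) \<Rightarrow> 'a topology \<Rightarrow>
    ('a \<Rightarrow> 'a) set \<Rightarrow> 'i set \<Rightarrow> ('i \<Rightarrow> 'i \<Rightarrow> bool) \<Rightarrow> ('i \<Rightarrow> 'a \<Rightarrow> 'a) \<Rightarrow> bool" where
  "two_sided_ergodic_net scl T S A le N \<longleftrightarrow>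
     left_ergodic_net scl T S A le N \<and> right_ergodic_net scl T S A le N"

definition pointwise_convergent_net ::
    "'a topology \<Rightarrow> 'i set \<Rightarrow> ('i \<Rightarrow> 'i \<Rightarrow> bool) \<Rightarrow> ('i \<Rightarrow> 'a \<Rightarrow> 'a) \<Rightarrow> bool" where
  "pointwise_convergent_net T A le N \<longleftrightarrow> (\<forall>y. \<exists>z. limitin T (\<lambda>\<alpha>. N \<alpha> y) z (tails A le))"

text \<open>
  Index types cannot be quantified inside a formula. Quantification over all operator nets is
  therefore rendered with index sets in the type \<open>'a op_index\<close>, ordered arbitrarily. This is no
  loss of generality: by \<open>canonical_net\<close> below every net, over whatever index type, has the same
  limits as a net indexed by pairs (operator, set of operators), cf.
  \<open>right_mean_ergodic_any_index\<close> and \<open>two_sided_convergent_any_index\<close>.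
\<close>

type_synonym 'a op_index = "('a \<Rightarrow> 'a) \<times> ('a \<Rightarrow> 'a) set"

definition right_mean_ergodic ::
    "(complex \<Rightarrow> 'a::ab_group_add \<Rightarrow> 'a) \<Rightarrow> 'a topology \<Rightarrow> ('a \<Rightarrow> 'a) set \<Rightarrow> bool" where
  "right_mean_ergodic scl T S \<longleftrightarrow>
     (\<forall>(A :: 'a op_index set) le N.
        right_ergodic_net scl T S A le N \<longrightarrow> pointwise_convergent_net T A le N)"

definition weakly_mean_ergodic ::
    "(complex \<Rightarrow> 'a::ab_group_add \<Rightarrow> 'a) \<Rightarrow> 'a topology \<Rightarrow> ('a \<Rightarrow> 'a) set \<Rightarrow> bool" where
  "weakly_mean_ergodic scl \<tau> S \<longleftrightarrow> right_mean_ergodic scl (weak_topology scl \<tau>) S"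

definition strongly_mean_ergodic ::
    "(complex \<Rightarrow> 'a::ab_group_add \<Rightarrow> 'a) \<Rightarrow> 'a topology \<Rightarrow> ('a \<Rightarrow> 'a) set \<Rightarrow> bool" where
  "strongly_mean_ergodic scl \<tau> S \<longleftrightarrow> right_mean_ergodic scl \<tau> S"


subsection \<open>Independence of the index type\<close>

lemma eventually_tails:
  assumes "directed A le"
  shows "eventually P (tails A le) \<longleftrightarrow> (\<exists>a\<in>A. \<forall>b\<in>A. le a b \<longrightarrow> P b)"
proof -
  have "eventually P (tails A le) \<longleftrightarrow> (\<exists>a\<in>A. eventually P (principal {b \<in> A. le a b}))"
    unfolding tails_def
  proof (rule eventually_INF_base)
    show "A \<noteq> {}" using assms by (simp add: directed_def)
  next
    fix a b assume "a \<in> A" "b \<in> A"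
    then obtain c where c: "c \<in> A" "le a c" "le b c"
      using assms unfolding directed_def by blast
    have "{d \<in> A. le c d} \<subseteq> {d \<in> A. le a d} \<inter> {d \<in> A. le b d}"
      using assms c \<open>a \<in> A\<close> \<open>b \<in> A\<close> unfolding directed_def by blast
    then show "\<exists>x\<in>A. principal {d \<in> A. le x d}
        \<le> inf (principal {d \<in> A. le a d}) (principal {d \<in> A. le b d})"
      using c by auto
  qed
  then show ?thesis by (auto simp: eventually_principal)
qed

lemma canonical_net:
  fixes N :: "'i \<Rightarrow> 'b"
  assumes dir: "directed A le"
  obtains B :: "('b \<times> 'b set) set" and le'
  where "directed B le'" "fst ` B \<subseteq> N ` A"
    "filtermap fst (tails B le') = filtermap N (tails A le)"
proof
  define F where "F = filtermap N (tails A le)"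
  define B where "B = {(x, E). eventually (\<lambda>y. y \<in> E) F \<and> x \<in> E \<and> x \<in> N ` A}"
  define le' where "le' = (\<lambda>(p :: 'b \<times> 'b set) (q :: 'b \<times> 'b set). snd q \<subseteq> snd p)"
  have evF: "eventually P F \<longleftrightarrow> (\<exists>a\<in>A. \<forall>b\<in>A. le a b \<longrightarrow> P (N b))" for P
    unfolding F_def by (simp add: eventually_filtermap eventually_tails[OF dir])
  have pick: "\<exists>x. (x, E) \<in> B" if ev: "eventually (\<lambda>y. y \<in> E) F" for E
  proof -
    obtain a where "a \<in> A" "\<forall>b\<in>A. le a b \<longrightarrow> N b \<in> E"
      using ev[unfolded evF] by meson
    moreover from this dir have "le a a" unfolding directed_def by blast
    ultimately have "(N a, E) \<in> B" using that by (auto simp: B_def)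
    then show ?thesis ..
  qed
  show dirB: "directed B le'"
    unfolding directed_def
  proof (intro conjI ballI)
    show "B \<noteq> {}" using pick[of UNIV] by auto
    fix p q assume pq: "p \<in> B" "q \<in> B"
    then have "eventually (\<lambda>y. y \<in> snd p \<inter> snd q) F"
      by (auto simp: B_def elim: eventually_elim2)
    from pick[OF this] obtain x where "(x, snd p \<inter> snd q) \<in> B" ..
    then show "\<exists>c\<in>B. le' p c \<and> le' q c"
      by (intro bexI[of _ "(x, snd p \<inter> snd q)"]) (auto simp: le'_def)
  qed (auto simp: le'_def)
  show "fst ` B \<subseteq> N ` A" by (auto simp: B_def)
  show "filtermap fst (tails B le') = filtermap N (tails A le)"
    unfolding F_def[symmetric]
  proof (rule filter_eq_iff[THEN iffD2], rule allI)
    fix P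
    have "eventually P (filtermap fst (tails B le')) \<longleftrightarrow>
        (\<exists>p\<in>B. \<forall>q\<in>B. le' p q \<longrightarrow> P (fst q))"
      by (simp add: eventually_filtermap eventually_tails[OF dirB])
    also have "\<dots> \<longleftrightarrow> eventually P F"
    proof
      assume "\<exists>p\<in>B. \<forall>q\<in>B. le' p q \<longrightarrow> P (fst q)"
      then obtain p where p: "p \<in> B" "\<And>q. q \<in> B \<Longrightarrow> le' p q \<Longrightarrow> P (fst q)" by blast
      then have ev: "eventually (\<lambda>y. y \<in> snd p) F" by (auto simp: B_def)
      then obtain a where a: "a \<in> A" "\<forall>b\<in>A. le a b \<longrightarrow> N b \<in> snd p"
        using ev[unfolded evF] by meson
      have "P (N b)" if "b \<in> A" "le a b" for b
      proof -
        have "(N b, snd p) \<in> B" using that a p(1) by (auto simp: B_def)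
        from p(2)[OF this] show ?thesis by (simp add: le'_def)
      qed
      then show "eventually P F" using a(1) evF by blast
    next
      assume *: "eventually P F"
      then have "eventually (\<lambda>y. y \<in> Collect P) F" by simp
      from pick[OF this] obtain x where "(x, Collect P) \<in> B" ..
      moreover have "P (fst q)" if "q \<in> B" "le' (x, Collect P) q" for q
        using that by (auto simp: B_def le'_def)
      ultimately show "\<exists>p\<in>B. \<forall>q\<in>B. le' p q \<longrightarrow> P (fst q)" by blast
    qed
    finally show "eventually P (filtermap fst (tails B le')) = eventually P F" .
  qed
qed

lemma limitin_filtermap:
  "limitin T (\<lambda>\<alpha>. f (N \<alpha>)) l F \<longleftrightarrow> limitin T f l (filtermap N F)"
  by (simp add: limitin_def eventually_filtermap)

lemma same_filter_same_limits:
  assumes "filtermap N' F' = filtermap N F"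
  shows "limitin T (\<lambda>\<alpha>. f (N' \<alpha>)) l F' \<longleftrightarrow> limitin T (\<lambda>\<alpha>. f (N \<alpha>)) l F"
  by (simp add: limitin_filtermap[of T f N'] limitin_filtermap[of T f N] assms)

lemma canonical_operator_net:
  fixes N :: "'i \<Rightarrow> 'a::ab_group_add \<Rightarrow> 'a"
  assumes "directed A le"
  obtains B :: "'a op_index set" and le' where
    "\<And>scl T S. operator_net scl T S A le N \<Longrightarrow> operator_net scl T S B le' fst"
    "\<And>T f l. limitin T (\<lambda>\<alpha>. f (fst \<alpha>)) l (tails B le') \<longleftrightarrow> limitin T (\<lambda>\<alpha>. f (N \<alpha>)) l (tails A le)"
proof -
  obtain B :: "'a op_index set" and le' where *: "directed B le'" "fst ` B \<subseteq> N ` A"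
    "filtermap fst (tails B le') = filtermap N (tails A le)"
    by (rule canonical_net[OF assms])
  show thesis
  proof (rule that)
    show "operator_net scl T S B le' fst" if "operator_net scl T S A le N" for scl T S
      using that *(1,2) unfolding operator_net_def by (auto simp: image_subset_iff)
    show "limitin T (\<lambda>\<alpha>. f (fst \<alpha>)) l (tails B le') \<longleftrightarrow> limitin T (\<lambda>\<alpha>. f (N \<alpha>)) l (tails A le)"
      for T :: "'b topology" and f l
      by (rule same_filter_same_limits[OF *(3)])
  qed
qed

lemma right_mean_ergodic_any_index:
  fixes A :: "'i set" and T :: "'a::ab_group_add topology"
  assumes me: "right_mean_ergodic scl T S" and net: "right_ergodic_net scl T S A le N"
  shows "pointwise_convergent_net T A le N"
proof -
  have "directed A le" using net by (simp add: right_ergodic_net_def operator_net_def)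
  then obtain B :: "'a op_index set" and le' where
    1: "\<And>scl T S. operator_net scl T S A le N \<Longrightarrow> operator_net scl T S B le' fst" and
    2: "\<And>(T :: 'a topology) f l. limitin T (\<lambda>\<alpha>. f (fst \<alpha>)) l (tails B le') \<longleftrightarrow>
          limitin T (\<lambda>\<alpha>. f (N \<alpha>)) l (tails A le)"
    using canonical_operator_net[of A le N] by blast
  have "right_ergodic_net scl T S B le' fst"
    using net 1 2[of T "\<lambda>R. R y" for y] by (simp add: right_ergodic_net_def)
  then have "pointwise_convergent_net T B le' fst"
    using me unfolding right_mean_ergodic_def by blast
  then show ?thesis
    using 2[of T "\<lambda>R. R y" for y] by (simp add: pointwise_convergent_net_def)
qed

lemma two_sided_convergent_any_index:
  fixes A :: "'i set" and T :: "'a::ab_group_add topology"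
  assumes net: "two_sided_ergodic_net scl T S A le N" and conv: "pointwise_convergent_net T A le N"
  shows "\<exists>(B :: 'a op_index set) le' M.
    two_sided_ergodic_net scl T S B le' M \<and> pointwise_convergent_net T B le' M"
proof -
  have "directed A le"
    using net by (simp add: two_sided_ergodic_net_def right_ergodic_net_def operator_net_def)
  then obtain B :: "'a op_index set" and le' where
    1: "\<And>scl T S. operator_net scl T S A le N \<Longrightarrow> operator_net scl T S B le' fst" and
    2: "\<And>(T :: 'a topology) f l. limitin T (\<lambda>\<alpha>. f (fst \<alpha>)) l (tails B le') \<longleftrightarrow>
          limitin T (\<lambda>\<alpha>. f (N \<alpha>)) l (tails A le)"
    using canonical_operator_net[of A le N] by blast
  have "two_sided_ergodic_net scl T S B le' fst"
    using net 1 2[of T "\<lambda>R. R y" for y] 2[of T "\<lambda>Q. Q y - R (Q y)" for y R]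
    by (simp add: two_sided_ergodic_net_def left_ergodic_net_def right_ergodic_net_def)
  moreover have "pointwise_convergent_net T B le' fst"
    using conv 2[of T "\<lambda>R. R y" for y] by (simp add: pointwise_convergent_net_def)
  ultimately show ?thesis by blast
qed

end

theory Submission
  imports Defs
begin

text \<open>
  Every assertion is compared with one statement: each \<open>x\<close> has a component \<open>u \<in> fix S\<close> with
  \<open>x - u\<close> in \<open>Ran\<close>, the closed linear span of \<open>rg (Id - S)\<close>. The map \<open>P x = u\<close> is the mean ergodic
  projection.

  The right invariant mean is needed only for one fact. By the Hahn-Banach theorem \<open>Ran\<close> is the
  annihilator of \<open>fix S'\<close>. If \<open>x \<in> Ran\<close> and the convex set \<open>co S x\<close> stayed away from \<open>0\<close>, then a
  functional \<open>\<phi>\<close> would satisfy \<open>Re (\<phi> (T x)) \<ge> 1\<close> for all \<open>T \<in> S\<close>; averaging \<open>T \<mapsto> \<phi> (T x)\<close> with the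
  mean gives \<open>\<psi> \<in> fix S'\<close> with \<open>Re (\<psi> x) \<ge> 1\<close>, which is impossible. So \<open>0\<close> lies in the closure of
  \<open>co S x\<close> for the given topology (\<open>Ran_small_orbit\<close>). Barrelledness makes \<open>S\<close>, \<open>co S\<close> and the
  weak closure \<open>K\<close> equicontinuous (\<open>equicontinuous\<close>, \<open>K_bound\<close>), and composing operators of \<open>co S\<close>
  makes finitely many vectors of \<open>Ran\<close> small at once. This produces a net in \<open>co S\<close> that tends to
  \<open>0\<close> pointwise on \<open>Ran\<close> for the given topology (\<open>ergodic_net_exists\<close>); it is right ergodic both
  strongly and weakly.

  Each of the assertions about ergodic nets and zeros implies that \<open>fix S\<close> separates \<open>fix S'\<close>: one
  exhibits, for given \<open>x\<close>, a vector \<open>z \<in> fix S\<close> on which every fixed functional has the same value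
  as on \<open>x\<close>. For an ergodic net \<open>z\<close> is the limit of \<open>T\<^sub>\<alpha> x\<close>, for a zero of \<open>K\<close> its value at \<open>x\<close>, and for a weak*
  continuous zero \<open>Q\<close> of \<open>K'\<close> the vector that represents the weak* continuous functional
  \<open>\<phi> \<mapsto> Q \<phi> x\<close>.

  Conversely, let \<open>fix S\<close> separate \<open>fix S'\<close>. Then \<open>fix S + Ran\<close> is dense, again by Hahn-Banach. If
  \<open>z = u + n\<close> in this sum is close to \<open>x\<close>, then \<open>u\<close> is close to the bounded orbit \<open>co S x\<close>, and \<open>u\<close>
  depends uniformly continuously on \<open>z\<close>. Hence quasi-completeness yields a limit of the \<open>u\<close>, the
  component of \<open>x\<close> (\<open>decomposition_if_separates\<close>). On \<open>fix S\<close> every element of \<open>K\<close> is the identity,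
  and a right ergodic net tends to \<open>0\<close> on \<open>Ran\<close>, so every such net converges to \<open>P\<close>; the remaining
  assertions are read off from \<open>P\<close> and its adjoint.
\<close>

section \<open>Continuous seminorms\<close>

locale lcs =
  fixes scl :: "complex \<Rightarrow> 'a::ab_group_add \<Rightarrow> 'a" and \<tau> :: "'a topology"
  assumes complex_lcs: "complex_lcs scl \<tau>"
begin

sublocale vector_space scl
  using complex_lcs unfolding complex_lcs_def by blast

lemma topspace_eq [simp]: "topspace \<tau> = UNIV"
  using complex_lcs unfolding complex_lcs_def by blast

definition seminorm :: "('a \<Rightarrow> real) \<Rightarrow> bool" where
  "seminorm p \<longleftrightarrow> (\<forall>x y. p (x + y) \<le> p x + p y) \<and> (\<forall>c x. p (scl c x) = norm c * p x)"

text \<open>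
  Continuous seminorms. For a seminorm, continuity amounts to the unit ball being a zero
  neighbourhood.
\<close>

definition csn :: "('a \<Rightarrow> real) \<Rightarrow> bool" where
  "csn p \<longleftrightarrow> seminorm p \<and> zero_nbhd \<tau> {x. p x \<le> 1}"

lemma seminormD:
  assumes "seminorm p"
  shows "p (x + y) \<le> p x + p y" "p (scl c x) = norm c * p x" "p 0 = 0" "p (- x) = p x"
    "p (x - y) \<le> p x + p y" "p x \<ge> 0" "p (x - y) = p (y - x)"
proof -
  show a: "p (x + y) \<le> p x + p y" and b: "p (scl c x) = norm c * p x" for x y c
    using assms by (auto simp: seminorm_def)
  show z: "p 0 = 0" using b[of 0 0] by simp
  show m: "p (- x) = p x" for x using b[of "-1" x] by simp
  show "p (x - y) \<le> p x + p y" using a[of x "- y"] m by simp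
  show "p x \<ge> 0" using a[of x "- x"] z m by simp
  show "p (x - y) = p (y - x)" using m[of "x - y"] by simp
qed

lemmas csn_seminorm = csn_def[THEN iffD1, THEN conjunct1]
lemmas csnD = seminormD[OF csn_seminorm]

lemma csn_triangle: "csn p \<Longrightarrow> p (x - z) \<le> p (x - y) + p (y - z)"
  using csnD(1)[of p "x - y" "y - z"] by simp

lemma continuous_scl: "continuous_map \<tau> \<tau> (scl c)"
proof -
  have "continuous_map \<tau> (prod_topology euclidean \<tau>) (\<lambda>x. (c, x))"
    by (simp add: continuous_map_pairedI)
  then have "continuous_map \<tau> \<tau> ((\<lambda>(c, x). scl c x) \<circ> (\<lambda>x. (c, x)))"
    using complex_lcs unfolding complex_lcs_def by (metis continuous_map_compose)
  then show ?thesis by (simp add: comp_def)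
qed

lemma continuous_translation: "continuous_map \<tau> \<tau> (\<lambda>x. x + a)"
proof -
  have "continuous_map \<tau> (prod_topology \<tau> \<tau>) (\<lambda>x. (x, a))"
    by (simp add: continuous_map_pairedI)
  then have "continuous_map \<tau> \<tau> ((\<lambda>(x, y). x + y) \<circ> (\<lambda>x. (x, a)))"
    using complex_lcs unfolding complex_lcs_def by (metis continuous_map_compose)
  then show ?thesis by (simp add: comp_def)
qed

lemma zero_nbhd_mono: "zero_nbhd \<tau> U \<Longrightarrow> U \<subseteq> V \<Longrightarrow> zero_nbhd \<tau> V"
  unfolding zero_nbhd_def by blast

lemma zero_nbhd_Int: "zero_nbhd \<tau> U \<Longrightarrow> zero_nbhd \<tau> V \<Longrightarrow> zero_nbhd \<tau> (U \<inter> V)"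
  unfolding zero_nbhd_def by (metis IntI Int_mono openin_Int)

lemma zero_nbhd_scl:
  assumes "zero_nbhd \<tau> U"
  shows "zero_nbhd \<tau> {x. scl c x \<in> U}"
proof -
  obtain V where V: "openin \<tau> V" "0 \<in> V" "V \<subseteq> U" using assms unfolding zero_nbhd_def by blast
  have "openin \<tau> {x. scl c x \<in> V}"
    using openin_continuous_map_preimage[OF continuous_scl V(1)] by simp
  then show ?thesis unfolding zero_nbhd_def using V by (intro exI[of _ "{x. scl c x \<in> V}"]) auto
qed

lemma csn_scale:
  assumes "csn p" "r \<ge> 0"
  shows "csn (\<lambda>x. r * p x)"
proof -
  have "{x. r * p x \<le> 1} = {x. scl (of_real r) x \<in> {x. p x \<le> 1}}"
    using assms csnD(2)[OF assms(1)] by auto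
  then have "zero_nbhd \<tau> {x. r * p x \<le> 1}"
    using assms zero_nbhd_scl[of "{x. p x \<le> 1}" "of_real r"] unfolding csn_def by simp
  moreover have "r * p (x + y) \<le> r * p x + r * p y" for x y
    using mult_left_mono[OF csnD(1)[OF assms(1), of x y] assms(2)] by (simp add: distrib_left)
  ultimately show ?thesis
    using csnD(2)[OF assms(1)] by (simp add: csn_def seminorm_def)
qed

lemma csn_add:
  assumes "csn p" "csn q"
  shows "csn (\<lambda>x. p x + q x)"
proof -
  have "csn (\<lambda>x. 2 * p x)" "csn (\<lambda>x. 2 * q x)" using assms csn_scale by simp_all
  then have "zero_nbhd \<tau> ({x. 2 * p x \<le> 1} \<inter> {x. 2 * q x \<le> 1})"
    unfolding csn_def by (intro zero_nbhd_Int) auto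
  then have "zero_nbhd \<tau> {x. p x + q x \<le> 1}" by (rule zero_nbhd_mono) auto
  moreover have "p (x + y) + q (x + y) \<le> (p x + q x) + (p y + q y)" for x y
    using csnD(1)[OF assms(1), of x y] csnD(1)[OF assms(2), of x y] by simp
  then have "seminorm (\<lambda>x. p x + q x)"
    unfolding seminorm_def using csnD(2)[OF assms(1)] csnD(2)[OF assms(2)]
    by (simp add: distrib_left)
  ultimately show ?thesis by (simp add: csn_def)
qed

lemma csn_zero: "csn (\<lambda>x. 0)"
  unfolding csn_def seminorm_def zero_nbhd_def
  by (auto intro!: exI[of _ UNIV] simp: openin_topspace[of \<tau>, simplified])

text \<open>
  Scalar multiplication is continuous at \<open>(0, 0)\<close>, so it maps \<open>D \<times> E\<close> into a convex \<open>W\<close> for a disc \<open>D\<close>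
  and a zero neighbourhood \<open>E\<close>. Hence the largest circled subset of \<open>W\<close>, which is again convex,
  contains a multiple of \<open>E\<close>.
\<close>

lemma zero_nbhd_convex_circled:
  assumes "zero_nbhd \<tau> U"
  obtains V where "zero_nbhd \<tau> V" "convex_wrt scl V" "circled scl V" "V \<subseteq> U"
proof -
  obtain W where W: "zero_nbhd \<tau> W" "convex_wrt scl W" "W \<subseteq> U"
    using assms complex_lcs unfolding complex_lcs_def by blast
  then obtain G where G: "openin \<tau> G" "0 \<in> G" "G \<subseteq> W" unfolding zero_nbhd_def by blast
  have cont: "continuous_map (prod_topology euclidean \<tau>) \<tau> (\<lambda>(c, x). scl c x)"
    using complex_lcs unfolding complex_lcs_def by blast
  have op: "openin (prod_topology euclidean \<tau>) {z. (case z of (c, x) \<Rightarrow> scl c x) \<in> G}"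
    using openin_continuous_map_preimage[OF cont G(1)] by simp
  have "(0::complex, 0::'a) \<in> {z. (case z of (c, x) \<Rightarrow> scl c x) \<in> G}"
    using G by simp
  then obtain D E where DE: "open D" "openin \<tau> E" "0 \<in> D" "0 \<in> E"
      "D \<times> E \<subseteq> {z. (case z of (c, x) \<Rightarrow> scl c x) \<in> G}"
    using op unfolding openin_prod_topology_alt by (metis open_openin)
  obtain d where d: "d > 0" "ball 0 d \<subseteq> D" using DE(1,3) openE by blast
  define V where "V = {x. \<forall>c. norm c \<le> 1 \<longrightarrow> scl c x \<in> W}"
  have "{x. scl (of_real (2 / d)) x \<in> E} \<subseteq> V"
  proof
    fix x assume "x \<in> {x. scl (of_real (2 / d)) x \<in> E}"
    then have x: "scl (of_real (2 / d)) x \<in> E" by simp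
    have "scl c x \<in> W" if c: "norm c \<le> 1" for c
    proof -
      have "norm c * (d / 2) \<le> 1 * (d / 2)" using c d(1) by (intro mult_right_mono) auto
      then have "norm (c * of_real (d / 2)) < d" using d(1) by (simp add: norm_mult)
      then have "c * of_real (d / 2) \<in> D" using d(2) by auto
      then have "scl (c * of_real (d / 2)) (scl (of_real (2 / d)) x) \<in> G" using DE(5) x by auto
      moreover have "c * of_real (d / 2) * of_real (2 / d) = c"
        using d(1) by simp
      ultimately have "scl c x \<in> G" by (simp only: scale_scale)
      then show ?thesis using G by blast
    qed
    then show "x \<in> V" by (simp add: V_def)
  qed
  moreover have "zero_nbhd \<tau> {x. scl (of_real (2 / d)) x \<in> E}"
    using DE zero_nbhd_scl unfolding zero_nbhd_def by blast
  ultimately have "zero_nbhd \<tau> V" using zero_nbhd_mono by blast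
  moreover have "convex_wrt scl V"
    using W(2) unfolding convex_wrt_def V_def
    by (simp add: scale_right_distrib scale_left_commute[of _ "of_real _"]
        scale_left_commute[of _ "1 - of_real _"] del: scale_scale)
  moreover have "circled scl V"
    unfolding circled_def V_def
  proof (intro allI impI subsetI)
    fix c y assume c: "norm c \<le> 1" and "y \<in> scl c ` {x. \<forall>c. norm c \<le> 1 \<longrightarrow> scl c x \<in> W}"
    then obtain x where x: "y = scl c x" "\<forall>c. norm c \<le> 1 \<longrightarrow> scl c x \<in> W" by blast
    show "y \<in> {x. \<forall>c. norm c \<le> 1 \<longrightarrow> scl c x \<in> W}"
    proof (intro CollectI allI impI)
      fix b :: complex assume "norm b \<le> 1"
      then have "norm (b * c) \<le> 1" using c by (simp add: norm_mult mult_le_one)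
      then show "scl b y \<in> W" using x by simp
    qed
  qed
  moreover have "V \<subseteq> U" using W(3) unfolding V_def by (auto dest!: spec[of _ 1])
  ultimately show thesis using that by blast
qed

lemma zero_nbhd_absorbing:
  assumes "zero_nbhd \<tau> U"
  shows "\<exists>r>0. scl (inverse (of_real r)) x \<in> U"
proof -
  obtain G where G: "openin \<tau> G" "0 \<in> G" "G \<subseteq> U" using assms unfolding zero_nbhd_def by blast
  have "continuous_map euclidean (prod_topology euclidean \<tau>) (\<lambda>c. (c, x))"
    by (simp add: continuous_map_pairedI)
  then have "continuous_map euclidean \<tau> ((\<lambda>(c, x). scl c x) \<circ> (\<lambda>c. (c, x)))"
    using complex_lcs unfolding complex_lcs_def by (metis continuous_map_compose)
  then have "continuous_map euclidean \<tau> (\<lambda>c. scl c x)" by (simp add: comp_def)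
  from openin_continuous_map_preimage[OF this G(1)] have "open {c. scl c x \<in> G}" by simp
  moreover have "0 \<in> {c. scl c x \<in> G}" using G by simp
  ultimately obtain d where d: "d > 0" "ball 0 d \<subseteq> {c. scl c x \<in> G}" using openE by blast
  have "inverse (complex_of_real (2 / d)) \<in> ball 0 d" using d(1) by (simp add: norm_divide)
  then have "scl (inverse (of_real (2 / d))) x \<in> G" using d by blast
  then show ?thesis using G d(1) by (intro exI[of _ "2 / d"]) auto
qed

text \<open>The seminorm is the Minkowski functional of a convex circled neighbourhood inside \<open>U\<close>.\<close>

lemma zero_nbhd_csn:
  assumes "zero_nbhd \<tau> U"
  obtains p where "csn p" "\<And>x. p x < 1 \<Longrightarrow> x \<in> U"
proof -
  obtain V where V: "zero_nbhd \<tau> V" "convex_wrt scl V" "circled scl V" "V \<subseteq> U"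
    using zero_nbhd_convex_circled[OF assms] .
  have circ: "scl c x \<in> V" if "x \<in> V" "norm c \<le> 1" for c x
    using V(3) that unfolding circled_def by blast
  define G where "G = (\<lambda>x. {r. r > 0 \<and> scl (inverse (of_real r)) x \<in> V})"
  define p where "p = (\<lambda>x. Inf (G x))"
  have ne: "G x \<noteq> {}" for x using zero_nbhd_absorbing[OF V(1), of x] unfolding G_def by blast
  have bdd: "bdd_below (G x)" for x unfolding G_def by (intro bdd_belowI[of _ 0]) auto
  have pos: "p x \<ge> 0" for x unfolding p_def by (rule cInf_greatest[OF ne]) (auto simp: G_def)
  have le: "p x \<le> r" if "r \<in> G x" for r x unfolding p_def using cInf_lower[OF that bdd] .
  have ex: "\<exists>r\<in>G x. r < b" if "p x < b" for x b
    using cInf_lessD[OF ne, of x b] that unfolding p_def by blast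
  have addG: "r + s \<in> G (x + y)" if "r \<in> G x" "s \<in> G y" for r s x y
  proof -
    have rs: "r > 0" "s > 0" and V': "scl (inverse (of_real r)) x \<in> V" "scl (inverse (of_real s)) y \<in> V"
      using that by (auto simp: G_def)
    define t where "t = r / (r + s)"
    have t: "0 \<le> t" "t \<le> 1" "1 - t = s / (r + s)" using rs by (auto simp: t_def field_simps)
    have "scl (of_real t) (scl (inverse (of_real r)) x) + scl (of_real (1 - t)) (scl (inverse (of_real s)) y) \<in> V"
      using V(2) V' t(1,2) unfolding convex_wrt_def by blast
    moreover have "of_real t * inverse (of_real r) = (inverse (of_real (r + s)) :: complex)"
      using rs unfolding t_def by (simp add: field_simps)
    moreover have "of_real (1 - t) * inverse (of_real s) = (inverse (of_real (r + s)) :: complex)"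
      using rs unfolding t(3) by (simp add: field_simps)
    ultimately have "scl (inverse (of_real (r + s))) (x + y) \<in> V"
      by (simp add: scale_right_distrib)
    then show ?thesis using rs by (simp add: G_def)
  qed
  have scaleG: "norm c * r \<in> G (scl c x)" if "r \<in> G x" "c \<noteq> 0" for r c x
  proof -
    have r: "r > 0" "scl (inverse (of_real r)) x \<in> V" using that by (auto simp: G_def)
    have "scl (c / of_real (norm c)) (scl (inverse (of_real r)) x) \<in> V"
      by (rule circ[OF r(2)]) (simp add: norm_divide)
    moreover have "c / of_real (norm c) * inverse (of_real r) = inverse (of_real (norm c * r)) * c"
      using that r by (simp add: field_simps)
    ultimately have "scl (inverse (of_real (norm c * r))) (scl c x) \<in> V"
      by simp
    then show ?thesis using r that by (simp add: G_def)
  qed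
  have sub: "p (x + y) \<le> p x + p y" for x y
  proof (rule field_le_epsilon)
    fix e :: real assume e: "e > 0"
    obtain r where r: "r \<in> G x" "r < p x + e/2" using ex[of x "p x + e/2"] e by auto
    obtain s where s: "s \<in> G y" "s < p y + e/2" using ex[of y "p y + e/2"] e by auto
    show "p (x + y) \<le> p x + p y + e" using le[OF addG[OF r(1) s(1)]] r s by simp
  qed
  have scale_le: "p (scl c x) \<le> norm c * p x" if "c \<noteq> 0" for c x
  proof -
    have "p (scl c x) / norm c \<le> p x"
      unfolding p_def[of] 
    proof (rule cInf_greatest[OF ne])
      fix r assume "r \<in> G x"
      from le[OF scaleG[OF this that]] that show "Inf (G (scl c x)) / norm c \<le> r"
        by (simp add: p_def field_simps)
    qed
    then show ?thesis using that by (simp add: field_simps)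
  qed
  have zero: "p 0 = 0"
  proof -
    have "e \<in> G 0" if "e > 0" for e
      using V(1) that unfolding G_def zero_nbhd_def by auto
    then have "p 0 \<le> e" if "e > 0" for e using le that by blast
    then show ?thesis using pos[of 0] by (meson antisym dense_ge)
  qed
  have scale: "p (scl c x) = norm c * p x" for c x
  proof (cases "c = 0")
    case True then show ?thesis using zero by simp
  next
    case False
    have "p x = p (scl (inverse c) (scl c x))" using False by simp
    also have "\<dots> \<le> norm (inverse c) * p (scl c x)" using False by (intro scale_le) simp
    finally have "norm c * p x \<le> p (scl c x)" using False by (simp add: norm_divide field_simps)
    then show ?thesis using scale_le[OF False, of x] by simp
  qed
  have "V \<subseteq> {x. p x \<le> 1}" using le[of 1] by (auto simp: G_def)
  then have "csn p"
    unfolding csn_def seminorm_def using sub scale zero_nbhd_mono[OF V(1)] by auto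
  moreover have "x \<in> U" if px: "p x < 1" for x
  proof -
    obtain r where r: "r \<in> G x" "r < 1" using ex[OF px] by blast
    then have "scl (of_real r) (scl (inverse (of_real r)) x) \<in> V"
      by (intro circ[of "scl (inverse (of_real r)) x"]) (auto simp: G_def)
    then show ?thesis using r V(4) by (auto simp: G_def)
  qed
  ultimately show thesis using that by blast
qed

text \<open>Translation reduces neighbourhoods of a point to zero neighbourhoods, hence to seminorms.\<close>

lemma openin_iff: "openin \<tau> A \<longleftrightarrow> (\<forall>x\<in>A. \<exists>p. csn p \<and> (\<forall>y. p (y - x) < 1 \<longrightarrow> y \<in> A))"
proof
  assume A: "openin \<tau> A"
  show "\<forall>x\<in>A. \<exists>p. csn p \<and> (\<forall>y. p (y - x) < 1 \<longrightarrow> y \<in> A)"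
  proof
    fix x assume x: "x \<in> A"
    have "openin \<tau> {y. y + x \<in> A}"
      using openin_continuous_map_preimage[OF continuous_translation A] by simp
    then have "zero_nbhd \<tau> {y. y + x \<in> A}" unfolding zero_nbhd_def using x by auto
    then obtain p where p: "csn p" "\<And>y. p y < 1 \<Longrightarrow> y \<in> {y. y + x \<in> A}"
      using zero_nbhd_csn by metis
    have "y \<in> A" if "p (y - x) < 1" for y using p(2)[OF that] by simp
    then show "\<exists>p. csn p \<and> (\<forall>y. p (y - x) < 1 \<longrightarrow> y \<in> A)" using p(1) by blast
  qed
next
  assume *: "\<forall>x\<in>A. \<exists>p. csn p \<and> (\<forall>y. p (y - x) < 1 \<longrightarrow> y \<in> A)"
  show "openin \<tau> A"
  proof (subst openin_subopen, intro ballI)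
    fix x assume "x \<in> A"
    then obtain p where p: "csn p" "\<And>y. p (y - x) < 1 \<Longrightarrow> y \<in> A" using * by blast
    have "zero_nbhd \<tau> {y. 2 * p y \<le> 1}" using csn_scale[OF p(1), of 2] by (simp add: csn_def)
    then obtain V where V: "openin \<tau> V" "0 \<in> V" "V \<subseteq> {y. 2 * p y \<le> 1}"
      unfolding zero_nbhd_def by blast
    have "openin \<tau> {y. y + (- x) \<in> V}"
      using openin_continuous_map_preimage[OF continuous_translation[of "- x"] V(1)] by simp
    moreover have "{y. y + (- x) \<in> V} \<subseteq> A" using V(3) p(2) by fastforce
    ultimately show "\<exists>T. openin \<tau> T \<and> x \<in> T \<and> T \<subseteq> A" using V(2)
      by (intro exI[of _ "{y. y + (- x) \<in> V}"]) auto
  qed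
qed

text \<open>
  The radius left over at \<open>y\<close> is \<open>e - p (y - x)\<close>; dividing \<open>p\<close> by it gives the seminorm required at \<open>y\<close>.
\<close>

lemma openin_csn_ball:
  assumes "csn p"
  shows "openin \<tau> {y. p (y - x) < e}"
  unfolding openin_iff
proof
  fix y assume "y \<in> {y. p (y - x) < e}"
  then have d: "e - p (y - x) > 0" by simp
  define q where "q = (\<lambda>z. inverse (e - p (y - x)) * p z)"
  have "csn q" unfolding q_def using d by (intro csn_scale[OF assms]) simp
  moreover have "p (z - x) < e" if "q (z - y) < 1" for z
    using that d csn_triangle[OF assms, of z x y] unfolding q_def by (simp add: field_simps)
  ultimately show "\<exists>p'. csn p' \<and> (\<forall>z. p' (z - y) < 1 \<longrightarrow> z \<in> {y. p (y - x) < e})" by blast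
qed

lemma zero_nbhd_iff: "zero_nbhd \<tau> U \<longleftrightarrow> (\<exists>p. csn p \<and> (\<forall>x. p x < 1 \<longrightarrow> x \<in> U))"
proof
  assume "zero_nbhd \<tau> U"
  then show "\<exists>p. csn p \<and> (\<forall>x. p x < 1 \<longrightarrow> x \<in> U)" by (metis zero_nbhd_csn)
next
  assume "\<exists>p. csn p \<and> (\<forall>x. p x < 1 \<longrightarrow> x \<in> U)"
  then obtain p where p: "csn p" "\<forall>x. p x < 1 \<longrightarrow> x \<in> U" by blast
  then show "zero_nbhd \<tau> U"
    unfolding zero_nbhd_def using openin_csn_ball[OF p(1), of 0 1] csnD(3)[OF p(1)]
    by (intro exI[of _ "{y. p y < 1}"]) auto
qed

lemma limitin_iff: "limitin \<tau> f l F \<longleftrightarrow> (\<forall>p. csn p \<longrightarrow> (\<forall>\<^sub>F i in F. p (f i - l) < 1))"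
proof
  assume L: "limitin \<tau> f l F"
  show "\<forall>p. csn p \<longrightarrow> (\<forall>\<^sub>F i in F. p (f i - l) < 1)"
  proof (intro allI impI)
    fix p assume "csn p"
    from openin_csn_ball[OF this, of l 1] L csnD(3)[OF \<open>csn p\<close>]
    show "\<forall>\<^sub>F i in F. p (f i - l) < 1" unfolding limitin_def by force
  qed
next
  assume *: "\<forall>p. csn p \<longrightarrow> (\<forall>\<^sub>F i in F. p (f i - l) < 1)"
  show "limitin \<tau> f l F"
    unfolding limitin_def
  proof (intro conjI allI impI)
    fix U assume "openin \<tau> U \<and> l \<in> U"
    then obtain p where "csn p" "\<forall>y. p (y - l) < 1 \<longrightarrow> y \<in> U" unfolding openin_iff by blast
    then show "\<forall>\<^sub>F i in F. f i \<in> U" using * by (auto elim!: allE[of _ p] eventually_mono)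
  qed simp
qed

lemma closure_iff: "x \<in> \<tau> closure_of A \<longleftrightarrow> (\<forall>p. csn p \<longrightarrow> (\<exists>a\<in>A. p (a - x) < 1))"
proof
  assume "x \<in> \<tau> closure_of A"
  then have *: "\<And>T. x \<in> T \<Longrightarrow> openin \<tau> T \<Longrightarrow> \<exists>y\<in>A. y \<in> T" by (auto simp: in_closure_of)
  show "\<forall>p. csn p \<longrightarrow> (\<exists>a\<in>A. p (a - x) < 1)"
    using *[OF _ openin_csn_ball] csnD(3) by force
next
  assume *: "\<forall>p. csn p \<longrightarrow> (\<exists>a\<in>A. p (a - x) < 1)"
  show "x \<in> \<tau> closure_of A"
    unfolding in_closure_of
  proof (intro conjI allI impI)
    fix T assume "x \<in> T \<and> openin \<tau> T"
    then obtain p where "csn p" "\<forall>y. p (y - x) < 1 \<longrightarrow> y \<in> T" unfolding openin_iff by blast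
    then show "\<exists>y. y \<in> A \<and> y \<in> T" using * by blast
  qed simp
qed

lemma closure_ex:
  assumes "x \<in> \<tau> closure_of A" "csn p" "e > 0"
  obtains a where "a \<in> A" "p (a - x) < e"
proof -
  have "csn (\<lambda>x. inverse e * p x)" using assms by (intro csn_scale) auto
  then obtain a where "a \<in> A" "inverse e * p (a - x) < 1" using assms(1) unfolding closure_iff by blast
  then show thesis using that assms(3) by (simp add: field_simps)
qed

lemma eventually_csn:
  assumes "limitin \<tau> f l F" "csn p" "e > 0"
  shows "\<forall>\<^sub>F i in F. p (f i - l) < e"
proof -
  have "csn (\<lambda>x. inverse e * p x)" using assms by (intro csn_scale) auto
  then have "\<forall>\<^sub>F i in F. inverse e * p (f i - l) < 1" using assms(1) unfolding limitin_iff by blast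
  then show ?thesis by eventually_elim (use assms(3) in \<open>simp add: field_simps\<close>)
qed

lemma closed_subspace_closure:
  assumes "subspace M"
  shows "subspace (\<tau> closure_of M)"
proof (rule subspaceI)
  show "0 \<in> \<tau> closure_of M"
    using closure_of_subset[of M \<tau>] subspace_0[OF assms] by auto
next
  fix x y assume xy: "x \<in> \<tau> closure_of M" "y \<in> \<tau> closure_of M"
  show "x + y \<in> \<tau> closure_of M"
    unfolding closure_iff
  proof (intro allI impI)
    fix p assume p: "csn p"
    obtain a where a: "a \<in> M" "p (a - x) < 1/2" using closure_ex[OF xy(1) p, of "1/2"] by auto
    obtain b where b: "b \<in> M" "p (b - y) < 1/2" using closure_ex[OF xy(2) p, of "1/2"] by auto
    have "p ((a + b) - (x + y)) < 1"
      using csnD(1)[OF p, of "a - x" "b - y"] a b by (simp add: algebra_simps)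
    then show "\<exists>a\<in>M. p (a - (x + y)) < 1" using subspace_add[OF assms a(1) b(1)] by blast
  qed
next
  fix c x assume x: "x \<in> \<tau> closure_of M"
  show "scl c x \<in> \<tau> closure_of M"
    unfolding closure_iff
  proof (intro allI impI)
    fix p assume p: "csn p"
    have "csn (\<lambda>x. norm c * p x)" using p by (intro csn_scale) auto
    then obtain a where a: "a \<in> M" "norm c * p (a - x) < 1" using x unfolding closure_iff by blast
    then have "p (scl c a - scl c x) < 1"
      using csnD(2)[OF p, of c "a - x"] by (simp add: scale_right_diff_distrib)
    then show "\<exists>a\<in>M. p (a - scl c x) < 1" using subspace_scale[OF assms a(1)] by blast
  qed
qed

end

section \<open>The Hahn-Banach theorem\<close>

context lcs
begin

definition sublinear :: "('a \<Rightarrow> real) \<Rightarrow> bool" where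
  "sublinear p \<longleftrightarrow> (\<forall>x y. p (x + y) \<le> p x + p y) \<and> (\<forall>r\<ge>0. \<forall>x. p (scl (of_real r) x) = r * p x)"

lemma sublinearD:
  assumes "sublinear p"
  shows "p (x + y) \<le> p x + p y" "r \<ge> 0 \<Longrightarrow> p (scl (of_real r) x) = r * p x" "p 0 = 0"
    "- p (- x) \<le> p x"
proof -
  show a: "p (x + y) \<le> p x + p y" and b: "r \<ge> 0 \<Longrightarrow> p (scl (of_real r) x) = r * p x" for x y r
    using assms by (auto simp: sublinear_def)
  show z: "p 0 = 0" using b[of 0 0] by simp
  show "- p (- x) \<le> p x" using a[of x "- x"] z by simp
qed

lemma csn_sublinear: "csn p \<Longrightarrow> sublinear p"
  unfolding sublinear_def by (simp add: csnD(1,2))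

lemma convex_wrt_singleton: "convex_wrt scl {y}"
  unfolding convex_wrt_def
  by (simp flip: scale_left_distrib)

lemma convex_wrt_combine:
  assumes "convex_wrt scl C" "c \<in> C" "d \<in> C" "s \<ge> 0" "t \<ge> 0" "s + t > 0"
  obtains e where "e \<in> C" "scl (of_real s) c + scl (of_real t) d = scl (of_real (s + t)) e"
proof -
  define r where "r = s / (s + t)"
  have r: "0 \<le> r" "r \<le> 1" "1 - r = t / (s + t)" using assms(4-6) by (auto simp: r_def field_simps)
  have "scl (of_real r) c + scl (of_real (1 - r)) d \<in> C"
    using assms(1-3) r(1,2) unfolding convex_wrt_def by blast
  moreover have "scl (of_real (s + t)) (scl (of_real r) c + scl (of_real (1 - r)) d) =
      scl (of_real ((s + t) * r)) c + scl (of_real ((s + t) * (1 - r))) d"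
    by (simp add: scale_right_distrib)
  moreover have "(s + t) * r = s" "(s + t) * (1 - r) = t" using assms(6) by (auto simp: r(3)) (auto simp: r_def)
  ultimately show thesis using that by simp
qed

text \<open>
  The functional \<open>s x = inf {p (x + t c) - t a | t \<ge> 0, c \<in> C}\<close> is the largest sublinear one below
  \<open>p\<close> that satisfies the conclusion. For a singleton \<open>C\<close> and \<open>a = p c\<close> this is one step of the
  Hahn-Banach extension; the general case separates \<open>C\<close> from the origin.
\<close>

lemma sublinear_push:
  assumes p: "sublinear p" and C: "convex_wrt scl C" "C \<noteq> {}" "\<And>c. c \<in> C \<Longrightarrow> a \<le> p c"
  obtains s where "sublinear s" "\<And>x. s x \<le> p x" "\<And>c. c \<in> C \<Longrightarrow> s (- c) \<le> - a"
proof -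
  define V where "V = (\<lambda>x. {p (x + scl (of_real t) c) - t * a | t c. t \<ge> 0 \<and> c \<in> C})"
  define s where "s = (\<lambda>x. Inf (V x))"
  have ne: "V x \<noteq> {}" for x
  proof -
    obtain c where "c \<in> C" using C(2) by blast
    then have "p (x + scl (of_real 0) c) - 0 * a \<in> V x" unfolding V_def by blast
    then show ?thesis by blast
  qed
  have lower: "- p (- x) \<le> v" if v: "v \<in> V x" for v x
  proof -
    obtain t c where tc: "v = p (x + scl (of_real t) c) - t * a" "t \<ge> 0" "c \<in> C"
      using v by (auto simp: V_def)
    have "t * a \<le> p (scl (of_real t) c)"
      using mult_left_mono[OF C(3)[OF tc(3)] tc(2)] sublinearD(2)[OF p tc(2)] by simp
    also have "\<dots> \<le> p (x + scl (of_real t) c) + p (- x)"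
      using sublinearD(1)[OF p, of "x + scl (of_real t) c" "- x"] by simp
    finally show ?thesis using tc(1) by simp
  qed
  then have bdd: "bdd_below (V x)" for x by (intro bdd_belowI)
  have le: "s x \<le> v" if "v \<in> V x" for v x unfolding s_def using cInf_lower[OF that bdd] .
  have ex: "\<exists>v\<in>V x. v < b" if "s x < b" for x b
    using cInf_lessD[OF ne, of x b] that unfolding s_def by blast
  have leI: "s x \<le> p (x + scl (of_real t) c) - t * a" if "t \<ge> 0" "c \<in> C" for x t c
    using that by (intro le) (auto simp: V_def)
  have s_le: "s x \<le> p x" for x
    using leI[of 0 _ x] C(2) by fastforce
  have sub: "s (x + y) \<le> s x + s y" for x y
  proof (rule field_le_epsilon)
    fix e :: real assume e: "e > 0"
    obtain t c where tc: "t \<ge> 0" "c \<in> C" "p (x + scl (of_real t) c) - t * a < s x + e/2"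
      using ex[of x "s x + e/2"] e by (auto simp: V_def)
    obtain r d where rd: "r \<ge> 0" "d \<in> C" "p (y + scl (of_real r) d) - r * a < s y + e/2"
      using ex[of y "s y + e/2"] e by (auto simp: V_def)
    obtain f where f: "f \<in> C" "scl (of_real t) c + scl (of_real r) d = scl (of_real (t + r)) f"
    proof (cases "t + r > 0")
      case True
      then show thesis using that convex_wrt_combine[OF C(1) tc(2) rd(2) tc(1) rd(1)] by metis
    next
      case False
      then have "t = 0" "r = 0" using tc rd by auto
      then show thesis using that[OF tc(2)] by simp
    qed
    have "s (x + y) \<le> p (x + y + scl (of_real (t + r)) f) - (t + r) * a"
      using tc rd f by (intro leI) auto
    also have "x + y + scl (of_real (t + r)) f = (x + scl (of_real t) c) + (y + scl (of_real r) d)"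
      unfolding f(2)[symmetric] by (simp add: algebra_simps)
    also have "p \<dots> \<le> p (x + scl (of_real t) c) + p (y + scl (of_real r) d)"
      using sublinearD(1)[OF p] .
    finally show "s (x + y) \<le> s x + s y + e" using tc rd by (simp add: algebra_simps)
  qed
  have zero: "s 0 = 0"
  proof -
    have "0 \<le> s 0" unfolding s_def using lower[of _ 0] sublinearD(3)[OF p]
      by (intro cInf_greatest[OF ne]) auto
    then show ?thesis using s_le[of 0] sublinearD(3)[OF p] by simp
  qed
  have scale_le: "s (scl (of_real r) x) \<le> r * s x" if r: "r > 0" for r x
  proof -
    have "s (scl (of_real r) x) / r \<le> Inf (V x)"
    proof (rule cInf_greatest[OF ne])
      fix v assume "v \<in> V x"
      then obtain t c where tc: "t \<ge> 0" "c \<in> C" "v = p (x + scl (of_real t) c) - t * a"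
        by (auto simp: V_def)
      have "s (scl (of_real r) x) \<le> p (scl (of_real r) x + scl (of_real (r * t)) c) - (r * t) * a"
        using tc r by (intro leI) auto
      also have "scl (of_real r) x + scl (of_real (r * t)) c = scl (of_real r) (x + scl (of_real t) c)"
        by (simp add: scale_right_distrib)
      also have "p \<dots> - (r * t) * a = r * v"
        using r by (subst sublinearD(2)[OF p]) (auto simp: tc(3) algebra_simps)
      finally show "s (scl (of_real r) x) / r \<le> v" using r by (simp add: field_simps)
    qed
    then show ?thesis using r by (simp add: s_def field_simps)
  qed
  have scale: "s (scl (of_real r) x) = r * s x" if "r \<ge> 0" for r x
  proof (cases "r = 0")
    case True then show ?thesis using zero by simp
  next
    case False
    then have r: "r > 0" using that by simp
    have "s x = s (scl (of_real (inverse r)) (scl (of_real r) x))" using r by simp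
    also have "\<dots> \<le> inverse r * s (scl (of_real r) x)" using r by (intro scale_le) simp
    finally have "r * s x \<le> s (scl (of_real r) x)" using r by (simp add: field_simps)
    then show ?thesis using scale_le[OF r, of x] by simp
  qed
  have "s (- c) \<le> - a" if "c \<in> C" for c
    using leI[of 1 c "- c"] that sublinearD(3)[OF p] by simp
  then show thesis using that[of s] sub scale s_le by (simp add: sublinear_def)
qed

text \<open>
  Minimality in the pointwise order forces \<open>q (- y) = - q y\<close>, since pushing \<open>q\<close> along \<open>y\<close> cannot
  lower it; an odd sublinear functional is additive.
\<close>

lemma minimal_sublinear_additive:
  assumes q: "sublinear q"
    and min: "\<And>s. sublinear s \<Longrightarrow> (\<And>x. s x \<le> q x) \<Longrightarrow> s = q"
  shows "q (x + y) = q x + q y" "q (scl (of_real r) x) = r * q x"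
proof -
  have odd: "q (- y) = - q y" for y
  proof -
    obtain s where s: "sublinear s" "\<And>x. s x \<le> q x" "s (- y) \<le> - q y"
      using sublinear_push[OF q convex_wrt_singleton, of y "q y"] by auto
    then have "s = q" using min by blast
    then show ?thesis using s(3) sublinearD(4)[OF q, of "- y"] by simp
  qed
  show "q (x + y) = q x + q y"
    using sublinearD(1)[OF q, of x y] sublinearD(1)[OF q, of "- x" "- y"] odd[of x] odd[of y] odd[of "x + y"]
    by (simp add: algebra_simps)
  show "q (scl (of_real r) x) = r * q x"
  proof (cases "r \<ge> 0")
    case True then show ?thesis using sublinearD(2)[OF q] by simp
  next
    case False
    then have "q (scl (of_real (- r)) x) = - r * q x" by (intro sublinearD(2)[OF q]) simp
    then show ?thesis using odd[of "scl (of_real r) x"] by simp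
  qed
qed

text \<open>
  Zorn's lemma, ordering the sublinear functionals below \<open>p\<close> downwards. The infimum of a chain is
  finite because each member is at least \<open>- p (- x)\<close> at \<open>x\<close>, and it is subadditive because two
  members of the chain can both be replaced by the smaller one.
\<close>

lemma minimal_sublinear_exists:
  assumes p: "sublinear p"
  obtains q where "sublinear q" "\<And>x. q x \<le> p x"
    "\<And>s. sublinear s \<Longrightarrow> (\<And>x. s x \<le> q x) \<Longrightarrow> s = q"
proof -
  define A where "A = {q. sublinear q \<and> (\<forall>x. q x \<le> p x)}"
  define P where "P = (\<lambda>(q :: 'a \<Rightarrow> real) s. \<forall>x. s x \<le> q x)"
  have po: "partial_order_on A (relation_of P A)"
    unfolding partial_order_on_def preorder_on_def relation_of_def refl_on_def trans_def antisym_def P_def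
    by (auto intro: order_trans intro!: ext) (blast intro: antisym)
  have "\<exists>m\<in>A. \<forall>a\<in>A. P m a \<longrightarrow> a = m"
  proof (rule predicate_Zorn[OF po])
    fix C assume C: "C \<in> Chains (relation_of P A)"
    show "\<exists>u\<in>A. \<forall>a\<in>C. P a u"
    proof (cases "C = {}")
      case True
      then show ?thesis using p by (auto simp: A_def)
    next
      case False
      have CA: "C \<subseteq> A" and tot: "\<And>q s. q \<in> C \<Longrightarrow> s \<in> C \<Longrightarrow> P q s \<or> P s q"
        using C unfolding Chains_def relation_of_def by auto
      define u where "u = (\<lambda>x. Inf ((\<lambda>q. q x) ` C))"
      have bdd: "bdd_below ((\<lambda>q. q x) ` C)" for x
      proof (rule bdd_belowI)
        fix v assume "v \<in> (\<lambda>q. q x) ` C"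
        then obtain q where q: "q \<in> C" "v = q x" by blast
        then have "sublinear q" "q (- x) \<le> p (- x)" using CA by (auto simp: A_def)
        then show "- p (- x) \<le> v" using sublinearD(4)[of q x] q by simp
      qed
      have ne: "(\<lambda>q. q x) ` C \<noteq> {}" for x using False by simp
      have le: "u x \<le> q x" if "q \<in> C" for q x
        unfolding u_def using cInf_lower[OF _ bdd] that by blast
      have ex: "\<exists>q\<in>C. q x < b" if "u x < b" for x b
        using cInf_lessD[OF ne, of x b] that unfolding u_def by blast
      have "u (x + y) \<le> u x + u y" for x y
      proof (rule field_le_epsilon)
        fix e :: real assume e: "e > 0"
        obtain q where q: "q \<in> C" "q x < u x + e/2" using ex[of x "u x + e/2"] e by auto
        obtain s where s: "s \<in> C" "s y < u y + e/2" using ex[of y "u y + e/2"] e by auto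
        obtain w where w: "w \<in> C" "w x \<le> q x" "w y \<le> s y"
          using tot[OF q(1) s(1)] q(1) s(1) unfolding P_def by blast
        have "u (x + y) \<le> w (x + y)" using le[OF w(1)] .
        also have "\<dots> \<le> w x + w y" using w(1) CA sublinearD(1) by (auto simp: A_def)
        finally show "u (x + y) \<le> u x + u y + e" using w q s by simp
      qed
      moreover have "u (scl (of_real r) x) = r * u x" if r: "r \<ge> 0" for r x
      proof -
        have "(\<lambda>q. q (scl (of_real r) x)) ` C = (\<lambda>q. r * q x) ` C"
          using CA r sublinearD(2) by (intro image_cong) (auto simp: A_def)
        moreover have "Inf ((\<lambda>q. r * q x) ` C) = r * Inf ((\<lambda>q. q x) ` C)"
        proof (rule cInf_eq_non_empty)
          show "(\<lambda>q. r * q x) ` C \<noteq> {}" using False by simp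
          show "r * Inf ((\<lambda>q. q x) ` C) \<le> v" if "v \<in> (\<lambda>q. r * q x) ` C" for v
            using that r le[unfolded u_def] by (auto intro: mult_left_mono)
          show "w \<le> r * Inf ((\<lambda>q. q x) ` C)" if w: "\<And>v. v \<in> (\<lambda>q. r * q x) ` C \<Longrightarrow> w \<le> v" for w
          proof (cases "r = 0")
            case True then show ?thesis using w False by auto
          next
            case F: False
            have "w / r \<le> Inf ((\<lambda>q. q x) ` C)"
              using w F r by (intro cInf_greatest[OF ne]) (auto simp: field_simps)
            then show ?thesis using F r by (simp add: field_simps)
          qed
        qed
        ultimately show ?thesis by (simp add: u_def)
      qed
      ultimately have "sublinear u" by (simp add: sublinear_def)
      moreover have "u x \<le> p x" for x
      proof -
        obtain q where q: "q \<in> C" using False by blast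
        then have "q x \<le> p x" using CA by (auto simp: A_def)
        then show ?thesis using le[OF q, of x] by simp
      qed
      ultimately show ?thesis using le by (auto simp: A_def P_def)
    qed
  qed
  then obtain m where m: "m \<in> A" "\<And>a. a \<in> A \<Longrightarrow> P m a \<Longrightarrow> a = m" by blast
  show thesis
  proof (rule that)
    show "sublinear m" "\<And>x. m x \<le> p x" using m(1) by (auto simp: A_def)
    fix s assume s: "sublinear s" "\<And>x. s x \<le> m x"
    then have "s \<in> A" using m(1) by (auto simp: A_def intro: order_trans)
    then show "s = m" using m(2) s(2) by (simp add: P_def)
  qed
qed

section \<open>The dual space\<close>

abbreviation "X' \<equiv> dual scl \<tau>"

lemma dual_linear:
  assumes "\<phi> \<in> X'"
  shows "\<phi> (x + y) = \<phi> x + \<phi> y" "\<phi> (scl c x) = c * \<phi> x" "\<phi> 0 = 0" "\<phi> (- x) = - \<phi> x"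
    "\<phi> (x - y) = \<phi> x - \<phi> y"
proof -
  interpret L: Vector_Spaces.linear scl "(*)" \<phi> using assms by (simp add: dual_def)
  show "\<phi> (x + y) = \<phi> x + \<phi> y" "\<phi> (scl c x) = c * \<phi> x" "\<phi> 0 = 0" "\<phi> (- x) = - \<phi> x"
    "\<phi> (x - y) = \<phi> x - \<phi> y"
    by (rule L.add L.scale L.zero L.neg L.diff)+
qed

lemma vector_space_complex: "vector_space ((*) :: complex \<Rightarrow> complex \<Rightarrow> complex)"
  by unfold_locales (auto simp: algebra_simps)

lemma linear_functionalI:
  assumes "\<And>x y. \<phi> (x + y) = \<phi> x + \<phi> y" "\<And>c x. \<phi> (scl c x) = c * \<phi> x"
  shows "Vector_Spaces.linear scl (*) \<phi>"
  using assms vector_space_complex vector_space_axioms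
  by (simp add: Vector_Spaces.linear_def module_hom_def module_hom_axioms_def module_iff_vector_space)

lemma dualI:
  assumes "\<And>x y. \<phi> (x + y) = \<phi> x + \<phi> y" "\<And>c x. \<phi> (scl c x) = c * \<phi> x"
    and p: "csn p" "\<And>x. norm (\<phi> x) \<le> p x"
  shows "\<phi> \<in> X'"
proof -
  have diff: "\<phi> (x - y) = \<phi> x - \<phi> y" for x y
    using assms(1)[of "x - y" y] by (simp add: algebra_simps)
  have "continuous_map \<tau> euclidean \<phi>"
    unfolding continuous_map_def
  proof (intro conjI allI impI)
    fix U :: "complex set" assume "openin euclidean U"
    then have U: "open U" by simp
    show "openin \<tau> {x \<in> topspace \<tau>. \<phi> x \<in> U}"
      unfolding openin_iff
    proof
      fix x assume "x \<in> {x \<in> topspace \<tau>. \<phi> x \<in> U}"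
      then obtain e where e: "e > 0" "ball (\<phi> x) e \<subseteq> U" using U openE by blast
      have "csn (\<lambda>x. inverse e * p x)" using e p by (intro csn_scale) auto
      moreover have "\<phi> y \<in> U" if "inverse e * p (y - x) < 1" for y
      proof -
        have "norm (\<phi> y - \<phi> x) < e" using that p(2)[of "y - x"] e(1) diff by (simp add: field_simps)
        then show ?thesis using e(2) by (auto simp: dist_norm norm_minus_commute)
      qed
      ultimately show "\<exists>p. csn p \<and> (\<forall>y. p (y - x) < 1 \<longrightarrow> y \<in> {x \<in> topspace \<tau>. \<phi> x \<in> U})"
        by auto
    qed
  qed simp
  then show ?thesis using assms(1,2) linear_functionalI by (simp add: dual_def)
qed

lemma dual_csn:
  assumes "\<phi> \<in> X'"
  shows "csn (\<lambda>x. norm (\<phi> x))"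
proof -
  have "openin \<tau> {x \<in> topspace \<tau>. \<phi> x \<in> ball 0 1}"
    using assms by (intro openin_continuous_map_preimage) (auto simp: dual_def)
  then have "zero_nbhd \<tau> {x. norm (\<phi> x) \<le> 1}"
    unfolding zero_nbhd_def using dual_linear[OF assms] by (intro exI[of _ "{x. norm (\<phi> x) < 1}"]) auto
  then show ?thesis
    using dual_linear[OF assms] by (simp add: csn_def seminorm_def norm_triangle_ineq norm_mult)
qed

lemma dual_add:
  assumes "\<phi> \<in> X'" "\<psi> \<in> X'"
  shows "\<phi> + \<psi> \<in> X'"
  by (rule dualI[OF _ _ csn_add[OF dual_csn[OF assms(1)] dual_csn[OF assms(2)]]])
    (auto simp: dual_linear[OF assms(1)] dual_linear[OF assms(2)] algebra_simps norm_triangle_ineq)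

lemma dual_scale:
  assumes "\<phi> \<in> X'"
  shows "fun_scale (*) c \<phi> \<in> X'"
  by (rule dualI[OF _ _ csn_scale[OF dual_csn[OF assms], of "norm c"]])
    (auto simp: dual_linear[OF assms] algebra_simps fun_scale_def norm_mult)

text \<open>
  Pushing \<open>p\<close> along \<open>C\<close> gives a sublinear functional that is at most \<open>-1\<close> on \<open>- C\<close>; a minimal one
  below it is a real linear \<open>f\<close> with \<open>f \<ge> 1\<close> on \<open>C\<close>, the real part of the complex linear
  functional \<open>x \<mapsto> f x - \<i> f (\<i> x)\<close>.
\<close>

lemma separation:
  assumes p: "csn p" and C: "convex_wrt scl C" "\<And>c. c \<in> C \<Longrightarrow> 1 \<le> p c"
  obtains \<phi> where "\<phi> \<in> X'" "\<And>x. norm (\<phi> x) \<le> p x" "\<And>c. c \<in> C \<Longrightarrow> 1 \<le> Re (\<phi> c)"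
proof (cases "C = {}")
  case True
  have "(\<lambda>x. 0) \<in> X'" by (rule dualI[OF _ _ csn_zero]) auto
  then show thesis using that[of "\<lambda>x. 0"] True csnD(6)[OF p] by simp
next
  case False
  obtain s where s: "sublinear s" "\<And>x. s x \<le> p x" "\<And>c. c \<in> C \<Longrightarrow> s (- c) \<le> - 1"
    using sublinear_push[OF csn_sublinear[OF p] C(1) False C(2)] by blast
  obtain f where f: "sublinear f" "\<And>x. f x \<le> s x"
    "\<And>s. sublinear s \<Longrightarrow> (\<And>x. s x \<le> f x) \<Longrightarrow> s = f"
    using minimal_sublinear_exists[OF s(1)] by blast
  note add = minimal_sublinear_additive(1)[OF f(1,3)]
  note scale = minimal_sublinear_additive(2)[OF f(1,3)]
  have neg: "f (- x) = - f x" for x using scale[of "-1" x] by simp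
  \<comment> \<open>The imaginary part is forced by \<open>Im z = - Re (\<i> * z)\<close>.\<close>
  define \<phi> where "\<phi> = (\<lambda>x. Complex (f x) (- f (scl \<i> x)))"
  have add': "\<phi> (x + y) = \<phi> x + \<phi> y" for x y
    by (simp add: \<phi>_def add scale_right_distrib complex_eq_iff)
  have scale': "\<phi> (scl c x) = c * \<phi> x" for c x
  proof -
    have c1: "of_real (Re c) + of_real (Im c) * \<i> = c"
      and c2: "of_real (Re c) * \<i> + of_real (- Im c) = \<i> * c"
      by (simp_all add: complex_eq_iff)
    have e: "scl c x = scl (of_real (Re c)) x + scl (of_real (Im c)) (scl \<i> x)"
      using arg_cong[OF c1, of "\<lambda>c. scl c x"] by (simp add: scale_left_distrib)
    have "scl \<i> (scl c x) = scl (of_real (Re c)) (scl \<i> x) + scl (of_real (- Im c)) x"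
      using arg_cong[OF c2, of "\<lambda>c. scl c x"] unfolding scale_left_distrib scale_scale by simp
    then have "f (scl \<i> (scl c x)) = Re c * f (scl \<i> x) - Im c * f x"
      by (simp only: add scale)
    moreover have "f (scl c x) = Re c * f x + Im c * f (scl \<i> x)"
      unfolding e by (simp only: add scale)
    ultimately show ?thesis by (simp add: \<phi>_def complex_eq_iff)
  qed
  have bound: "norm (\<phi> x) \<le> p x" for x
  proof (cases "\<phi> x = 0")
    case True then show ?thesis using csnD(6)[OF p] by simp
  next
    case False
    \<comment> \<open>Rotating \<open>x\<close> makes the value of \<open>\<phi>\<close> real and positive, where \<open>\<phi>\<close> agrees with \<open>f\<close>.\<close>
    define c where "c = of_real (norm (\<phi> x)) / \<phi> x"
    have c: "norm c = 1" "c * \<phi> x = of_real (norm (\<phi> x))" using False by (simp_all add: c_def norm_divide)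
    have "norm (\<phi> x) = Re (\<phi> (scl c x))" using scale' c(2) by simp
    also have "\<dots> = f (scl c x)" by (simp add: \<phi>_def)
    also have "\<dots> \<le> p (scl c x)" using f(2) s(2) order_trans by blast
    finally show ?thesis using c(1) csnD(2)[OF p] by simp
  qed
  have "\<phi> \<in> X'" using dualI[OF add' scale' p bound] .
  moreover have "1 \<le> Re (\<phi> c)" if "c \<in> C" for c
    using s(3)[OF that] f(2)[of "- c"] neg[of c] by (simp add: \<phi>_def)
  ultimately show thesis using that bound by blast
qed

text \<open>
  Separate the single vector \<open>x / p x\<close> from the origin.
\<close>

lemma norming_functional:
  assumes p: "csn p"
  obtains \<phi> where "\<phi> \<in> X'" "\<And>y. norm (\<phi> y) \<le> p y" "Re (\<phi> x) = p x"
proof (cases "p x = 0")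
  case True
  have "(\<lambda>x. 0) \<in> X'" by (rule dualI[OF _ _ csn_zero]) auto
  then show thesis using that[of "\<lambda>x. 0"] True csnD(6)[OF p] by simp
next
  case False
  then have px: "p x > 0" using csnD(6)[OF p, of x] by simp
  define r where "r = inverse (p x)"
  have r: "r > 0" "r * p x = 1" using px by (auto simp: r_def)
  have "1 \<le> p (scl (of_real r) x)" using csnD(2)[OF p] r by simp
  then obtain \<phi> where \<phi>: "\<phi> \<in> X'" "\<And>y. norm (\<phi> y) \<le> p y" "1 \<le> Re (\<phi> (scl (of_real r) x))"
    using separation[OF p convex_wrt_singleton, of "scl (of_real r) x"] by auto
  have "1 \<le> r * Re (\<phi> x)" using \<phi>(3) dual_linear(2)[OF \<phi>(1)] by simp
  then have "r * p x \<le> r * Re (\<phi> x)" using r by simp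
  then have "p x \<le> Re (\<phi> x)" using r(1) by simp
  moreover have "Re (\<phi> x) \<le> p x" using \<phi>(2) complex_Re_le_cmod order_trans by blast
  ultimately show thesis using that \<phi> by simp
qed

lemma csn_separates:
  assumes "\<And>p. csn p \<Longrightarrow> p (x - y) < 1"
  shows "x = y"
proof -
  have "limitin \<tau> (\<lambda>_::nat. x) y sequentially" "limitin \<tau> (\<lambda>_::nat. x) x sequentially"
    using assms csnD(3) by (auto simp: limitin_iff)
  moreover have "Hausdorff_space \<tau>" using complex_lcs by (simp add: complex_lcs_def)
  ultimately show ?thesis using limitin_Hausdorff_unique trivial_limit_sequentially by metis
qed

lemma dual_separates:
  assumes "\<And>\<phi>. \<phi> \<in> X' \<Longrightarrow> \<phi> x = \<phi> y"
  shows "x = y"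
proof (rule csn_separates)
  fix p assume p: "csn p"
  obtain \<phi> where \<phi>: "\<phi> \<in> X'" "Re (\<phi> (x - y)) = p (x - y)" using norming_functional[OF p] by metis
  then show "p (x - y) < 1" using assms[OF \<phi>(1)] dual_linear(5)[OF \<phi>(1), of x y] by simp
qed

text \<open>
  Separate the translate \<open>M - x\<close> from the origin. The real part of a functional is bounded below on
  a subspace only if the functional vanishes there.
\<close>

lemma closed_subspace_annihilator:
  assumes M: "subspace M" and x: "x \<notin> \<tau> closure_of M"
  obtains \<phi> where "\<phi> \<in> X'" "\<And>y. y \<in> M \<Longrightarrow> \<phi> y = 0" "\<phi> x \<noteq> 0"
proof -
  obtain p where p: "csn p" "\<And>y. y \<in> M \<Longrightarrow> p (y - x) \<ge> 1"
    using x unfolding closure_iff by force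
  define C where "C = (\<lambda>y. y - x) ` M"
  have "convex_wrt scl C"
    unfolding convex_wrt_def C_def
  proof (intro ballI allI impI)
    fix a b t assume "a \<in> (\<lambda>y. y - x) ` M" "b \<in> (\<lambda>y. y - x) ` M"
    then obtain u v where uv: "u \<in> M" "v \<in> M" "a = u - x" "b = v - x" by blast
    have "scl (of_real t) a + scl (of_real (1 - t)) b =
        (scl (of_real t) u + scl (of_real (1 - t)) v) - scl (of_real t + of_real (1 - t)) x"
      unfolding uv by (simp add: scale_right_diff_distrib scale_left_distrib scale_left_diff_distrib algebra_simps)
    then have "scl (of_real t) a + scl (of_real (1 - t)) b =
        (scl (of_real t) u + scl (of_real (1 - t)) v) - x" by simp
    moreover have "scl (of_real t) u + scl (of_real (1 - t)) v \<in> M"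
      using uv M by (intro subspace_add subspace_scale)
    ultimately show "scl (of_real t) a + scl (of_real (1 - t)) b \<in> (\<lambda>y. y - x) ` M" by blast
  qed
  moreover have "1 \<le> p c" if "c \<in> C" for c using p(2) that by (auto simp: C_def)
  ultimately obtain \<phi> where \<phi>: "\<phi> \<in> X'" "\<And>c. c \<in> C \<Longrightarrow> 1 \<le> Re (\<phi> c)"
    using separation[OF p(1), of C] by metis
  have ge: "1 + Re (\<phi> x) \<le> Re (\<phi> y)" if "y \<in> M" for y
    using \<phi>(2)[of "y - x"] that dual_linear[OF \<phi>(1)] by (simp add: C_def)
  have "\<phi> y = 0" if y: "y \<in> M" for y
  proof (rule ccontr)
    assume "\<phi> y \<noteq> 0"
    \<comment> \<open>On the multiple \<open>scl c y\<close> of \<open>y\<close> the functional takes the value \<open>Re (\<phi> x)\<close>, below the bound.\<close>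
    define c where "c = of_real (Re (\<phi> x)) / \<phi> y"
    have "scl c y \<in> M" using M y by (rule subspace_scale)
    from ge[OF this] show False using \<open>\<phi> y \<noteq> 0\<close> by (simp add: dual_linear[OF \<phi>(1)] c_def)
  qed
  moreover have "\<phi> x \<noteq> 0"
    using ge[OF subspace_0[OF M]] dual_linear(3)[OF \<phi>(1)] by auto
  ultimately show thesis using that \<phi>(1) by blast
qed

end

section \<open>Weak topologies\<close>

lemma limitin_generated:
  "limitin (topology_generated_by B) f l F \<longleftrightarrow>
    l \<in> \<Union>B \<and> (\<forall>U\<in>B. l \<in> U \<longrightarrow> (\<forall>\<^sub>F i in F. f i \<in> U))" (is "?L \<longleftrightarrow> ?R")
proof
  assume ?L
  then show ?R by (auto simp: limitin_def topology_generated_by_Basis)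
next
  assume R: ?R
  have "l \<in> U \<longrightarrow> (\<forall>\<^sub>F i in F. f i \<in> U)" if "generate_topology_on B U" for U
    using that
  proof induction
    case (UN \<U>)
    show ?case
    proof
      assume "l \<in> \<Union>\<U>"
      then obtain V where V: "V \<in> \<U>" "l \<in> V" by blast
      then have "\<forall>\<^sub>F i in F. f i \<in> V" using UN.IH by blast
      then show "\<forall>\<^sub>F i in F. f i \<in> \<Union>\<U>" using V by (auto elim: eventually_mono)
    qed
  qed (use R in \<open>auto intro: eventually_conj\<close>)
  then show ?L using R by (simp add: limitin_def openin_topology_generated_by_iff)
qed

text \<open>
  Applied below to product topologies, where it turns pointwise convergence of operators into
  membership in \<open>K\<close> or \<open>K'\<close>.
\<close>

lemma limitin_in_closure_of:
  assumes "limitin X f l F" "F \<noteq> bot" "\<forall>\<^sub>F \<alpha> in F. f \<alpha> \<in> C"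
  shows "l \<in> X closure_of C"
  unfolding in_closure_of
proof (intro conjI allI impI)
  show "l \<in> topspace X" using assms(1) by (simp add: limitin_def)
  fix T assume "l \<in> T \<and> openin X T"
  then have "\<forall>\<^sub>F \<alpha> in F. f \<alpha> \<in> T" using assms(1) by (simp add: limitin_def)
  with assms(3) have "\<forall>\<^sub>F \<alpha> in F. f \<alpha> \<in> C \<and> f \<alpha> \<in> T" by (rule eventually_conj)
  then show "\<exists>y. y \<in> C \<and> y \<in> T" using eventually_happens'[OF assms(2)] by blast
qed

text \<open>
  The elements of \<open>K\<close> and \<open>K'\<close> inherit their properties from the convex hull through this
  principle, with \<open>g\<close> built from evaluations.
\<close>

lemma continuous_map_closure_in_closed:
  assumes "R \<in> X closure_of A" "continuous_map X euclidean g" "closed B" "\<And>T. T \<in> A \<Longrightarrow> g T \<in> B"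
  shows "g R \<in> B"
proof -
  have "closedin X {T \<in> topspace X. g T \<in> B}"
    using assms(2,3) by (intro closedin_continuous_map_preimage) auto
  moreover have "R \<in> X closure_of (topspace X \<inter> A)"
    using assms(1) by (metis closure_of_restrict)
  ultimately show ?thesis
    using closure_of_minimal[of "topspace X \<inter> A" "{T \<in> topspace X. g T \<in> B}" X] assms(4) by blast
qed

context lcs
begin

abbreviation "weak \<equiv> weak_topology scl \<tau>"
abbreviation "weakstar \<equiv> weakstar_topology scl \<tau>"

lemma zero_in_dual: "0 \<in> X'"
  by (rule dualI[OF _ _ csn_zero]) auto

lemma topspace_weak [simp]: "topspace weak = UNIV"
  using zero_in_dual unfolding weak_topology_def by (auto intro!: exI[of _ "UNIV :: 'a set"] exI[of _ 0] exI[of _ "UNIV :: complex set"])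

lemma topspace_weakstar [simp]: "topspace weakstar = X'"
  unfolding weakstar_topology_def by (auto intro!: exI[of _ X'] exI[of _ "UNIV :: complex set"])

lemma limitin_weak:
  "limitin weak f l F \<longleftrightarrow> (\<forall>\<phi>\<in>X'. ((\<lambda>i. \<phi> (f i)) \<longlongrightarrow> \<phi> l) F)"
proof -
  have "l \<in> \<Union>{\<phi> -` U | \<phi> U. \<phi> \<in> X' \<and> open U}"
    using topspace_weak unfolding weak_topology_def by simp
  then have "limitin weak f l F \<longleftrightarrow>
      (\<forall>\<phi>\<in>X'. \<forall>U. open U \<longrightarrow> \<phi> l \<in> U \<longrightarrow> (\<forall>\<^sub>F i in F. f i \<in> \<phi> -` U))"
    unfolding weak_topology_def limitin_generated by blast
  then show ?thesis unfolding tendsto_def vimage_eq .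
qed

lemma limitin_weakstar:
  "limitin weakstar f l F \<longleftrightarrow>
    l \<in> X' \<and> (\<forall>\<^sub>F i in F. f i \<in> X') \<and> (\<forall>x. ((\<lambda>i. f i x) \<longlongrightarrow> l x) F)" (is "?L \<longleftrightarrow> ?R")
proof -
  have u: "(\<Union>{{\<phi> \<in> X'. \<phi> x \<in> U} | x U. open U}) = X'"
    using topspace_weakstar unfolding weakstar_topology_def by simp
  show ?thesis
  proof
    assume L: ?L
    note L' = L[unfolded weakstar_topology_def limitin_generated u]
    have l: "l \<in> X'" using L' by (rule conjunct1)
    have *: "\<forall>\<^sub>F i in F. f i \<in> {\<phi> \<in> X'. \<phi> x \<in> U}" if "open U" "l x \<in> U" for x U
    proof -
      have "{\<phi> \<in> X'. \<phi> x \<in> U} \<in> {{\<phi> \<in> X'. \<phi> x \<in> U} | x U. open U}" using that by blast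
      from bspec[OF L'[THEN conjunct2] this] show ?thesis using l that by simp
    qed
    note l
    moreover have "\<forall>\<^sub>F i in F. f i \<in> X'" using *[of UNIV] by simp
    moreover have "\<forall>\<^sub>F i in F. f i x \<in> U" if "open U" "l x \<in> U" for x U
      using *[OF that] by (rule eventually_mono) simp
    ultimately show ?R by (simp add: tendsto_def)
  next
    assume ?R
    then show ?L
      unfolding weakstar_topology_def limitin_generated u by (auto simp: tendsto_def eventually_conj_iff)
  qed
qed

lemma limitin_weak_if_limitin: "limitin \<tau> f l F \<Longrightarrow> limitin weak f l F"
  unfolding limitin_weak tendsto_iff dist_norm
proof (intro ballI allI impI)
  fix \<phi> and e :: real assume "limitin \<tau> f l F" "\<phi> \<in> X'" "e > 0"
  from eventually_csn[OF this(1) dual_csn[OF this(2)] this(3)]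
  show "\<forall>\<^sub>F i in F. norm (\<phi> (f i) - \<phi> l) < e" using dual_linear(5)[OF \<open>\<phi> \<in> X'\<close>] by simp
qed

lemma continuous_map_weak:
  assumes "\<phi> \<in> X'"
  shows "continuous_map weak euclidean \<phi>"
  unfolding continuous_map_def
proof (intro conjI allI impI)
  fix U :: "complex set" assume "openin euclidean U"
  then have "openin weak (\<phi> -` U)"
    unfolding weak_topology_def using assms by (intro topology_generated_by_Basis) auto
  then show "openin weak {x \<in> topspace weak. \<phi> x \<in> U}" by (simp add: vimage_def)
qed simp

lemma continuous_map_weakstar_eval: "continuous_map weakstar euclidean (\<lambda>\<phi>. \<phi> x)"
  unfolding continuous_map_def
proof (intro conjI allI impI)
  fix U :: "complex set" assume "openin euclidean U"
  then show "openin weakstar {\<phi> \<in> topspace weakstar. \<phi> x \<in> U}"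
    unfolding topspace_weakstar unfolding weakstar_topology_def
    by (intro topology_generated_by_Basis) auto
qed simp

lemma continuous_map_id_weak: "continuous_map \<tau> weak id"
  unfolding weak_topology_def
proof (rule continuous_on_generated_topo)
  fix U assume "U \<in> {\<phi> -` U |\<phi> U. \<phi> \<in> X' \<and> open U}"
  then obtain \<phi> V where U: "U = \<phi> -` V" "\<phi> \<in> X'" "open V" by blast
  then have "openin \<tau> {x \<in> topspace \<tau>. \<phi> x \<in> V}"
    by (intro openin_continuous_map_preimage[of _ euclidean]) (auto simp: dual_def)
  then show "openin \<tau> (id -` U \<inter> topspace \<tau>)" using U(1) by (simp add: vimage_def)
next
  show "id ` topspace \<tau> \<subseteq> \<Union> {\<phi> -` U |\<phi> U. \<phi> \<in> X' \<and> open U}"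
    using topspace_weak unfolding weak_topology_def by simp
qed

end

section \<open>Convex hulls of operators and their pointwise closures\<close>

lemma co_convex:
  fixes scl :: "complex \<Rightarrow> 'b::ab_group_add \<Rightarrow> 'b"
  assumes "T \<in> co scl S" "U \<in> co scl S" "0 \<le> t" "t \<le> (1::real)"
  shows "(\<lambda>x. scl (of_real t) (T x) + scl (of_real (1 - t)) (U x)) \<in> co scl S"
proof -
  have "convex_wrt (fun_scale scl) (co scl S)"
    unfolding co_def
  proof (rule hull_in)
    fix \<T> :: "('b \<Rightarrow> 'b) set set" assume "Ball \<T> (convex_wrt (fun_scale scl))"
    then show "convex_wrt (fun_scale scl) (\<Inter>\<T>)" unfolding convex_wrt_def by blast
  qed
  then have "fun_scale scl (of_real t) T + fun_scale scl (of_real (1 - t)) U \<in> co scl S"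
    using assms unfolding convex_wrt_def by blast
  then show ?thesis by (simp add: fun_scale_def plus_fun_def)
qed

lemma co_superset: "T \<in> S \<Longrightarrow> T \<in> co scl S"
  unfolding co_def by (rule hull_inc)

lemma co_induct [consumes 1, case_names incl conv]:
  fixes scl :: "complex \<Rightarrow> 'b::ab_group_add \<Rightarrow> 'b"
  assumes "T \<in> co scl S" "\<And>T. T \<in> S \<Longrightarrow> P T"
    "\<And>T U t. P T \<Longrightarrow> P U \<Longrightarrow> 0 \<le> t \<Longrightarrow> t \<le> (1::real) \<Longrightarrow>
      P (\<lambda>x. scl (of_real t) (T x) + scl (of_real (1 - t)) (U x))"
  shows "P T"
  using assms(1) unfolding co_def
proof (rule hull_induct)
  show "convex_wrt (fun_scale scl) {T. P T}"
    unfolding convex_wrt_def using assms(3) by (simp add: fun_scale_def plus_fun_def)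
qed (fact assms(2))

locale lcs_semigroup = lcs +
  fixes S :: "('a \<Rightarrow> 'a) set"
  assumes S_operators: "S \<subseteq> continuous_operators scl \<tau>"
    and S_semigroup: "operator_semigroup S"
begin

abbreviation "coS \<equiv> co scl S"
abbreviation "K \<equiv> K_space scl \<tau> S"
abbreviation "S' \<equiv> adjoint_semigroup scl \<tau> S"
abbreviation "coS' \<equiv> co (fun_scale (*)) S'"
abbreviation "K' \<equiv> K_dual scl \<tau> S"
abbreviation "Fix \<equiv> fix_on UNIV S"
abbreviation "Fix' \<equiv> fix_on X' S'"
abbreviation "Ran \<equiv> closed_lin scl \<tau> (rg_Id_minus S)"

lemma S_linear:
  assumes "T \<in> S"
  shows "T (x + y) = T x + T y" "T (scl c x) = scl c (T x)" "T (x - y) = T x - T y" "T 0 = 0"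
proof -
  interpret L: Vector_Spaces.linear scl scl T
    using assms S_operators by (auto simp: continuous_operators_def)
  show "T (x + y) = T x + T y" "T (scl c x) = scl c (T x)" "T (x - y) = T x - T y" "T 0 = 0"
    by (rule L.add L.scale L.diff L.zero)+
qed

lemma S_comp: "T \<in> S \<Longrightarrow> U \<in> S \<Longrightarrow> T \<circ> U \<in> S"
  using S_semigroup by (simp add: operator_semigroup_def)

lemma S_nonempty: "S \<noteq> {}"
  using S_semigroup by (simp add: operator_semigroup_def)

lemma dual_comp:
  assumes "\<phi> \<in> X'" "T \<in> S"
  shows "\<phi> \<circ> T \<in> X'"
proof -
  have "continuous_map \<tau> \<tau> T" using assms S_operators by (auto simp: continuous_operators_def)
  then have "continuous_map \<tau> euclidean (\<phi> \<circ> T)"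
    using assms(1) by (auto simp: dual_def intro: continuous_map_compose)
  moreover have "Vector_Spaces.linear scl (*) (\<phi> \<circ> T)"
    by (rule linear_functionalI) (simp_all add: S_linear[OF assms(2)] dual_linear[OF assms(1)])
  ultimately show ?thesis by (simp add: dual_def)
qed

lemma csn_comp:
  assumes "csn p" "T \<in> S"
  shows "csn (\<lambda>x. p (T x))"
proof -
  have "continuous_map \<tau> \<tau> T" using assms S_operators by (auto simp: continuous_operators_def)
  from openin_continuous_map_preimage[OF this openin_csn_ball[OF assms(1), of 0 1]]
  have "openin \<tau> {x. p (T x) < 1}" by simp
  then have "zero_nbhd \<tau> {x. p (T x) \<le> 1}"
    unfolding zero_nbhd_def using S_linear[OF assms(2)] csnD(3)[OF assms(1)]
    by (intro exI[of _ "{x. p (T x) < 1}"]) auto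
  then show ?thesis
    using csnD(1,2)[OF assms(1)] by (simp add: csn_def seminorm_def S_linear[OF assms(2)])
qed

lemma Fix_iff: "x \<in> Fix \<longleftrightarrow> (\<forall>T\<in>S. T x = x)"
  by (simp add: fix_on_def)

lemma Fix'_iff: "\<phi> \<in> Fix' \<longleftrightarrow> \<phi> \<in> X' \<and> (\<forall>T\<in>S. \<forall>x. \<phi> (T x) = \<phi> x)"
  by (auto simp: fix_on_def adjoint_semigroup_def adjoint_on_def fun_eq_iff)

lemma Fix'_dual: "\<phi> \<in> Fix' \<Longrightarrow> \<phi> \<in> X'"
  by (rule Fix'_iff[THEN iffD1, THEN conjunct1])

lemma Fix'_apply: "\<phi> \<in> Fix' \<Longrightarrow> T \<in> S \<Longrightarrow> \<phi> (T x) = \<phi> x"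
  by (rule Fix'_iff[THEN iffD1, THEN conjunct2, rule_format])

lemma Fix'I: "\<phi> \<in> X' \<Longrightarrow> (\<And>T x. T \<in> S \<Longrightarrow> \<phi> (T x) = \<phi> x) \<Longrightarrow> \<phi> \<in> Fix'"
  by (rule Fix'_iff[THEN iffD2, OF conjI]) auto

lemma Ran_subspace: "subspace Ran"
  unfolding closed_lin_def by (intro closed_subspace_closure subspace_span)

text \<open>
  A functional is fixed by \<open>S'\<close> if and only if it vanishes on \<open>rg (Id - S)\<close>, and the Hahn-Banach
  theorem recovers a closed subspace from its annihilator.
\<close>

lemma Ran_iff: "x \<in> Ran \<longleftrightarrow> (\<forall>\<phi>\<in>Fix'. \<phi> x = 0)"
proof
  assume x: "x \<in> Ran"
  show "\<forall>\<phi>\<in>Fix'. \<phi> x = 0"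
  proof
    fix \<phi> assume \<phi>: "\<phi> \<in> Fix'"
    then have \<phi>': "\<phi> \<in> X'" by (rule Fix'_dual)
    have vanish: "\<phi> y \<in> {0}" if "y \<in> span (rg_Id_minus S)" for y
      using that
    proof (induction rule: span_induct_alt)
      case base show ?case using dual_linear[OF \<phi>'] by simp
    next
      case (step c z y)
      then obtain u T where "z = u - T u" "T \<in> S" by (auto simp: rg_Id_minus_def)
      then have "z = u - T u" "\<phi> (T u) = \<phi> u" using Fix'_apply[OF \<phi>] by auto
      then show ?case using step by (simp add: dual_linear[OF \<phi>'])
    qed
    have "continuous_map \<tau> euclidean \<phi>" using \<phi>' by (simp add: dual_def)
    from continuous_map_closure_in_closed[OF x[unfolded closed_lin_def] this closed_singleton vanish]
    show "\<phi> x = 0" by simp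
  qed
next
  assume *: "\<forall>\<phi>\<in>Fix'. \<phi> x = 0"
  show "x \<in> Ran"
  proof (rule ccontr)
    assume "x \<notin> Ran"
    then obtain \<phi> where \<phi>: "\<phi> \<in> X'" "\<And>y. y \<in> span (rg_Id_minus S) \<Longrightarrow> \<phi> y = 0" "\<phi> x \<noteq> 0"
      unfolding closed_lin_def using closed_subspace_annihilator[OF subspace_span] by metis
    have "\<phi> (T y) = \<phi> y" if "T \<in> S" for T y
    proof -
      have "y - T y \<in> span (rg_Id_minus S)" using that by (intro span_base) (auto simp: rg_Id_minus_def)
      from \<phi>(2)[OF this] show ?thesis using dual_linear[OF \<phi>(1)] by simp
    qed
    then have "\<phi> \<in> Fix'" by (rule Fix'I[OF \<phi>(1)])
    then show False using * \<phi>(3) by blast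
  qed
qed

lemma coS_linear:
  assumes "T \<in> coS"
  shows "T (x + y) = T x + T y" "T (scl c x) = scl c (T x)" "T (x - y) = T x - T y"
proof -
  have "(\<forall>x y. T (x + y) = T x + T y) \<and> (\<forall>c x. T (scl c x) = scl c (T x))"
    using assms
  proof (induction rule: co_induct)
    case (conv T U t)
    then show ?case
      by (auto simp: scale_right_distrib add_ac mult_ac)
  qed (simp add: S_linear)
  then show a: "T (x + y) = T x + T y" and "T (scl c x) = scl c (T x)" for x y c by auto
  show "T (x - y) = T x - T y" using a[of "x - y" y] by (simp add: algebra_simps)
qed

text \<open>
  Induction on each factor separately; the induction on the right factor uses that \<open>T\<close> is linear.
\<close>

lemma coS_comp:
  assumes "T \<in> coS" "U \<in> coS"
  shows "T \<circ> U \<in> coS"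
  using assms(2)
proof (induction rule: co_induct)
  case (incl U)
  show ?case using assms(1)
  proof (induction rule: co_induct)
    case (incl T)
    then show ?case using S_comp[OF _ \<open>U \<in> S\<close>] co_superset by blast
  next
    case (conv T V t)
    then show ?case using co_convex[of "T \<circ> U" scl S "V \<circ> U" t] by (simp add: comp_def)
  qed
next
  case (conv U V t)
  then show ?case
    using co_convex[of "T \<circ> U" scl S "T \<circ> V" t] by (simp add: comp_def coS_linear[OF assms(1)])
qed

lemma convex_combination_same: "scl (of_real t) x + scl (of_real (1 - t)) x = x"
  by (simp flip: scale_left_distrib)

lemma coS_fix:
  assumes "T \<in> coS" "x \<in> Fix"
  shows "T x = x"
  using assms(1)
proof (induction rule: co_induct)
  case (conv T U t)
  show ?case unfolding conv by (rule convex_combination_same)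
qed (use assms(2) in \<open>simp add: Fix_iff\<close>)

lemma coS_fix':
  assumes "T \<in> coS" "\<phi> \<in> Fix'"
  shows "\<phi> (T x) = \<phi> x"
  using assms(1)
proof (induction rule: co_induct)
  case (conv T U t)
  moreover have "\<phi> \<in> X'" by (rule Fix'_dual[OF assms(2)])
  ultimately show ?case by (simp add: dual_linear algebra_simps)
qed (use assms(2) Fix'_apply in simp)

lemma coS_bound:
  assumes "T \<in> coS" "seminorm p" "\<And>T. T \<in> S \<Longrightarrow> p (T x) \<le> b"
  shows "p (T x) \<le> b"
  using assms(1)
proof (induction rule: co_induct)
  case (conv T U t)
  have "p (scl (of_real t) (T x) + scl (of_real (1 - t)) (U x)) \<le>
      p (scl (of_real t) (T x)) + p (scl (of_real (1 - t)) (U x))"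
    by (rule seminormD(1)[OF assms(2)])
  also have "\<dots> = t * p (T x) + (1 - t) * p (U x)"
    unfolding seminormD(2)[OF assms(2)] norm_of_real using conv by simp
  also have "\<dots> \<le> t * b + (1 - t) * b"
    using conv by (intro add_mono mult_left_mono) auto
  finally show ?case by (simp add: algebra_simps)
qed (fact assms(3))

lemma continuous_map_eval:
  assumes "\<phi> \<in> X'"
  shows "continuous_map (product_topology (\<lambda>_. weak) UNIV) euclidean (\<lambda>R. \<phi> (R x))"
  using continuous_map_compose[OF continuous_map_product_projection[of x UNIV "\<lambda>_. weak"]
      continuous_map_weak[OF assms]] by (simp add: comp_def)

lemma K_closed:
  assumes "R \<in> K" "continuous_map (product_topology (\<lambda>_. weak) UNIV) euclidean g" "closed B"
    "\<And>T. T \<in> coS \<Longrightarrow> g T \<in> B"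
  shows "g R \<in> B"
  using assms(1) unfolding K_space_def pointwise_closure_def topspace_weak
  by (rule continuous_map_closure_in_closed[OF _ assms(2-4)])

lemma coS_subset_K: "coS \<subseteq> K"
  unfolding K_space_def pointwise_closure_def by (intro closure_of_subset) auto

lemma K_fix':
  assumes "R \<in> K" "\<phi> \<in> Fix'"
  shows "\<phi> (R x) = \<phi> x"
proof -
  have "\<phi> (R x) \<in> {\<phi> x}"
    by (rule K_closed[OF assms(1) continuous_map_eval[OF Fix'_dual[OF assms(2)]]])
      (simp_all add: coS_fix'[OF _ assms(2)])
  then show ?thesis by simp
qed

lemma K_fix:
  assumes "R \<in> K" "x \<in> Fix"
  shows "R x = x"
proof (rule dual_separates)
  fix \<phi> assume \<phi>: "\<phi> \<in> X'"
  have "\<phi> (R x) \<in> {\<phi> x}"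
    by (rule K_closed[OF assms(1) continuous_map_eval[OF \<phi>]]) (simp_all add: coS_fix[OF _ assms(2)])
  then show "\<phi> (R x) = \<phi> x" by simp
qed

lemma K_linear:
  assumes "R \<in> K"
  shows "R (x + y) = R x + R y" "R (scl c x) = scl c (R x)" "R (x - y) = R x - R y"
proof -
  show a: "R (x + y) = R x + R y" for x y
  proof (rule dual_separates)
    fix \<phi> assume \<phi>: "\<phi> \<in> X'"
    have "\<phi> (R (x + y)) - (\<phi> (R x) + \<phi> (R y)) \<in> {0}"
      by (rule K_closed[OF assms, of "\<lambda>R. \<phi> (R (x + y)) - (\<phi> (R x) + \<phi> (R y))"])
        (auto intro!: continuous_map_diff continuous_map_add continuous_map_eval \<phi>
          simp: coS_linear dual_linear[OF \<phi>])
    then show "\<phi> (R (x + y)) = \<phi> (R x + R y)" by (simp add: dual_linear[OF \<phi>])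
  qed
  show "R (scl c x) = scl c (R x)"
  proof (rule dual_separates)
    fix \<phi> assume \<phi>: "\<phi> \<in> X'"
    have cont: "continuous_map (product_topology (\<lambda>_. weak) UNIV) euclidean (\<lambda>R. c * \<phi> (R x))"
      using continuous_map_eval[OF dual_scale[OF \<phi>, of c]] by (simp add: fun_scale_def)
    have "\<phi> (R (scl c x)) - c * \<phi> (R x) \<in> {0}"
      by (rule K_closed[OF assms, of "\<lambda>R. \<phi> (R (scl c x)) - c * \<phi> (R x)"])
        (auto intro!: continuous_map_diff cont continuous_map_eval \<phi>
          simp: coS_linear dual_linear[OF \<phi>])
    then show "\<phi> (R (scl c x)) = \<phi> (scl c (R x))" by (simp add: dual_linear[OF \<phi>])
  qed
  show "R (x - y) = R x - R y" using a[of "x - y" y] by (simp add: algebra_simps)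
qed

text \<open>
  A weakly closed bound: \<open>p (R x)\<close> is attained by a functional \<open>\<phi>\<close> dominated by \<open>p\<close>, and
  \<open>norm (\<phi> (T x)) \<le> b\<close> passes from \<open>co S\<close> to \<open>R\<close>.
\<close>

lemma K_bound:
  assumes "R \<in> K" "csn p" "\<And>T. T \<in> S \<Longrightarrow> p (T x) \<le> b"
  shows "p (R x) \<le> b"
proof -
  obtain \<phi> where \<phi>: "\<phi> \<in> X'" "\<And>y. norm (\<phi> y) \<le> p y" "Re (\<phi> (R x)) = p (R x)"
    using norming_functional[OF assms(2)] by metis
  have "\<phi> (R x) \<in> cball 0 b"
  proof (rule K_closed[OF assms(1) continuous_map_eval[OF \<phi>(1)]])
    fix T assume "T \<in> coS"
    then have "p (T x) \<le> b" using coS_bound csn_seminorm[OF assms(2)] assms(3) by blast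
    then show "\<phi> (T x) \<in> cball 0 b" using \<phi>(2)[of "T x"] by simp
  qed simp
  then show ?thesis using complex_Re_le_cmod[of "\<phi> (R x)"] \<phi>(3) by simp
qed

lemma pointwise_closure_subset_K: "pointwise_closure \<tau> coS \<subseteq> K"
proof -
  have "continuous_map (product_topology (\<lambda>_. \<tau>) UNIV) (product_topology (\<lambda>_. weak) (UNIV :: 'a set)) id"
    unfolding continuous_map_componentwise_UNIV
  proof
    fix x :: 'a
    show "continuous_map (product_topology (\<lambda>_. \<tau>) UNIV) weak (\<lambda>R. id R x)"
      using continuous_map_compose[OF continuous_map_product_projection[of x UNIV "\<lambda>_. \<tau>"]
          continuous_map_id_weak] by (simp add: comp_def)
  qed
  from continuous_map_image_closure_subset[OF this, of coS]
  show ?thesis unfolding K_space_def pointwise_closure_def by simp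
qed

lemma Ran_invariant: "R \<in> K \<Longrightarrow> x \<in> Ran \<Longrightarrow> R x \<in> Ran"
  by (simp add: Ran_iff K_fix')

end

section \<open>Invariant means\<close>

text \<open>
  Splitting \<open>f\<close> into real and imaginary part, positivity forces \<open>m\<close> to be real on bounded real
  functions, after adding a constant.
\<close>

lemma right_invariant_mean_Re_ge:
  assumes m: "right_invariant_mean T mul m" and f: "f \<in> Cb T"
    and a: "\<And>t. t \<in> topspace T \<Longrightarrow> a \<le> Re (f t)"
  shows "a \<le> Re (m f)"
proof -
  have add: "m (\<lambda>t\<in>topspace T. f t + g t) = m f + m g" if "f \<in> Cb T" "g \<in> Cb T" for f g
    using m that unfolding right_invariant_mean_def by blast
  have scale: "m (\<lambda>t\<in>topspace T. c * f t) = c * m f" if "f \<in> Cb T" for f c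
    using m that unfolding right_invariant_mean_def by blast
  have pos: "m f \<in> \<real>\<^sub>\<ge>\<^sub>0" if "f \<in> Cb T" "\<forall>t\<in>topspace T. f t \<in> \<real>\<^sub>\<ge>\<^sub>0" for f
    using m that unfolding right_invariant_mean_def by blast
  have one: "m (\<lambda>t\<in>topspace T. 1) = 1"
    using m unfolding right_invariant_mean_def by blast
  have Cb1: "(\<lambda>t\<in>topspace T. 1) \<in> Cb T"
  proof -
    have "continuous_map T euclidean (\<lambda>t\<in>topspace T. 1 :: complex)"
      by (rule continuous_map_eq[of _ _ "\<lambda>_. 1"]) auto
    moreover have "bounded ((\<lambda>t\<in>topspace T. 1 :: complex) ` topspace T)"
      by (rule bounded_subset[of "{1}"]) auto
    ultimately show ?thesis by (simp add: Cb_def)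
  qed
  have real: "Im (m (\<lambda>t\<in>topspace T. of_real (h t))) = 0 \<and> b \<le> Re (m (\<lambda>t\<in>topspace T. of_real (h t)))"
    if h: "continuous_map T euclidean h" "bounded (h ` topspace T)" "\<And>t. t \<in> topspace T \<Longrightarrow> b \<le> h t"
    for h :: "_ \<Rightarrow> real" and b
  proof -
    define g where "g = (\<lambda>t\<in>topspace T. complex_of_real (h t - b))"
    have "continuous_map T euclidean (\<lambda>t. h t - b)"
      using h(1) by (intro continuous_map_diff) auto
    then have "continuous_map T euclidean (complex_of_real \<circ> (\<lambda>t. h t - b))"
      by (intro continuous_map_compose) (auto intro!: continuous_intros)
    then have "continuous_map T euclidean g"
      by (rule continuous_map_eq) (simp add: g_def)
    moreover have "bounded (g ` topspace T)"
    proof -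
      obtain M where M: "\<And>t. t \<in> topspace T \<Longrightarrow> norm (h t) \<le> M" using h(2) unfolding bounded_iff by auto
      have "norm (g t) \<le> M + \<bar>b\<bar>" if "t \<in> topspace T" for t
        using M[OF that] that by (simp add: g_def flip: of_real_diff)
      then show ?thesis unfolding bounded_iff by auto
    qed
    ultimately have g: "g \<in> Cb T" by (simp add: Cb_def g_def)
    have Cbb: "(\<lambda>t\<in>topspace T. of_real b * (\<lambda>t\<in>topspace T. 1) t) \<in> Cb T" (is "?c \<in> _")
    proof -
      have "continuous_map T euclidean ?c"
        by (rule continuous_map_eq[of _ _ "\<lambda>_. of_real b"]) auto
      moreover have "bounded (?c ` topspace T)"
        by (rule bounded_subset[of "{of_real b}"]) auto
      ultimately show ?thesis by (simp add: Cb_def)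
    qed
    have "m (\<lambda>t\<in>topspace T. g t + ?c t) = m g + of_real b"
      using add[OF g Cbb] scale[OF Cb1, of "of_real b"] one by simp
    moreover have "(\<lambda>t\<in>topspace T. g t + ?c t) = (\<lambda>t\<in>topspace T. complex_of_real (h t))"
      by (rule restrict_ext) (simp add: g_def)
    ultimately have "m (\<lambda>t\<in>topspace T. complex_of_real (h t)) = m g + of_real b" by simp
    moreover have "m g \<in> \<real>\<^sub>\<ge>\<^sub>0"
      using h(3) by (intro pos[OF g]) (simp add: g_def flip: of_real_diff)
    ultimately show ?thesis by (simp add: complex_nonneg_Reals_iff)
  qed
  define u where "u = (\<lambda>t\<in>topspace T. complex_of_real (Re (f t)))"
  define v where "v = (\<lambda>t\<in>topspace T. complex_of_real (Im (f t)))"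
  have fc: "continuous_map T euclidean f" and fb: "bounded (f ` topspace T)" using f by (auto simp: Cb_def)
  obtain M where M: "\<And>t. t \<in> topspace T \<Longrightarrow> norm (f t) \<le> M" using fb unfolding bounded_iff by auto
  have cont: "continuous_map T euclidean (\<lambda>t. k (f t))" if "continuous_on UNIV k"
    for k :: "complex \<Rightarrow> 'b::topological_space"
    using continuous_map_compose[OF fc, of euclidean k] that by (simp add: comp_def)
  have Re_b: "bounded ((\<lambda>t. Re (f t)) ` topspace T)" and Im_b: "bounded ((\<lambda>t. Im (f t)) ` topspace T)"
    unfolding bounded_iff using M abs_Re_le_cmod abs_Im_le_cmod order_trans by (auto, blast+)
  have u: "u \<in> Cb T" and v: "v \<in> Cb T"
  proof -
    have "continuous_map T euclidean u" "continuous_map T euclidean v"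
      unfolding u_def v_def
      by (rule continuous_map_eq[OF cont[of "\<lambda>z. of_real (Re z)"]]
          continuous_map_eq[OF cont[of "\<lambda>z. of_real (Im z)"]]; auto intro!: continuous_intros)+
    moreover have "bounded (u ` topspace T)" "bounded (v ` topspace T)"
      using Re_b Im_b unfolding bounded_iff by (auto simp: u_def v_def)
    ultimately show "u \<in> Cb T" "v \<in> Cb T" by (auto simp: Cb_def u_def v_def)
  qed
  have iv: "(\<lambda>t\<in>topspace T. \<i> * v t) \<in> Cb T"
  proof -
    have "continuous_map T euclidean (\<lambda>t\<in>topspace T. \<i> * v t)"
      by (rule continuous_map_eq[OF cont[of "\<lambda>z. \<i> * of_real (Im z)"]])
        (auto intro!: continuous_intros simp: v_def)
    moreover have "bounded ((\<lambda>t\<in>topspace T. \<i> * v t) ` topspace T)"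
      using Im_b unfolding bounded_iff by (auto simp: v_def norm_mult)
    ultimately show ?thesis by (simp add: Cb_def)
  qed
  have "m (\<lambda>t\<in>topspace T. u t + (\<lambda>t\<in>topspace T. \<i> * v t) t) = m u + \<i> * m v"
    using add[OF u iv] scale[OF v] by simp
  moreover have "(\<lambda>t\<in>topspace T. u t + (\<lambda>t\<in>topspace T. \<i> * v t) t) = f"
    using f by (intro extensionalityI[of _ "topspace T"]) (auto simp: Cb_def u_def v_def complex_eq_iff)
  ultimately have "m f = m u + \<i> * m v" by simp
  moreover have "a \<le> Re (m u)"
    unfolding u_def using real[of "\<lambda>t. Re (f t)" a] cont[OF continuous_on_Re[OF continuous_on_id]] Re_b a
    by blast
  moreover have "Im (m v) = 0"
  proof -
    have "- M \<le> Im (f t)" if "t \<in> topspace T" for t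
      using M[OF that] abs_Im_le_cmod[of "f t"] by linarith
    then show ?thesis
      unfolding v_def using real[of "\<lambda>t. Im (f t)" "- M"] cont[OF continuous_on_Im[OF continuous_on_id]] Im_b
      by blast
  qed
  ultimately show ?thesis by simp
qed

locale bounded_amenable_semigroup = lcs_semigroup +
  assumes barrelled: "barrelled scl \<tau>"
    and quasi_complete: "quasi_complete scl \<tau>"
    and bounded_S: "bounded_semigroup scl \<tau> S"
    and amenable: "right_amenable_operators \<tau> S"
begin

text \<open>
  The unit ball of \<open>sup {p (T x) | T \<in> S}\<close> is a barrel; this is the Banach-Steinhaus theorem
  for \<open>S\<close>.
\<close>

lemma equicontinuous:
  assumes p: "csn p"
  obtains q where "csn q" "\<And>x. p x \<le> q x" "\<And>T x. T \<in> S \<Longrightarrow> p (T x) \<le> q x"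
proof -
  have "\<exists>r. \<forall>T\<in>S. p (T x) \<le> r" for x
  proof -
    have "zero_nbhd \<tau> {y. p y < 1}" using p zero_nbhd_iff by blast
    then have "absorbs scl {y. p y < 1} {T x | T. T \<in> S}"
      using bounded_S unfolding bounded_semigroup_def tvs_bounded_def by blast
    then obtain r where r: "r > 0" "\<And>c. r \<le> norm c \<Longrightarrow> {T x | T. T \<in> S} \<subseteq> scl c ` {y. p y < 1}"
      unfolding absorbs_def by blast
    have "p (T x) \<le> r" if "T \<in> S" for T
    proof -
      have "T x \<in> scl (of_real r) ` {y. p y < 1}" using r(2)[of "of_real r"] r(1) that by auto
      then obtain y where "T x = scl (of_real r) y" "p y < 1" by blast
      then show ?thesis using r(1) by (simp add: csnD(2)[OF p])
    qed
    then show ?thesis by blast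
  qed
  then have bdd: "bdd_above ((\<lambda>T. p (T x)) ` S)" for x by (simp add: bdd_above_def)
  define q where "q = (\<lambda>x. SUP T\<in>S. p (T x))"
  have upper: "p (T x) \<le> q x" if "T \<in> S" for T x
    unfolding q_def by (rule cSUP_upper[OF that bdd])
  have least: "q x \<le> b" if "\<And>T. T \<in> S \<Longrightarrow> p (T x) \<le> b" for x b
    unfolding q_def by (rule cSUP_least[OF S_nonempty that])
  have add: "q (x + y) \<le> q x + q y" for x y
  proof (rule least)
    fix T assume T: "T \<in> S"
    show "p (T (x + y)) \<le> q x + q y"
      using csnD(1)[OF p, of "T x" "T y"] upper[OF T, of x] upper[OF T, of y] by (simp add: S_linear[OF T])
  qed
  have scale_le: "q (scl c x) \<le> norm c * q x" for c x
  proof (rule least)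
    fix T assume T: "T \<in> S"
    show "p (T (scl c x)) \<le> norm c * q x"
      using upper[OF T, of x] by (simp add: S_linear[OF T] csnD(2)[OF p] mult_left_mono)
  qed
  have q0: "q x \<ge> 0" for x
  proof -
    obtain T where "T \<in> S" using S_nonempty by blast
    then show ?thesis using upper[of T x] csnD(6)[OF p, of "T x"] by simp
  qed
  have scale: "q (scl c x) = norm c * q x" for c x
  proof (cases "c = 0")
    case True then show ?thesis using scale_le[of 0 x] q0[of 0] by simp
  next
    case False
    have "q x \<le> norm (inverse c) * q (scl c x)" using scale_le[of "inverse c" "scl c x"] False by simp
    then have "norm c * q x \<le> q (scl c x)" using False by (simp add: norm_divide field_simps)
    then show ?thesis using scale_le[of c x] by simp
  qed
  have semi: "seminorm q" using add scale by (simp add: seminorm_def)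
  have "zero_nbhd \<tau> {x. q x \<le> 1}"
  proof (rule barrelled[unfolded barrelled_def, rule_format], intro conjI)
    show "radial scl {x. q x \<le> 1}"
      unfolding radial_def absorbs_def
    proof
      fix x
      have "x \<in> scl c ` {x. q x \<le> 1}" if c: "q x + 1 \<le> norm c" for c
      proof -
        have "c \<noteq> 0" using c q0[of x] by auto
        moreover have "q (scl (inverse c) x) \<le> 1"
          using c q0[of x] \<open>c \<noteq> 0\<close> unfolding scale by (simp add: norm_divide field_simps)
        ultimately show ?thesis by (intro image_eqI[of _ _ "scl (inverse c) x"]) auto
      qed
      then show "\<exists>r>0. \<forall>c. r \<le> norm c \<longrightarrow> {x} \<subseteq> scl c ` {x. q x \<le> 1}"
        using q0[of x] by (intro exI[of _ "q x + 1"]) auto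
    qed
    show "convex_wrt scl {x. q x \<le> 1}"
      unfolding convex_wrt_def
    proof (intro ballI allI impI CollectI)
      fix x y and t :: real assume xy: "x \<in> {x. q x \<le> 1}" "y \<in> {x. q x \<le> 1}" and t: "0 \<le> t \<and> t \<le> 1"
      have "q (scl (of_real t) x + scl (of_real (1 - t)) y) \<le> t * q x + (1 - t) * q y"
        using add[of "scl (of_real t) x" "scl (of_real (1 - t)) y"] t
        unfolding scale norm_of_real by simp
      also have "\<dots> \<le> t * 1 + (1 - t) * 1"
        using xy t by (intro add_mono mult_left_mono) auto
      finally show "q (scl (of_real t) x + scl (of_real (1 - t)) y) \<le> 1" by simp
    qed
    show "circled scl {x. q x \<le> 1}"
      unfolding circled_def using q0 by (auto simp: scale mult_le_one)
    have "\<tau> closure_of {x. q x \<le> 1} \<subseteq> {x. q x \<le> 1}"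
    proof (intro subsetI CollectI least)
      fix x T assume x: "x \<in> \<tau> closure_of {x. q x \<le> 1}" and T: "T \<in> S"
      show "p (T x) \<le> 1"
      proof (rule field_le_epsilon)
        fix e :: real assume "e > 0"
        then obtain a where a: "a \<in> {x. q x \<le> 1}" "p (T (a - x)) < e"
          using closure_ex[OF x csn_comp[OF p T]] by metis
        have "p (T x) \<le> p (T a) + p (T a - T x)"
          using csnD(1)[OF p, of "T a" "T x - T a"] csnD(7)[OF p, of "T x" "T a"] by simp
        then show "p (T x) \<le> 1 + e" using a upper[OF T, of a] by (simp add: S_linear[OF T])
      qed
    qed
    then show "closedin \<tau> {x. q x \<le> 1}" using closure_of_subset_eq[of "{x. q x \<le> 1}" \<tau>] by simp
  qed
  then have "csn q" using semi by (simp add: csn_def)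
  then have "csn (\<lambda>x. p x + q x)" using csn_add[OF p] by blast
  moreover have "p (T x) \<le> p x + q x" if "T \<in> S" for T x
    using upper[OF that, of x] csnD(6)[OF p, of x] by simp
  ultimately show thesis using that q0 by fastforce
qed

text \<open>
  The functional \<open>\<psi>\<close> averages \<open>T \<mapsto> \<phi> (T x)\<close> with the mean. It is fixed because
  \<open>T \<mapsto> \<phi> (T (R x))\<close> is the right translate of \<open>T \<mapsto> \<phi> (T x)\<close> by \<open>R\<close>.
\<close>

lemma averaged_functional:
  assumes \<phi>: "\<phi> \<in> X'"
  obtains \<psi> where "\<psi> \<in> Fix'" "\<And>x a. (\<And>T. T \<in> S \<Longrightarrow> a \<le> Re (\<phi> (T x))) \<Longrightarrow> a \<le> Re (\<psi> x)"
proof -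
  define Z where "Z = subtopology (product_topology (\<lambda>_. \<tau>) UNIV) S"
  have Z [simp]: "topspace Z = S" by (auto simp: Z_def)
  obtain m where m: "right_invariant_mean Z (\<circ>) m"
    using amenable unfolding right_amenable_operators_def right_amenable_def Z_def by auto
  have add: "m (\<lambda>t\<in>S. f t + g t) = m f + m g" if "f \<in> Cb Z" "g \<in> Cb Z" for f g
    using m that unfolding right_invariant_mean_def Z by blast
  have scale: "m (\<lambda>t\<in>S. c * f t) = c * m f" if "f \<in> Cb Z" for f c
    using m that unfolding right_invariant_mean_def Z by blast
  have inv: "m (\<lambda>t\<in>S. f (t \<circ> s)) = m f" if "f \<in> Cb Z" "s \<in> S" for f s
    using m that unfolding right_invariant_mean_def Z by blast
  obtain C where C: "\<And>f. f \<in> Cb Z \<Longrightarrow> norm (m f) \<le> C * (SUP t\<in>S. norm (f t))"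
    using m unfolding right_invariant_mean_def Z by blast
  obtain q where q: "csn q" "\<And>T x. T \<in> S \<Longrightarrow> norm (\<phi> (T x)) \<le> q x"
    using equicontinuous[OF dual_csn[OF \<phi>]] by metis
  define f where "f = (\<lambda>x. \<lambda>T\<in>S. \<phi> (T x))"
  have f: "f x \<in> Cb Z" for x
  proof -
    have "continuous_map Z \<tau> (\<lambda>T. T x)"
      unfolding Z_def by (intro continuous_map_from_subtopology continuous_map_product_projection) simp
    then have "continuous_map Z euclidean (\<phi> \<circ> (\<lambda>T. T x))"
      using \<phi> by (intro continuous_map_compose[of _ \<tau>]) (auto simp: dual_def)
    then have "continuous_map Z euclidean (f x)"
      by (rule continuous_map_eq) (simp add: f_def)
    moreover have "bounded (f x ` S)"
      unfolding bounded_iff using q(2)[of _ x] by (auto simp: f_def)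
    ultimately show ?thesis by (simp add: Cb_def f_def)
  qed
  define \<psi> where "\<psi> = (\<lambda>x. m (f x))"
  have "\<psi> \<in> X'"
  proof (rule dualI)
    show "\<psi> (x + y) = \<psi> x + \<psi> y" for x y
    proof -
      have "f (x + y) = (\<lambda>t\<in>S. f x t + f y t)"
        unfolding f_def by (rule restrict_ext) (simp add: S_linear dual_linear[OF \<phi>])
      then show ?thesis unfolding \<psi>_def using add[OF f f] by simp
    qed
    show "\<psi> (scl c x) = c * \<psi> x" for c x
    proof -
      have "f (scl c x) = (\<lambda>t\<in>S. c * f x t)"
        unfolding f_def by (rule restrict_ext) (simp add: S_linear dual_linear[OF \<phi>])
      then show ?thesis unfolding \<psi>_def using scale[OF f] by simp
    qed
    show "csn (\<lambda>x. \<bar>C\<bar> * q x)" using q(1) by (intro csn_scale) auto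
    show "norm (\<psi> x) \<le> \<bar>C\<bar> * q x" for x
    proof -
      have bnd: "norm (f x t) \<le> q x" if "t \<in> S" for t using q(2) that by (simp add: f_def)
      have "(SUP t\<in>S. norm (f x t)) \<le> q x" by (rule cSUP_least[OF S_nonempty bnd])
      moreover have "0 \<le> (SUP t\<in>S. norm (f x t))"
      proof -
        obtain T where T: "T \<in> S" using S_nonempty by blast
        have "bdd_above ((\<lambda>t. norm (f x t)) ` S)" using bnd by (intro bdd_aboveI[of _ "q x"]) auto
        from cSUP_upper[OF T this] show ?thesis using norm_ge_zero order_trans by blast
      qed
      ultimately have "C * (SUP t\<in>S. norm (f x t)) \<le> \<bar>C\<bar> * q x"
        by (intro mult_mono) auto
      then show ?thesis using C[OF f, of x] unfolding \<psi>_def by simp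
    qed
  qed
  then have "\<psi> \<in> Fix'"
  proof (rule Fix'I)
    fix T x assume T: "T \<in> S"
    have "(\<lambda>t\<in>S. f x (t \<circ> T)) = f (T x)"
      unfolding f_def using S_comp[OF _ T] by (intro restrict_ext) simp
    then show "\<psi> (T x) = \<psi> x" using inv[OF f T, of x] by (simp add: \<psi>_def)
  qed
  moreover have "a \<le> Re (\<psi> x)" if "\<And>T. T \<in> S \<Longrightarrow> a \<le> Re (\<phi> (T x))" for x a
    unfolding \<psi>_def using that by (intro right_invariant_mean_Re_ge[OF m f]) (simp add: f_def)
  ultimately show thesis using that by blast
qed

text \<open>
  Otherwise a functional \<open>\<phi>\<close> separates the convex set \<open>co S x\<close> from the origin, and the average of
  \<open>\<phi>\<close> is a fixed functional that does not vanish at \<open>x\<close>.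
\<close>

lemma Ran_small_orbit:
  assumes x: "x \<in> Ran" and p: "csn p"
  shows "\<exists>T\<in>coS. p (T x) < 1"
proof (rule ccontr)
  assume no: "\<not> (\<exists>T\<in>coS. p (T x) < 1)"
  have "convex_wrt scl ((\<lambda>T. T x) ` coS)"
    unfolding convex_wrt_def
  proof (intro ballI allI impI)
    fix u v and t :: real assume "u \<in> (\<lambda>T. T x) ` coS" "v \<in> (\<lambda>T. T x) ` coS" and t: "0 \<le> t \<and> t \<le> 1"
    then obtain T U where TU: "T \<in> coS" "U \<in> coS" "u = T x" "v = U x" by blast
    show "scl (of_real t) u + scl (of_real (1 - t)) v \<in> (\<lambda>T. T x) ` coS"
      using co_convex[OF TU(1,2)] t TU(3,4) by (intro image_eqI) auto
  qed
  moreover have "1 \<le> p c" if "c \<in> (\<lambda>T. T x) ` coS" for c using no that not_less by blast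
  ultimately obtain \<phi> where \<phi>: "\<phi> \<in> X'" "\<And>c. c \<in> (\<lambda>T. T x) ` coS \<Longrightarrow> 1 \<le> Re (\<phi> c)"
    using separation[OF p] by metis
  obtain \<psi> where \<psi>: "\<psi> \<in> Fix'" "\<And>x a. (\<And>T. T \<in> S \<Longrightarrow> a \<le> Re (\<phi> (T x))) \<Longrightarrow> a \<le> Re (\<psi> x)"
    using averaged_functional[OF \<phi>(1)] by blast
  have "1 \<le> Re (\<psi> x)" using \<phi>(2) co_superset by (intro \<psi>(2)) blast
  moreover have "\<psi> x = 0" using x \<psi>(1) by (simp add: Ran_iff)
  ultimately show False by simp
qed

end

section \<open>Ergodic nets\<close>

lemma eventually_in_tails:
  assumes "directed A le"
  shows "\<forall>\<^sub>F a in tails A le. a \<in> A"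
  using assms unfolding eventually_tails[OF assms] directed_def by blast

lemma tails_neq_bot:
  assumes "directed A le"
  shows "tails A le \<noteq> bot"
  using assms unfolding eventually_False[symmetric] eventually_tails[OF assms] directed_def by blast

lemma directed_Times:
  assumes dir: "directed A le" and "B \<noteq> {}"
  shows "directed (A \<times> B) (\<lambda>\<beta> \<gamma>. le (fst \<beta>) (fst \<gamma>))"
proof -
  have ne: "A \<noteq> {}" and refl: "\<And>a. a \<in> A \<Longrightarrow> le a a"
    and trans: "\<And>a b c. a \<in> A \<Longrightarrow> b \<in> A \<Longrightarrow> c \<in> A \<Longrightarrow> le a b \<Longrightarrow> le b c \<Longrightarrow> le a c"
    and upper: "\<And>a b. a \<in> A \<Longrightarrow> b \<in> A \<Longrightarrow> \<exists>c\<in>A. le a c \<and> le b c"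
    using dir unfolding directed_def by (elim conjE; meson)+
  show ?thesis
    unfolding directed_def
  proof (intro conjI ballI impI)
    show "A \<times> B \<noteq> {}" using ne assms(2) by simp
    show "le (fst \<beta>) (fst \<beta>)" if "\<beta> \<in> A \<times> B" for \<beta>
      by (rule refl) (use that in auto)
    show "le (fst \<beta>) (fst \<delta>)" if "\<beta> \<in> A \<times> B" "\<gamma> \<in> A \<times> B" "\<delta> \<in> A \<times> B"
      "le (fst \<beta>) (fst \<gamma>) \<and> le (fst \<gamma>) (fst \<delta>)" for \<beta> \<gamma> \<delta>
      by (rule trans[of _ "fst \<gamma>"]) (use that in auto)
    show "\<exists>\<delta>\<in>A \<times> B. le (fst \<beta>) (fst \<delta>) \<and> le (fst \<gamma>) (fst \<delta>)"
      if bc: "\<beta> \<in> A \<times> B" "\<gamma> \<in> A \<times> B" for \<beta> \<gamma>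
    proof -
      obtain c where "c \<in> A" "le (fst \<beta>) c" "le (fst \<gamma>) c"
        using upper[of "fst \<beta>" "fst \<gamma>"] bc by auto
      then show ?thesis using bc(1) by (intro bexI[of _ "(c, snd \<beta>)"]) (auto simp: mem_Times_iff)
    qed
  qed
qed

context lcs_semigroup
begin

lemma limitin_K_fix':
  assumes "directed A le" "\<And>\<alpha>. \<alpha> \<in> A \<Longrightarrow> N \<alpha> \<in> K" "limitin weak (\<lambda>\<alpha>. N \<alpha> x) z (tails A le)"
    "\<phi> \<in> Fix'"
  shows "\<phi> z = \<phi> x"
proof -
  have "((\<lambda>\<alpha>. \<phi> (N \<alpha> x)) \<longlongrightarrow> \<phi> z) (tails A le)"
    using assms(3) Fix'_dual[OF assms(4)] unfolding limitin_weak by blast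
  moreover have "((\<lambda>\<alpha>. \<phi> (N \<alpha> x)) \<longlongrightarrow> \<phi> x) (tails A le)"
    by (rule tendsto_eventually, rule eventually_mono[OF eventually_in_tails[OF assms(1)]])
      (rule K_fix'[OF assms(2,4)])
  ultimately show ?thesis using tendsto_unique tails_neq_bot[OF assms(1)] by blast
qed

definition Fix_separates_Fix' :: bool where
  "Fix_separates_Fix' \<longleftrightarrow> (\<forall>\<phi>\<in>Fix'. \<phi> \<noteq> 0 \<longrightarrow> (\<exists>x\<in>Fix. \<phi> x \<noteq> 0))"

text \<open>
  All implications towards the separation property have this form: \<open>x\<close> is replaced by a fixed
  vector that no fixed functional distinguishes from \<open>x\<close>.
\<close>

lemma Fix_separatesI:
  assumes "\<And>x. \<exists>z\<in>Fix. \<forall>\<phi>\<in>Fix'. \<phi> z = \<phi> x"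
  shows "Fix_separates_Fix'"
  unfolding Fix_separates_Fix'_def
proof (intro ballI impI)
  fix \<phi> :: "'a \<Rightarrow> complex" assume \<phi>: "\<phi> \<in> Fix'" "\<phi> \<noteq> 0"
  then obtain x where "\<phi> x \<noteq> 0" by (auto simp: fun_eq_iff)
  then show "\<exists>x\<in>Fix. \<phi> x \<noteq> 0" using assms[of x] \<phi>(1) by metis
qed

lemma separates_if_two_sided_net:
  assumes net: "two_sided_ergodic_net scl weak S A le N"
    and conv: "\<forall>x. \<exists>z. limitin weak (\<lambda>\<alpha>. N \<alpha> x) z (tails A le)"
  shows "Fix_separates_Fix'"
proof (rule Fix_separatesI)
  fix x
  have dir: "directed A le" and NK: "\<And>\<alpha>. \<alpha> \<in> A \<Longrightarrow> N \<alpha> \<in> K"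
    and left: "\<And>y R. R \<in> S \<Longrightarrow> limitin weak (\<lambda>\<alpha>. N \<alpha> y - R (N \<alpha> y)) 0 (tails A le)"
    using net unfolding two_sided_ergodic_net_def left_ergodic_net_def operator_net_def K_space_def by blast+
  obtain z where z: "limitin weak (\<lambda>\<alpha>. N \<alpha> x) z (tails A le)" using conv by blast
  have "R z = z" if R: "R \<in> S" for R
  proof (rule dual_separates)
    fix \<phi> assume \<phi>: "\<phi> \<in> X'"
    have "((\<lambda>\<alpha>. \<phi> (N \<alpha> x)) \<longlongrightarrow> \<phi> z) (tails A le)"
      using z \<phi> unfolding limitin_weak by blast
    moreover have "((\<lambda>\<alpha>. \<phi> (R (N \<alpha> x))) \<longlongrightarrow> \<phi> (R z)) (tails A le)"
      using z dual_comp[OF \<phi> R] unfolding limitin_weak by fastforce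
    ultimately have "((\<lambda>\<alpha>. \<phi> (N \<alpha> x) - \<phi> (R (N \<alpha> x))) \<longlongrightarrow> \<phi> z - \<phi> (R z)) (tails A le)"
      by (rule tendsto_diff)
    moreover have "((\<lambda>\<alpha>. \<phi> (N \<alpha> x) - \<phi> (R (N \<alpha> x))) \<longlongrightarrow> 0) (tails A le)"
      using left[OF R, of x] \<phi> unfolding limitin_weak by (fastforce simp: dual_linear[OF \<phi>])
    ultimately show "\<phi> (R z) = \<phi> z" using tendsto_unique tails_neq_bot[OF dir] by fastforce
  qed
  then have "z \<in> Fix" by (simp add: Fix_iff)
  then show "\<exists>z\<in>Fix. \<forall>\<phi>\<in>Fix'. \<phi> z = \<phi> x"
    using limitin_K_fix'[OF dir NK z] by blast
qed

lemma separates_if_zero: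
  assumes P: "is_zero_on UNIV K P"
  shows "Fix_separates_Fix'"
proof (rule Fix_separatesI)
  fix x
  have PK: "P \<in> K" and zero: "\<And>R. R \<in> K \<Longrightarrow> compose UNIV R P = P"
    using P unfolding is_zero_on_def by auto
  have "R (P x) = P x" if "R \<in> S" for R
    using fun_cong[OF zero[of R], of x] that co_superset coS_subset_K by (auto simp: compose_def)
  then have "P x \<in> Fix" by (simp add: Fix_iff)
  then show "\<exists>z\<in>Fix. \<forall>\<phi>\<in>Fix'. \<phi> z = \<phi> x"
    using K_fix'[OF PK] by blast
qed

lemma coS_le:
  assumes "T \<in> coS" "csn p" "\<And>T x. T \<in> S \<Longrightarrow> p (T x) \<le> q x"
  shows "p (T x) \<le> q x"
  using coS_bound[OF assms(1) csn_seminorm[OF assms(2)]] assms(3) by blast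

end

context bounded_amenable_semigroup
begin

text \<open>
  One operator of \<open>co S\<close> makes finitely many vectors of \<open>Ran\<close> small: after \<open>T\<close> has dealt with
  \<open>F\<close>, the vector \<open>T y\<close> is still in \<open>Ran\<close>, so that some \<open>U\<close> makes it small, and by
  equicontinuity \<open>U \<circ> T\<close> is still good for \<open>F\<close>.
\<close>

lemma Ran_finite_small_orbit:
  assumes "finite F" "F \<subseteq> Ran" "csn p"
  shows "\<exists>T\<in>coS. \<forall>y\<in>F. p (T y) < 1"
  using assms
proof (induction F arbitrary: p)
  case empty
  then show ?case using S_nonempty co_superset by blast
next
  case (insert y F)
  obtain q where q: "csn q" "\<And>x. p x \<le> q x" "\<And>T x. T \<in> S \<Longrightarrow> p (T x) \<le> q x"
    using equicontinuous[OF insert.prems(2)] by blast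
  obtain T where T: "T \<in> coS" "\<And>y. y \<in> F \<Longrightarrow> q (T y) < 1"
    using insert.IH[OF _ q(1)] insert.prems by blast
  have "T y \<in> Ran" using T(1) coS_subset_K Ran_invariant insert.prems by blast
  then obtain U where U: "U \<in> coS" "p (U (T y)) < 1"
    using Ran_small_orbit[OF _ insert.prems(2)] by blast
  have "p (U (T z)) \<le> q (T z)" for z
    using coS_le[of U p q "T z"] U(1) insert.prems(2) q(3) by blast
  then have "p (U (T z)) < 1" if "z \<in> F" for z using T(2)[OF that] by (rule le_less_trans)
  then show ?case using U(2) coS_comp[OF U(1) T(1)] by (intro bexI[of _ "U \<circ> T"]) auto
qed

lemma rg_subset_Ran: "rg_Id_minus S \<subseteq> Ran"
proof
  fix y assume "y \<in> rg_Id_minus S"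
  then obtain x T where y: "y = x - T x" "T \<in> S" by (auto simp: rg_Id_minus_def)
  then show "y \<in> Ran"
    unfolding Ran_iff by (auto simp: dual_linear[OF Fix'_dual] Fix'_apply)
qed

text \<open>
  Indices are pairs of a finite subset of \<open>Ran\<close> and a continuous seminorm; \<open>N\<close> picks an operator
  of \<open>co S\<close> that is small on the given set for the given seminorm.
\<close>

lemma ergodic_net_exists:
  obtains A :: "('a set \<times> ('a \<Rightarrow> real)) set" and le N
  where "directed A le" "\<And>\<alpha>. \<alpha> \<in> A \<Longrightarrow> N \<alpha> \<in> coS"
    "\<And>y. y \<in> Ran \<Longrightarrow> limitin \<tau> (\<lambda>\<alpha>. N \<alpha> y) 0 (tails A le)"
proof -
  define A where "A = {(F, p). finite F \<and> F \<subseteq> Ran \<and> csn p}"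
  define le where "le = (\<lambda>(F :: 'a set, p) (G, q). F \<subseteq> G \<and> (\<forall>x::'a. p x \<le> (q x :: real)))"
  have "\<forall>\<alpha>\<in>A. \<exists>T. T \<in> coS \<and> (\<forall>y\<in>fst \<alpha>. snd \<alpha> (T y) < 1)"
    using Ran_finite_small_orbit by (auto simp: A_def Bex_def)
  then obtain N where N: "\<And>\<alpha>. \<alpha> \<in> A \<Longrightarrow> N \<alpha> \<in> coS" "\<And>\<alpha> y. \<alpha> \<in> A \<Longrightarrow> y \<in> fst \<alpha> \<Longrightarrow> snd \<alpha> (N \<alpha> y) < 1"
    by metis
  have dir: "directed A le"
    unfolding directed_def
  proof (intro conjI ballI)
    show "A \<noteq> {}" using csn_zero by (auto simp: A_def intro!: exI[of _ "{}"])
    fix a b assume "a \<in> A" "b \<in> A"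
    then obtain F p G q where ab: "a = (F, p)" "b = (G, q)" "finite F" "finite G" "F \<subseteq> Ran" "G \<subseteq> Ran" "csn p" "csn q"
      by (auto simp: A_def)
    then show "\<exists>c\<in>A. le a c \<and> le b c"
      using csn_add[of p q] csnD(6)[of p] csnD(6)[of q]
      by (intro bexI[of _ "(F \<union> G, \<lambda>x. p x + q x)"]) (auto simp: A_def le_def)
  qed (auto simp: le_def intro: order_trans)
  have "limitin \<tau> (\<lambda>\<alpha>. N \<alpha> y) 0 (tails A le)" if y: "y \<in> Ran" for y
    unfolding limitin_iff
  proof (intro allI impI)
    fix p assume p: "csn p"
    have "({y}, p) \<in> A" using y p by (simp add: A_def)
    moreover have "p (N b y - 0) < 1" if "b \<in> A" "le ({y}, p) b" for b
    proof -
      have "p (N b y) \<le> snd b (N b y)" "y \<in> fst b" using that(2) by (auto simp: le_def split: prod.splits)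
      then show ?thesis using N(2)[OF that(1), of y] by simp
    qed
    ultimately show "\<forall>\<^sub>F \<alpha> in tails A le. p (N \<alpha> y - 0) < 1"
      unfolding eventually_tails[OF dir] by blast
  qed
  with dir N(1) show thesis by (rule that)
qed

lemma operator_net_coS:
  assumes "directed A le" "\<And>\<alpha>. \<alpha> \<in> A \<Longrightarrow> N \<alpha> \<in> coS" "topspace T = UNIV"
  shows "operator_net scl T S A le N"
proof -
  have "coS \<subseteq> pointwise_closure T coS"
    unfolding pointwise_closure_def using assms(3) by (intro closure_of_subset) simp
  then show ?thesis using assms by (auto simp: operator_net_def)
qed

text \<open>
  By equicontinuity, a right ergodic net remains one when each of its members is followed by an
  arbitrary operator of \<open>S\<close>. If the enlarged net converges, then so do all these modifications, to the same limit, which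
  is therefore fixed by \<open>S\<close>.
\<close>

lemma separates_if_mean_ergodic:
  assumes me: "right_mean_ergodic scl weak S \<or> right_mean_ergodic scl \<tau> S"
  shows "Fix_separates_Fix'"
proof -
  obtain A :: "('a set \<times> ('a \<Rightarrow> real)) set" and le N where net: "directed A le"
      "\<And>\<alpha>. \<alpha> \<in> A \<Longrightarrow> N \<alpha> \<in> coS" "\<And>y. y \<in> Ran \<Longrightarrow> limitin \<tau> (\<lambda>\<alpha>. N \<alpha> y) 0 (tails A le)"
    using ergodic_net_exists by blast
  define B where "B = A \<times> insert id S"
  define leB where "leB = (\<lambda>\<beta> \<gamma>. le (fst (\<beta> :: _ \<times> ('a \<Rightarrow> 'a))) (fst (\<gamma> :: _ \<times> ('a \<Rightarrow> 'a))))"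
  define M where "M = (\<lambda>(a, R :: 'a \<Rightarrow> 'a). R \<circ> N a)"
  have dirB: "directed B leB"
    unfolding B_def leB_def using net(1) by (rule directed_Times) simp
  have MS: "M \<beta> \<in> coS" if "\<beta> \<in> B" for \<beta>
    using that net(2) coS_comp[OF co_superset] by (auto simp: B_def M_def)
  have small: "limitin \<tau> (\<lambda>\<beta>. M \<beta> (y - R y)) 0 (tails B leB)" if "R \<in> S" for y R
    unfolding limitin_iff
  proof (intro allI impI)
    fix p assume p: "csn p"
    obtain q where q: "csn q" "\<And>x. p x \<le> q x" "\<And>T x. T \<in> S \<Longrightarrow> p (T x) \<le> q x"
      using equicontinuous[OF p] by blast
    have "y - R y \<in> Ran" using that rg_subset_Ran by (auto simp: rg_Id_minus_def)
    from net(3)[OF this] q(1) have "\<forall>\<^sub>F \<alpha> in tails A le. q (N \<alpha> (y - R y) - 0) < 1"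
      unfolding limitin_iff by blast
    then obtain a where a: "a \<in> A" "\<And>b. b \<in> A \<Longrightarrow> le a b \<Longrightarrow> q (N b (y - R y)) < 1"
      unfolding eventually_tails[OF net(1)] by auto
    have "p (M \<beta> (y - R y) - 0) < 1" if "\<beta> \<in> B" "leB (a, id) \<beta>" for \<beta>
    proof -
      obtain b U where \<beta>: "\<beta> = (b, U)" by (cases \<beta>)
      have b: "b \<in> A" "le a b" "U = id \<or> U \<in> S" using that by (auto simp: B_def leB_def \<beta>)
      then have "p (U (N b (y - R y))) \<le> q (N b (y - R y))" using q by auto
      then show ?thesis using a(2)[OF b(1,2)] by (simp add: M_def \<beta>)
    qed
    moreover have "(a, id) \<in> B" using a(1) by (simp add: B_def)
    ultimately show "\<forall>\<^sub>F \<beta> in tails B leB. p (M \<beta> (y - R y) - 0) < 1"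
      unfolding eventually_tails[OF dirB] by blast
  qed
  have conv: "\<exists>z. limitin weak (\<lambda>\<beta>. M \<beta> x) z (tails B leB)" for x
  proof -
    have "operator_net scl \<tau> S B leB M" "operator_net scl weak S B leB M"
      using MS by (auto intro: operator_net_coS[OF dirB])
    then have "right_ergodic_net scl \<tau> S B leB M" "right_ergodic_net scl weak S B leB M"
      unfolding right_ergodic_net_def using small limitin_weak_if_limitin[OF small] by blast+
    then have "pointwise_convergent_net weak B leB M \<or> pointwise_convergent_net \<tau> B leB M"
      using me right_mean_ergodic_any_index by metis
    then show ?thesis unfolding pointwise_convergent_net_def using limitin_weak_if_limitin by metis
  qed
  show ?thesis
  proof (rule Fix_separatesI)
    fix x
    obtain z where z: "limitin weak (\<lambda>\<beta>. M \<beta> x) z (tails B leB)" using conv by blast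
    have lim: "((\<lambda>a. \<phi> (U (N a x))) \<longlongrightarrow> \<phi> z) (tails A le)" if "\<phi> \<in> X'" "U \<in> insert id S" for \<phi> U
    proof -
      have "filterlim (\<lambda>a. (a, U)) (tails B leB) (tails A le)"
        unfolding filterlim_iff eventually_tails[OF dirB] eventually_tails[OF net(1)]
        using that(2) by (fastforce simp: B_def leB_def)
      moreover have "((\<lambda>\<beta>. \<phi> (M \<beta> x)) \<longlongrightarrow> \<phi> z) (tails B leB)"
        using z that(1) unfolding limitin_weak by blast
      ultimately have "((\<lambda>a. \<phi> (M (a, U) x)) \<longlongrightarrow> \<phi> z) (tails A le)"
        by (rule filterlim_compose[rotated])
      then show ?thesis by (simp add: M_def)
    qed
    have "R z = z" if R: "R \<in> S" for R
    proof (rule dual_separates)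
      fix \<phi> assume \<phi>: "\<phi> \<in> X'"
      have "((\<lambda>a. \<phi> (R (N a x))) \<longlongrightarrow> \<phi> (R z)) (tails A le)"
        using lim[OF dual_comp[OF \<phi> R], of id] by simp
      then show "\<phi> (R z) = \<phi> z"
        using lim[OF \<phi>, of R] R tendsto_unique[OF tails_neq_bot[OF net(1)]] by blast
    qed
    then have "z \<in> Fix" by (simp add: Fix_iff)
    moreover have "M \<beta> \<in> K" if "\<beta> \<in> B" for \<beta> using MS[OF that] coS_subset_K by blast
    ultimately show "\<exists>z\<in>Fix. \<forall>\<phi>\<in>Fix'. \<phi> z = \<phi> x"
      using limitin_K_fix'[of B leB M x z] dirB z by blast
  qed
qed

section \<open>The decomposition\<close>

lemma Fix_subspace: "subspace Fix"
  by (rule subspaceI) (auto simp: Fix_iff S_linear)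

lemma Fix_in_closed_orbit:
  assumes "u \<in> Fix" "n \<in> Ran" "csn p"
  obtains T where "T \<in> coS" "p (T (u + n) - u) < 1"
proof -
  obtain T where T: "T \<in> coS" "p (T n) < 1" using Ran_small_orbit[OF assms(2,3)] by blast
  then show thesis using that[OF T(1)] by (simp add: coS_linear coS_fix[OF _ assms(1)])
qed

text \<open>
  The orbit \<open>co S u\<close> of \<open>u \<in> Fix\<close> is \<open>{u}\<close>, and for \<open>u \<in> Ran\<close> it comes arbitrarily close to \<open>0\<close>.
\<close>

lemma Fix_Ran_trivial:
  assumes "u \<in> Fix" "u \<in> Ran"
  shows "u = 0"
proof (rule csn_separates)
  fix p assume "csn p"
  then obtain T where "T \<in> coS" "p (T u) < 1" using Ran_small_orbit[OF assms(2)] by blast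
  then show "p (u - 0) < 1" using coS_fix[OF \<open>T \<in> coS\<close> assms(1)] by simp
qed

text \<open>
  Continuity of the projection of \<open>Fix + Ran\<close> onto \<open>Fix\<close>: the component \<open>u\<close> lies in the closure of
  the orbit of \<open>u + n\<close>, where \<open>p\<close> is bounded by \<open>q (u + n)\<close>.
\<close>

lemma Fix_part_bound:
  assumes "u \<in> Fix" "n \<in> Ran" "csn p" "\<And>T x. T \<in> S \<Longrightarrow> p (T x) \<le> q x"
  shows "p u \<le> q (u + n)"
proof (rule field_le_epsilon)
  fix e :: real assume e: "e > 0"
  have "csn (\<lambda>x. inverse e * p x)" using e assms(3) by (intro csn_scale) auto
  then obtain T where T: "T \<in> coS" "inverse e * p (T (u + n) - u) < 1"
    using Fix_in_closed_orbit[OF assms(1,2)] by blast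
  have "p u \<le> p (T (u + n)) + p (T (u + n) - u)"
    using csnD(5)[OF assms(3), of "T (u + n)" "T (u + n) - u"] by simp
  moreover have "p (T (u + n)) \<le> q (u + n)"
    using coS_le[of T p q "u + n"] T(1) assms(3,4) by blast
  ultimately show "p u \<le> q (u + n) + e" using T(2) e by (simp add: field_simps)
qed

lemma Fix_closed: "\<tau> closure_of Fix \<subseteq> Fix"
proof
  fix x assume x: "x \<in> \<tau> closure_of Fix"
  have "T x = x" if T: "T \<in> S" for T
  proof (rule csn_separates)
    fix p assume p: "csn p"
    have "csn (\<lambda>x. p (T x) + p x)" using csn_add[OF csn_comp[OF p T] p] .
    then obtain a where a: "a \<in> Fix" "p (T (a - x)) + p (a - x) < 1"
      using x unfolding closure_iff by blast
    have "T a = a" using a(1) T by (simp add: Fix_iff)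
    then have "p (T x - x) \<le> p (T x - T a) + p (a - x)"
      using csn_triangle[OF p, of "T x" x a] by simp
    then show "p (T x - x) < 1"
      using a(2) csnD(7)[OF p, of "T x" "T a"] by (simp add: S_linear[OF T])
  qed
  then show "x \<in> Fix" by (simp add: Fix_iff)
qed

text \<open>
  A functional that vanishes on \<open>Ran\<close> is fixed, and one that also vanishes on \<open>Fix\<close> is then \<open>0\<close>.
\<close>

lemma sum_dense_if_separates:
  assumes sep: "Fix_separates_Fix'"
  shows "x \<in> \<tau> closure_of {u + n | u n. u \<in> Fix \<and> n \<in> Ran}"
proof (rule ccontr)
  assume "x \<notin> \<tau> closure_of {u + n | u n. u \<in> Fix \<and> n \<in> Ran}"
  then obtain \<phi> where \<phi>: "\<phi> \<in> X'" "\<And>y. y \<in> {u + n | u n. u \<in> Fix \<and> n \<in> Ran} \<Longrightarrow> \<phi> y = 0" "\<phi> x \<noteq> 0"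
    by (rule closed_subspace_annihilator[OF subspace_sums[OF Fix_subspace Ran_subspace]]) (rule that)
  have Fix0: "\<phi> u = 0" if "u \<in> Fix" for u
    using \<phi>(2)[of u] that subspace_0[OF Ran_subspace] by force
  have Ran0: "\<phi> n = 0" if "n \<in> Ran" for n
    using \<phi>(2)[of n] that subspace_0[OF Fix_subspace] by force
  have "\<phi> \<in> Fix'"
  proof (rule Fix'I[OF \<phi>(1)])
    fix T y assume "T \<in> S"
    then have "y - T y \<in> Ran" using rg_subset_Ran by (auto simp: rg_Id_minus_def)
    from Ran0[OF this] show "\<phi> (T y) = \<phi> y" by (simp add: dual_linear[OF \<phi>(1)])
  qed
  moreover have "\<phi> \<noteq> 0" using \<phi>(3) by auto
  ultimately show False using sep Fix0 unfolding Fix_separates_Fix'_def by blast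
qed

text \<open>
  Approximate \<open>x\<close> by vectors \<open>u + n\<close> of the dense subspace. The components \<open>u\<close> form a Cauchy net,
  which need not be bounded, but \<open>T (u + n)\<close> is close to \<open>u\<close> for some \<open>T \<in> co S\<close>, so \<open>u\<close> is close
  to a point of the orbit \<open>co S x\<close>. That orbit is bounded, and quasi-completeness gives a limit of
  the \<open>u\<close>.
\<close>

lemma decomposition_if_separates:
  assumes sep: "Fix_separates_Fix'"
  shows "\<exists>u\<in>Fix. x - u \<in> Ran"
proof -
  define C where "C = \<tau> closure_of {T x | T. T \<in> coS}"
  define A where "A = (\<lambda>p. {y \<in> C. \<exists>u\<in>Fix. \<exists>n\<in>Ran. p (y - u) < 1 \<and> p (x - (u + n)) < (1::real)})"
  \<comment> \<open>The filter of the points of the closed orbit that approximate components of vectors near \<open>x\<close>.\<close>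
  define G where "G = (INF p\<in>{p. csn p}. principal (A p))"
  have Amono: "A q \<subseteq> A p" if "\<And>x. p x \<le> q x" for p q
    unfolding A_def using that by (blast intro: le_less_trans)
  have evG: "eventually P G \<longleftrightarrow> (\<exists>p. csn p \<and> (\<forall>y\<in>A p. P y))" for P
  proof -
    have "eventually P G \<longleftrightarrow> (\<exists>p\<in>{p. csn p}. eventually P (principal (A p)))"
      unfolding G_def
    proof (rule eventually_INF_base)
      show "{p. csn p} \<noteq> {}" using csn_zero by blast
      fix p q assume pq: "p \<in> {p. csn p}" "q \<in> {p. csn p}"
      then have "p x \<le> p x + q x" "q x \<le> p x + q x" for x using csnD(6) by auto
      then have "A (\<lambda>x. p x + q x) \<subseteq> A p \<inter> A q" using Amono by (intro Int_greatest) auto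
      then show "\<exists>r\<in>{p. csn p}. principal (A r) \<le> inf (principal (A p)) (principal (A q))"
        using csn_add pq by (intro bexI[of _ "\<lambda>x. p x + q x"]) auto
    qed
    then show ?thesis by (auto simp: eventually_principal)
  qed
  have ne: "A p \<noteq> {}" if p: "csn p" for p
  proof -
    obtain q where q: "csn q" "\<And>x. p x \<le> q x" "\<And>T x. T \<in> S \<Longrightarrow> p (T x) \<le> q x"
      using equicontinuous[OF p] by blast
    have "csn (\<lambda>x. 2 * q x)" using csn_scale[OF q(1)] by simp
    then obtain z where "z \<in> {u + n | u n. u \<in> Fix \<and> n \<in> Ran}" and z: "2 * q (z - x) < 1"
      using sum_dense_if_separates[OF sep, of x] unfolding closure_iff by blast
    then obtain u n where un: "z = u + n" "u \<in> Fix" "n \<in> Ran" by blast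
    have "csn (\<lambda>x. 2 * p x)" using csn_scale[OF p] by simp
    then obtain T where T: "T \<in> coS" "2 * p (T z - u) < 1"
      using Fix_in_closed_orbit[OF un(2,3)] un(1) by blast
    have "p (T (x - z)) \<le> q (x - z)"
      using coS_le[of T p q "x - z"] T(1) p q(3) by blast
    then have "p (T x - T z) \<le> q (x - z)" by (simp add: coS_linear[OF T(1)])
    then have "p (T x - u) < 1"
      using csn_triangle[OF p, of "T x" u "T z"] T(2) z csnD(7)[OF q(1), of x z] by simp
    moreover have "p (x - (u + n)) < 1"
      using z q(2)[of "x - z"] csnD(7)[OF q(1), of x z] csnD(6)[OF q(1), of "x - z"] un(1) by simp
    moreover have "T x \<in> C"
      unfolding C_def using T(1) closure_of_subset[of "{T x | T. T \<in> coS}" \<tau>] by auto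
    ultimately have "T x \<in> A p" using un unfolding A_def by blast
    then show ?thesis by blast
  qed
  have "G \<noteq> bot" using ne by (auto simp: evG simp flip: eventually_False)
  moreover have "G \<le> principal C"
    unfolding le_principal evG A_def using csn_zero by blast
  moreover have "tvs_cauchy \<tau> G"
    unfolding tvs_cauchy_def
  proof (intro allI impI)
    fix U assume "zero_nbhd \<tau> U"
    then obtain p where p: "csn p" "\<And>x. p x < 1 \<Longrightarrow> x \<in> U" using zero_nbhd_csn by metis
    obtain q where q: "csn q" "\<And>x. p x \<le> q x" "\<And>T x. T \<in> S \<Longrightarrow> p (T x) \<le> q x"
      using equicontinuous[OF p(1)] by blast
    \<comment> \<open>The factor \<open>4\<close> splits \<open>1\<close> into \<open>1/4 + 1/2 + 1/4\<close> in the estimate of \<open>y - z\<close> through \<open>u\<close> and \<open>v\<close>.\<close>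
    define r where "r = (\<lambda>x. 4 * q x)"
    have r: "csn r" unfolding r_def using csn_scale[OF q(1)] by simp
    have "y - z \<in> U" if yz: "y \<in> A r" "z \<in> A r" for y z
    proof -
      obtain u n where un: "u \<in> Fix" "n \<in> Ran" "r (y - u) < 1" "r (x - (u + n)) < 1"
        using yz(1) unfolding A_def by blast
      obtain v m where vm: "v \<in> Fix" "m \<in> Ran" "r (z - v) < 1" "r (x - (v + m)) < 1"
        using yz(2) unfolding A_def by blast
      have "p (u - v) \<le> q ((u - v) + (n - m))"
        using Fix_part_bound[of "u - v" "n - m" p q] subspace_diff[OF Fix_subspace un(1) vm(1)]
          subspace_diff[OF Ran_subspace un(2) vm(2)] p(1) q(3) by blast
      also have "(u - v) + (n - m) = (u + n) - (v + m)" by simp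
      also have "q \<dots> \<le> q ((u + n) - x) + q (x - (v + m))" by (rule csn_triangle[OF q(1)])
      also have "\<dots> < 1/2" using un(4) vm(4) csnD(7)[OF q(1), of "u + n" x] by (simp add: r_def)
      finally have "p (u - v) < 1/2" .
      moreover have "p (y - u) < 1/4" using un(3) q(2)[of "y - u"] by (simp add: r_def)
      moreover have "p (v - z) < 1/4"
        using vm(3) q(2)[of "z - v"] csnD(7)[OF p(1), of z v] by (simp add: r_def)
      moreover have "p (y - z) \<le> p (y - u) + (p (u - v) + p (v - z))"
        using csn_triangle[OF p(1), of y z u] csn_triangle[OF p(1), of u z v] by simp
      ultimately show ?thesis by (intro p(2)) simp
    qed
    then have "eventually (\<lambda>y. y \<in> A r) G \<and> (\<forall>y z. y \<in> A r \<longrightarrow> z \<in> A r \<longrightarrow> y - z \<in> U)"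
      using r by (auto simp: evG)
    then show "\<forall>\<^sub>F (x, y) in G \<times>\<^sub>F G. x - y \<in> U"
      unfolding eventually_prod_filter by (intro exI[of _ "\<lambda>y. y \<in> A r"]) auto
  qed
  moreover have "tvs_complete \<tau> C"
  proof -
    have "tvs_bounded scl \<tau> C"
      unfolding tvs_bounded_def
    proof (intro allI impI)
      fix U assume "zero_nbhd \<tau> U"
      then obtain p where p: "csn p" "\<And>x. p x < 1 \<Longrightarrow> x \<in> U" using zero_nbhd_csn by metis
      obtain q where q: "csn q" "\<And>x. p x \<le> q x" "\<And>T x. T \<in> S \<Longrightarrow> p (T x) \<le> q x"
        using equicontinuous[OF p(1)] by blast
      have bound: "p y < q x + 1" if y: "y \<in> C" for y
      proof -
        obtain T where T: "T \<in> coS" "p (T x - y) < 1"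
          using y p(1) unfolding C_def closure_iff by blast
        have "p (T x) \<le> q x" using coS_le[of T p q x] T(1) p(1) q(3) by blast
        then show ?thesis using T(2) csnD(5)[OF p(1), of "T x" "T x - y"] by simp
      qed
      have "C \<subseteq> scl c ` U" if c: "q x + 1 \<le> norm c" for c
      proof
        fix y assume y: "y \<in> C"
        have c0: "c \<noteq> 0" using c csnD(6)[OF q(1), of x] by auto
        have "p (scl (inverse c) y) < 1"
          using bound[OF y] c c0 by (simp add: csnD(2)[OF p(1)] norm_divide field_simps)
        then show "y \<in> scl c ` U" using c0 p(2) by (intro image_eqI[of _ _ "scl (inverse c) y"]) auto
      qed
      then show "absorbs scl U C"
        unfolding absorbs_def using csnD(6)[OF q(1), of x] by (intro exI[of _ "q x + 1"]) auto
    qed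
    moreover have "closedin \<tau> C" by (simp add: C_def)
    ultimately show ?thesis using quasi_complete unfolding quasi_complete_def by blast
  qed
  ultimately obtain w where w: "limitin \<tau> (\<lambda>y. y) w G" unfolding tvs_complete_def by blast
  have approx: "\<exists>u\<in>Fix. \<exists>n\<in>Ran. p (u - w) < 1 \<and> p (n - (x - w)) < 1" if p: "csn p" for p
  proof -
    define r where "r = (\<lambda>x. 4 * p x)"
    have r: "csn r" unfolding r_def using csn_scale[OF p] by simp
    have "\<forall>\<^sub>F y in G. r (y - w) < 1" using w r unfolding limitin_iff by blast
    moreover have "\<forall>\<^sub>F y in G. y \<in> A r" using r by (auto simp: evG)
    ultimately have "\<forall>\<^sub>F y in G. r (y - w) < 1 \<and> y \<in> A r" by (rule eventually_conj)
    then obtain y where y: "r (y - w) < 1" "y \<in> A r"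
      using eventually_happens'[OF \<open>G \<noteq> bot\<close>] by blast
    then obtain u n where un: "u \<in> Fix" "n \<in> Ran" "r (y - u) < 1" "r (x - (u + n)) < 1"
      unfolding A_def by blast
    have uw: "p (u - w) < 1/2"
      using csn_triangle[OF p, of u w y] csnD(7)[OF p, of u y] un(3) y(1) by (simp add: r_def)
    have "n - (x - w) = ((u + n) - x) - (u - w)" by (simp add: algebra_simps)
    then have "p (n - (x - w)) \<le> p ((u + n) - x) + p (u - w)" using csnD(5)[OF p] by metis
    then have "p (n - (x - w)) < 1"
      using uw un(4) csnD(7)[OF p, of x "u + n"] by (simp add: r_def)
    then show ?thesis using uw un by force
  qed
  have "w \<in> Fix" using approx Fix_closed unfolding subset_iff closure_iff by blast
  moreover have "x - w \<in> \<tau> closure_of Ran" unfolding closure_iff using approx by blast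
  then have "x - w \<in> Ran" by (simp add: closed_lin_def)
  ultimately show ?thesis by blast
qed

end

section \<open>The adjoint semigroup\<close>

lemma fun_scale_apply: "fun_scale scl c f x = scl c (f x)"
  by (simp add: fun_scale_def)

context lcs
begin

lemma weakstar_nbhd:
  assumes "openin weakstar W" "\<psi> \<in> W"
  obtains F e where "finite F" "e > 0"
    "\<And>\<eta>. \<eta> \<in> X' \<Longrightarrow> (\<And>x. x \<in> F \<Longrightarrow> norm (\<eta> x - \<psi> x) < e) \<Longrightarrow> \<eta> \<in> W"
proof -
  define B where "B = {{\<phi> \<in> X'. \<phi> x \<in> U} | x U. open U}"
  have "generate_topology_on B W"
    using assms(1) unfolding weakstar_topology_def B_def openin_topology_generated_by_iff .
  then have "\<psi> \<in> W \<longrightarrow> (\<exists>F e. finite F \<and> e > 0 \<and>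
      (\<forall>\<eta>\<in>X'. (\<forall>x\<in>F. norm (\<eta> x - \<psi> x) < e) \<longrightarrow> \<eta> \<in> W))"
  proof induction
    case Empty
    then show ?case by simp
  next
    case (Int V W)
    show ?case
    proof
      assume "\<psi> \<in> V \<inter> W"
      then obtain F e G d where *: "finite F" "e > 0" "finite G" "d > 0"
        "\<And>\<eta>. \<eta> \<in> X' \<Longrightarrow> \<forall>x\<in>F. norm (\<eta> x - \<psi> x) < e \<Longrightarrow> \<eta> \<in> V"
        "\<And>\<eta>. \<eta> \<in> X' \<Longrightarrow> \<forall>x\<in>G. norm (\<eta> x - \<psi> x) < d \<Longrightarrow> \<eta> \<in> W"
        using Int.IH by (metis IntD1 IntD2)
      have "\<eta> \<in> V \<inter> W" if "\<eta> \<in> X'" "\<forall>x\<in>F \<union> G. norm (\<eta> x - \<psi> x) < min e d" for \<eta>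
        using that *(5,6)[of \<eta>] by simp
      then show "\<exists>F e. finite F \<and> e > 0 \<and>
          (\<forall>\<eta>\<in>X'. (\<forall>x\<in>F. norm (\<eta> x - \<psi> x) < e) \<longrightarrow> \<eta> \<in> V \<inter> W)"
        using *(1-4) by (intro exI[of _ "F \<union> G"] exI[of _ "min e d"]) auto
    qed
  next
    case (UN \<U>)
    show ?case
    proof
      assume "\<psi> \<in> \<Union>\<U>"
      then obtain V where V: "V \<in> \<U>" "\<psi> \<in> V" by blast
      then obtain F e where "finite F" "e > 0" "\<forall>\<eta>\<in>X'. (\<forall>x\<in>F. norm (\<eta> x - \<psi> x) < e) \<longrightarrow> \<eta> \<in> V"
        using UN.IH by blast
      then show "\<exists>F e. finite F \<and> e > 0 \<and>
          (\<forall>\<eta>\<in>X'. (\<forall>x\<in>F. norm (\<eta> x - \<psi> x) < e) \<longrightarrow> \<eta> \<in> \<Union>\<U>)"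
        using V(1) by (intro exI[of _ F] exI[of _ e]) auto
    qed
  next
    case (Basis V)
    show ?case
    proof
      assume \<psi>: "\<psi> \<in> V"
      obtain x U where V: "V = {\<phi> \<in> X'. \<phi> x \<in> U}" "open U" using Basis by (auto simp: B_def)
      then obtain e where e: "e > 0" "ball (\<psi> x) e \<subseteq> U" using \<psi> openE by blast
      have "\<eta> \<in> V" if "\<eta> \<in> X'" "\<forall>x\<in>{x}. norm (\<eta> x - \<psi> x) < e" for \<eta>
      proof -
        have "\<eta> x \<in> ball (\<psi> x) e" using that(2) by (simp add: dist_norm norm_minus_commute)
        with e(2) have "\<eta> x \<in> U" by (rule subsetD)
        then show ?thesis using that(1) by (simp add: V(1))
      qed
      then show "\<exists>F e. finite F \<and> e > 0 \<and>
          (\<forall>\<eta>\<in>X'. (\<forall>x\<in>F. norm (\<eta> x - \<psi> x) < e) \<longrightarrow> \<eta> \<in> V)"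
        using e(1) by (intro exI[of _ "{x}"] exI[of _ e]) auto
    qed
  qed
  from mp[OF this assms(2)] obtain F e where "finite F" "e > 0"
    and nbhd: "\<forall>\<eta>\<in>X'. (\<forall>x\<in>F. norm (\<eta> x - \<psi> x) < e) \<longrightarrow> \<eta> \<in> W" by (elim exE conjE)
  then show thesis by (intro that[of F e]) auto
qed

text \<open>
  The vector \<open>w\<close> is a linear combination of the elements of \<open>F\<close>. In the induction step a suitable
  multiple of the evaluation at \<open>x\<close> is subtracted from \<open>f\<close>, so that the difference vanishes on the
  common kernel of the evaluations at the points of \<open>F\<close>.
\<close>

lemma functional_is_evaluation:
  assumes "finite F"
    and "\<And>\<phi> \<psi>. \<phi> \<in> X' \<Longrightarrow> \<psi> \<in> X' \<Longrightarrow> f (\<phi> + \<psi>) = f \<phi> + f \<psi>"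
    and "\<And>c \<phi>. \<phi> \<in> X' \<Longrightarrow> f (fun_scale (*) c \<phi>) = c * f \<phi>"
    and "\<And>\<phi>. \<phi> \<in> X' \<Longrightarrow> (\<And>x. x \<in> F \<Longrightarrow> \<phi> x = 0) \<Longrightarrow> f \<phi> = 0"
  shows "\<exists>w. \<forall>\<phi>\<in>X'. f \<phi> = \<phi> w"
  using assms
proof (induction F arbitrary: f)
  case empty
  then have "\<forall>\<phi>\<in>X'. f \<phi> = \<phi> 0" by (simp add: dual_linear)
  then show ?case by blast
next
  case (insert x F)
  show ?case
  proof (cases "\<exists>\<phi>\<in>X'. (\<forall>y\<in>F. \<phi> y = 0) \<and> \<phi> x \<noteq> 0")
    case False
    then show ?thesis by (intro insert.IH insert.prems) auto
  next
    case True
    then obtain \<phi>\<^sub>0 where 0: "\<phi>\<^sub>0 \<in> X'" "\<And>y. y \<in> F \<Longrightarrow> \<phi>\<^sub>0 y = 0" "\<phi>\<^sub>0 x \<noteq> 0" by blast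
    define c where "c = f \<phi>\<^sub>0 / \<phi>\<^sub>0 x"
    have "\<exists>w. \<forall>\<phi>\<in>X'. f \<phi> - c * \<phi> x = \<phi> w"
    proof (rule insert.IH)
      show "f (\<phi> + \<psi>) - c * (\<phi> + \<psi>) x = (f \<phi> - c * \<phi> x) + (f \<psi> - c * \<psi> x)"
        if "\<phi> \<in> X'" "\<psi> \<in> X'" for \<phi> \<psi>
        using that by (simp add: insert.prems(1) algebra_simps)
      show "f (fun_scale (*) d \<phi>) - c * fun_scale (*) d \<phi> x = d * (f \<phi> - c * \<phi> x)" if "\<phi> \<in> X'" for d \<phi>
        unfolding insert.prems(2)[OF that] by (simp add: fun_scale_apply algebra_simps)
      fix \<phi> assume \<phi>: "\<phi> \<in> X'" "\<And>y. y \<in> F \<Longrightarrow> \<phi> y = 0"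
      \<comment> \<open>Adding \<open>d \<phi>\<^sub>0\<close> moves \<open>\<phi>\<close> into the common kernel of all evaluations.\<close>
      define d where "d = - (\<phi> x / \<phi>\<^sub>0 x)"
      have d: "fun_scale (*) d \<phi>\<^sub>0 \<in> X'" using dual_scale[OF 0(1)] .
      have "f (\<phi> + fun_scale (*) d \<phi>\<^sub>0) = 0"
      proof (rule insert.prems(3))
        show "\<phi> + fun_scale (*) d \<phi>\<^sub>0 \<in> X'" using dual_add[OF \<phi>(1) d] .
        show "(\<phi> + fun_scale (*) d \<phi>\<^sub>0) y = 0" if "y \<in> insert x F" for y
          using that 0(2,3) \<phi>(2) by (auto simp: fun_scale_apply d_def)
      qed
      then have "f \<phi> + d * f \<phi>\<^sub>0 = 0"
        using insert.prems(1)[OF \<phi>(1) d] insert.prems(2)[OF 0(1)] by simp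
      then show "f \<phi> - c * \<phi> x = 0" by (simp add: c_def d_def)
    qed
    then obtain w where w: "\<And>\<phi>. \<phi> \<in> X' \<Longrightarrow> f \<phi> - c * \<phi> x = \<phi> w" by blast
    have "f \<phi> = \<phi> (w + scl c x)" if "\<phi> \<in> X'" for \<phi>
      using w[OF that] by (simp add: dual_linear[OF that] algebra_simps)
    then show ?thesis by blast
  qed
qed

end

context lcs_semigroup
begin

lemma coS'_maps: "T \<in> coS' \<Longrightarrow> T \<in> extensional X' \<and> (\<forall>\<phi>\<in>X'. T \<phi> \<in> X')"
proof (induction rule: co_induct)
  case (incl T)
  then obtain R where R: "R \<in> S" "T = adjoint_on X' R" by (auto simp: adjoint_semigroup_def)
  then have "T \<phi> \<in> X'" if "\<phi> \<in> X'" for \<phi>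
    using dual_comp[OF that R(1)] that by (simp add: adjoint_on_def)
  moreover have "T \<in> extensional X'" by (simp add: R(2) adjoint_on_def)
  ultimately show ?case by blast
next
  case (conv T U t)
  have "fun_scale (*) (of_real t) (T \<phi>) + fun_scale (*) (of_real (1 - t)) (U \<phi>) \<in> X'"
    if "\<phi> \<in> X'" for \<phi>
    using conv that by (intro dual_add dual_scale) auto
  moreover have "fun_scale (*) (of_real t) (T \<phi>) + fun_scale (*) (of_real (1 - t)) (U \<phi>) = undefined"
    if "\<phi> \<notin> X'" for \<phi>
  proof -
    have "T \<phi> = undefined" "U \<phi> = undefined" using conv that by (auto simp: extensional_def)
    then show ?thesis by (simp add: fun_eq_iff fun_scale_apply flip: distrib_right)
  qed
  ultimately show ?case unfolding extensional_def by blast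
qed

lemma coS'_linear: "T \<in> coS' \<Longrightarrow>
  (\<forall>\<phi>\<in>X'. \<forall>\<psi>\<in>X'. T (\<phi> + \<psi>) = T \<phi> + T \<psi>) \<and> (\<forall>c. \<forall>\<phi>\<in>X'. T (fun_scale (*) c \<phi>) = fun_scale (*) c (T \<phi>))"
proof (induction rule: co_induct)
  case (incl T)
  then obtain R where R: "T = adjoint_on X' R" by (auto simp: adjoint_semigroup_def)
  have T: "T \<phi> = \<phi> \<circ> R" if "\<phi> \<in> X'" for \<phi> using that by (simp add: R adjoint_on_def)
  show ?case
  proof (intro conjI ballI allI)
    fix \<phi> assume \<phi>: "\<phi> \<in> X'"
    show "T (\<phi> + \<psi>) = T \<phi> + T \<psi>" if "\<psi> \<in> X'" for \<psi>
      unfolding T[OF \<phi>] T[OF that] T[OF dual_add[OF \<phi> that]] by (simp add: fun_eq_iff)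
    show "T (fun_scale (*) c \<phi>) = fun_scale (*) c (T \<phi>)" for c
      unfolding T[OF \<phi>] T[OF dual_scale[OF \<phi>]] by (simp add: fun_eq_iff fun_scale_apply)
  qed
next
  case (conv T U t)
  then show ?case by (auto simp: fun_eq_iff fun_scale_apply algebra_simps)
qed

lemma coS'_fix':
  assumes "T \<in> coS'" "\<phi> \<in> Fix'"
  shows "T \<phi> = \<phi>"
  using assms(1)
proof (induction rule: co_induct)
  case (incl T)
  then show ?case using assms(2) by (auto simp: fix_on_def)
next
  case (conv T U t)
  then show ?case by (auto simp: fun_eq_iff fun_scale_apply simp flip: distrib_right)
qed

lemma coS'_fix: "T \<in> coS' \<Longrightarrow> x \<in> Fix \<Longrightarrow> \<forall>\<phi>\<in>X'. T \<phi> x = \<phi> x"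
proof (induction rule: co_induct)
  case (incl T)
  then show ?case by (auto simp: adjoint_semigroup_def adjoint_on_def Fix_iff)
next
  case (conv T U t)
  then show ?case by (auto simp: fun_scale_apply simp flip: distrib_right)
qed

text \<open>
  The convex combination of adjoints is taken pointwise; off the dual both sides are
  \<^term>\<open>undefined\<close>.
\<close>

lemma coS'_adjoint: "T \<in> coS \<Longrightarrow> adjoint_on X' T \<in> coS'"
proof (induction rule: co_induct)
  case (incl T)
  then show ?case by (auto simp: adjoint_semigroup_def intro: co_superset)
next
  case (conv T U t)
  have "adjoint_on X' (\<lambda>x. scl (of_real t) (T x) + scl (of_real (1 - t)) (U x)) =
      (\<lambda>\<phi>. fun_scale (*) (of_real t) (adjoint_on X' T \<phi>) + fun_scale (*) (of_real (1 - t)) (adjoint_on X' U \<phi>))"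
    by (auto simp: fun_eq_iff adjoint_on_def fun_scale_apply dual_linear simp flip: distrib_right)
  then show ?case using co_convex[OF conv] by (simp only:)
qed

lemma coS'_subset_K': "coS' \<subseteq> K'"
  unfolding K_dual_def pointwise_closure_def using coS'_maps
  by (intro closure_of_subset) (auto simp: PiE_def)

lemma K'_maps: "R \<in> K' \<Longrightarrow> R \<in> extensional X' \<and> (\<forall>\<phi>\<in>X'. R \<phi> \<in> X')"
  unfolding K_dual_def pointwise_closure_def
  using closure_of_subset_topspace[of "product_topology (\<lambda>_. weakstar) X'" coS'] by (auto simp: PiE_def)

lemma continuous_map_eval':
  assumes "\<phi> \<in> X'"
  shows "continuous_map (product_topology (\<lambda>_. weakstar) X') euclidean (\<lambda>R. R \<phi> x)"
  using continuous_map_compose[OF continuous_map_product_projection[OF assms, of "\<lambda>_. weakstar"]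
      continuous_map_weakstar_eval[of x]] by (simp add: comp_def)

lemma K'_closed:
  assumes "R \<in> K'" "continuous_map (product_topology (\<lambda>_. weakstar) X') euclidean g" "closed B"
    "\<And>T. T \<in> coS' \<Longrightarrow> g T \<in> B"
  shows "g R \<in> B"
  using assms(1) unfolding K_dual_def pointwise_closure_def topspace_weakstar
  by (rule continuous_map_closure_in_closed[OF _ assms(2-4)])

lemma K'_fix':
  assumes "R \<in> K'" "\<phi> \<in> Fix'"
  shows "R \<phi> = \<phi>"
proof
  fix x
  have "R \<phi> x \<in> {\<phi> x}"
    by (rule K'_closed[OF assms(1) continuous_map_eval'[OF Fix'_dual[OF assms(2)]]])
      (simp_all add: coS'_fix'[OF _ assms(2)])
  then show "R \<phi> x = \<phi> x" by simp
qed

lemma K'_fix: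
  assumes "R \<in> K'" "x \<in> Fix" "\<phi> \<in> X'"
  shows "R \<phi> x = \<phi> x"
proof -
  have "R \<phi> x \<in> {\<phi> x}"
    by (rule K'_closed[OF assms(1) continuous_map_eval'[OF assms(3)]])
      (use coS'_fix assms in auto)
  then show ?thesis by simp
qed

lemma K'_linear:
  assumes "R \<in> K'" "\<phi> \<in> X'" "\<psi> \<in> X'"
  shows "R (\<phi> + \<psi>) x = R \<phi> x + R \<psi> x" "R (fun_scale (*) c \<phi>) x = c * R \<phi> x"
proof -
  have "R (\<phi> + \<psi>) x - (R \<phi> x + R \<psi> x) \<in> {0}"
    by (rule K'_closed[OF assms(1), of "\<lambda>R. R (\<phi> + \<psi>) x - (R \<phi> x + R \<psi> x)"])
      (auto intro!: continuous_map_diff continuous_map_add continuous_map_eval' assms dual_add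
        simp: coS'_linear assms)
  then show "R (\<phi> + \<psi>) x = R \<phi> x + R \<psi> x" by simp
  have cont: "continuous_map (product_topology (\<lambda>_. weakstar) X') euclidean (\<lambda>R. c * R \<phi> x)"
    using continuous_map_compose[OF continuous_map_eval'[OF assms(2), of x], of euclidean "\<lambda>z. c * z"]
    by (auto simp: comp_def intro: continuous_intros)
  have "R (fun_scale (*) c \<phi>) x - c * R \<phi> x \<in> {0}"
    by (rule K'_closed[OF assms(1), of "\<lambda>R. R (fun_scale (*) c \<phi>) x - c * R \<phi> x"])
      (auto intro!: continuous_map_diff cont continuous_map_eval' dual_scale assms(2)
        simp: coS'_linear[THEN conjunct2, rule_format, OF _ assms(2)] fun_scale_apply)
  then show "R (fun_scale (*) c \<phi>) x = c * R \<phi> x" by simp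
qed

text \<open>
  A weak* continuous \<open>Q\<close> is the adjoint of an operator on \<open>X\<close>, and \<open>Q S' = Q\<close> says that this
  operator maps into \<open>fix S\<close>.
\<close>

lemma separates_if_dual_zero:
  assumes Q: "is_zero_on X' K' Q" and cont: "continuous_map weakstar weakstar Q"
  shows "Fix_separates_Fix'"
proof (rule Fix_separatesI)
  fix x
  have QK: "Q \<in> K'" and zero: "\<And>R. R \<in> K' \<Longrightarrow> compose X' Q R = Q"
    using Q unfolding is_zero_on_def by auto
  have "continuous_map weakstar euclidean (\<lambda>\<phi>. Q \<phi> x)"
    using continuous_map_compose[OF cont continuous_map_weakstar_eval[of x]] by (simp add: comp_def)
  then have op: "openin weakstar {\<phi> \<in> topspace weakstar. Q \<phi> x \<in> ball 0 1}"
    by (rule openin_continuous_map_preimage) simp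
  have lin: "Q (fun_scale (*) c \<phi>) x = c * Q \<phi> x" if "\<phi> \<in> X'" for c \<phi>
    using K'_linear(2)[OF QK that that] .
  have "fun_scale (*) 0 0 = (0 :: 'a \<Rightarrow> complex)" by (simp add: fun_scale_apply fun_eq_iff)
  then have "Q 0 x = 0" using lin[OF zero_in_dual, of 0] by simp
  then have "0 \<in> {\<phi> \<in> topspace weakstar. Q \<phi> x \<in> ball 0 1}" using zero_in_dual by simp
  from weakstar_nbhd[OF op this] obtain F e where F: "finite F" "e > 0"
    "\<And>\<eta>. \<eta> \<in> X' \<Longrightarrow> (\<And>x. x \<in> F \<Longrightarrow> norm (\<eta> x - 0 x) < e) \<Longrightarrow> norm (Q \<eta> x) < 1"
    by auto
  have "\<exists>w. \<forall>\<phi>\<in>X'. Q \<phi> x = \<phi> w"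
  proof (rule functional_is_evaluation[OF F(1)])
    show "Q (\<phi> + \<psi>) x = Q \<phi> x + Q \<psi> x" if "\<phi> \<in> X'" "\<psi> \<in> X'" for \<phi> \<psi>
      using K'_linear(1)[OF QK that] .
    show "Q (fun_scale (*) c \<phi>) x = c * Q \<phi> x" if "\<phi> \<in> X'" for c \<phi> using lin[OF that] .
    fix \<phi> assume \<phi>: "\<phi> \<in> X'" "\<And>y. y \<in> F \<Longrightarrow> \<phi> y = 0"
    show "Q \<phi> x = 0"
    proof (rule ccontr)
      \<comment> \<open>All multiples of \<open>\<phi>\<close> lie in the neighbourhood; one of them has value \<open>1\<close>.\<close>
      assume ne: "Q \<phi> x \<noteq> 0"
      have "norm (Q (fun_scale (*) (inverse (Q \<phi> x)) \<phi>) x) < 1"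
        using \<phi> F(2) by (intro F(3) dual_scale) (auto simp: fun_scale_apply)
      then show False using ne by (simp add: lin[OF \<phi>(1)])
    qed
  qed
  then obtain w where w: "\<And>\<phi>. \<phi> \<in> X' \<Longrightarrow> Q \<phi> x = \<phi> w" by blast
  have "T w = w" if T: "T \<in> S" for T
  proof (rule dual_separates)
    fix \<phi> assume \<phi>: "\<phi> \<in> X'"
    have "adjoint_on X' T \<in> K'" using T co_superset coS'_adjoint coS'_subset_K' by blast
    from fun_cong[OF zero[OF this], of \<phi>] have "Q (\<phi> \<circ> T) = Q \<phi>"
      using \<phi> by (simp add: compose_def adjoint_on_def)
    then show "\<phi> (T w) = \<phi> w" using w[OF \<phi>] w[OF dual_comp[OF \<phi> T]] by simp
  qed
  then have "w \<in> Fix" by (simp add: Fix_iff)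
  moreover have "\<phi> w = \<phi> x" if "\<phi> \<in> Fix'" for \<phi>
    using w[OF Fix'_dual[OF that]] K'_fix'[OF QK that] by simp
  ultimately show "\<exists>z\<in>Fix. \<forall>\<phi>\<in>Fix'. \<phi> z = \<phi> x" by blast
qed

end

section \<open>The mean ergodic projection\<close>

context bounded_amenable_semigroup
begin

lemma K_le:
  assumes "R \<in> K" "csn p" "\<And>T x. T \<in> S \<Longrightarrow> p (T x) \<le> q x"
  shows "p (R x) \<le> q x"
  using K_bound[OF assms(1,2)] assms(3) by blast

lemma dual_comp_K:
  assumes "\<phi> \<in> X'" "R \<in> K"
  shows "\<phi> \<circ> R \<in> X'"
proof -
  obtain q where q: "csn q" "\<And>T x. T \<in> S \<Longrightarrow> norm (\<phi> (T x)) \<le> q x"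
    using equicontinuous[OF dual_csn[OF assms(1)]] by metis
  show ?thesis
  proof (rule dualI[OF _ _ q(1)])
    show "norm ((\<phi> \<circ> R) x) \<le> q x" for x
      using K_le[of R "\<lambda>x. norm (\<phi> x)" q] assms q(2) dual_csn by simp
  qed (simp_all add: K_linear[OF assms(2)] dual_linear[OF assms(1)])
qed

text \<open>
  The vectors on which the net tends to \<open>0\<close> for the seminorm \<open>p\<close> form a subspace, which is closed
  because \<open>p \<circ> N \<alpha>\<close> is dominated by one continuous seminorm. The weak topology is covered by
  \<open>p = norm \<circ> \<phi>\<close>.
\<close>

lemma net_tendsto_0_on_Ran:
  assumes dir: "directed A le" and NK: "\<And>\<alpha>. \<alpha> \<in> A \<Longrightarrow> N \<alpha> \<in> K" and p: "csn p"
    and rg: "\<And>y R. R \<in> S \<Longrightarrow> ((\<lambda>\<alpha>. p (N \<alpha> (y - R y))) \<longlongrightarrow> 0) (tails A le)"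
    and y: "y \<in> Ran"
  shows "((\<lambda>\<alpha>. p (N \<alpha> y)) \<longlongrightarrow> 0) (tails A le)"
proof -
  note inA = eventually_in_tails[OF dir]
  have nonneg: "\<forall>\<^sub>F \<alpha> in tails A le. 0 \<le> p (N \<alpha> x)" for x
    using csnD(6)[OF p] by simp
  have span: "((\<lambda>\<alpha>. p (N \<alpha> z)) \<longlongrightarrow> 0) (tails A le)" if "z \<in> span (rg_Id_minus S)" for z
    using that
  proof (induction rule: span_induct_alt)
    case base
    have "\<forall>\<^sub>F \<alpha> in tails A le. p (N \<alpha> 0) = 0"
      using inA
    proof eventually_elim
      case (elim \<alpha>)
      have "N \<alpha> 0 = 0" using K_linear(2)[OF NK[OF elim], of 0 0] by simp
      then show ?case using csnD(3)[OF p] by simp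
    qed
    then show ?case by (rule tendsto_eventually)
  next
    case (step c x z)
    obtain u R where x: "x = u - R u" "R \<in> S" using step(1) by (auto simp: rg_Id_minus_def)
    have "((\<lambda>\<alpha>. norm c * p (N \<alpha> x) + p (N \<alpha> z)) \<longlongrightarrow> norm c * 0 + 0) (tails A le)"
      using rg[OF x(2), of u] step(2) unfolding x(1) by (intro tendsto_intros)
    then have lim: "((\<lambda>\<alpha>. norm c * p (N \<alpha> x) + p (N \<alpha> z)) \<longlongrightarrow> 0) (tails A le)" by simp
    have "\<forall>\<^sub>F \<alpha> in tails A le. p (N \<alpha> (scl c x + z)) \<le> norm c * p (N \<alpha> x) + p (N \<alpha> z)"
      using inA
    proof eventually_elim
      case (elim \<alpha>)
      show ?case
        using csnD(1)[OF p, of "scl c (N \<alpha> x)" "N \<alpha> z"]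
        by (simp add: K_linear[OF NK[OF elim]] csnD(2)[OF p])
    qed
    then show ?case using tendsto_sandwich[OF nonneg _ tendsto_const lim] by blast
  qed
  obtain q where q: "csn q" "\<And>T x. T \<in> S \<Longrightarrow> p (T x) \<le> q x" using equicontinuous[OF p] by metis
  show ?thesis
    unfolding tendsto_iff
  proof (intro allI impI)
    fix e :: real assume e: "e > 0"
    then obtain z where z: "z \<in> span (rg_Id_minus S)" "q (z - y) < e / 2"
      using closure_ex[OF y[unfolded closed_lin_def] q(1), of "e / 2"] by auto
    have "\<forall>\<^sub>F \<alpha> in tails A le. dist (p (N \<alpha> z)) 0 < e / 2"
      using span[OF z(1)] half_gt_zero[OF e] unfolding tendsto_iff by blast
    with inA show "\<forall>\<^sub>F \<alpha> in tails A le. dist (p (N \<alpha> y)) 0 < e"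
    proof eventually_elim
      case (elim \<alpha>)
      have "p (N \<alpha> (z - y)) \<le> q (z - y)" using K_le[of "N \<alpha>" p q] NK[OF elim(1)] p q(2) by blast
      moreover have "p (N \<alpha> y) \<le> p (N \<alpha> z) + p (N \<alpha> (z - y))"
        using csnD(5)[OF p, of "N \<alpha> z" "N \<alpha> z - N \<alpha> y"] by (simp add: K_linear[OF NK[OF elim(1)]])
      ultimately show ?case using elim(2) z(2) csnD(6)[OF p] by simp
    qed
  qed
qed

text \<open>The vector \<open>u\<close> is the component of \<open>x\<close> in \<open>fix S\<close>; on it every operator of \<open>K\<close> is the identity.\<close>

lemma right_ergodic_net_converges:
  assumes u: "u \<in> Fix" "x - u \<in> Ran"
  shows "right_ergodic_net scl weak S A le N \<Longrightarrow> limitin weak (\<lambda>\<alpha>. N \<alpha> x) u (tails A le)"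
    and "right_ergodic_net scl \<tau> S A le N \<Longrightarrow> limitin \<tau> (\<lambda>\<alpha>. N \<alpha> x) u (tails A le)"
proof -
  have split: "\<forall>\<^sub>F \<alpha> in tails A le. N \<alpha> x - u = N \<alpha> (x - u)"
    if "directed A le" "\<And>\<alpha>. \<alpha> \<in> A \<Longrightarrow> N \<alpha> \<in> K"
    using eventually_in_tails[OF that(1)]
    by (rule eventually_mono) (simp add: K_linear[OF that(2)] K_fix[OF that(2) u(1)])
  {
    assume net: "right_ergodic_net scl weak S A le N"
    then have dir: "directed A le" and NK: "\<And>\<alpha>. \<alpha> \<in> A \<Longrightarrow> N \<alpha> \<in> K"
      and rg: "\<And>y R. R \<in> S \<Longrightarrow> limitin weak (\<lambda>\<alpha>. N \<alpha> (y - R y)) 0 (tails A le)"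
      unfolding right_ergodic_net_def operator_net_def K_space_def by blast+
    have split': "\<forall>\<^sub>F \<alpha> in tails A le. N \<alpha> x - u = N \<alpha> (x - u)" by (rule split[OF dir NK])
    show "limitin weak (\<lambda>\<alpha>. N \<alpha> x) u (tails A le)"
      unfolding limitin_weak
    proof
      fix \<phi> assume \<phi>: "\<phi> \<in> X'"
      have "((\<lambda>\<alpha>. \<phi> (N \<alpha> (y - R y))) \<longlongrightarrow> 0) (tails A le)" if "R \<in> S" for y R
        using rg[OF that, of y] \<phi> unfolding limitin_weak by (metis dual_linear(3))
      then have "((\<lambda>\<alpha>. norm (\<phi> (N \<alpha> (x - u)))) \<longlongrightarrow> 0) (tails A le)"
        by (intro net_tendsto_0_on_Ran[OF dir NK dual_csn[OF \<phi>] _ u(2)] tendsto_norm_zero)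
      then have "((\<lambda>\<alpha>. \<phi> (N \<alpha> (x - u))) \<longlongrightarrow> 0) (tails A le)" by (rule tendsto_norm_zero_cancel)
      moreover have "\<forall>\<^sub>F \<alpha> in tails A le. \<phi> (N \<alpha> (x - u)) = \<phi> (N \<alpha> x) - \<phi> u"
        using split' by (rule eventually_mono) (simp only: dual_linear(5)[OF \<phi>, symmetric])
      ultimately have "((\<lambda>\<alpha>. \<phi> (N \<alpha> x) - \<phi> u) \<longlongrightarrow> 0) (tails A le)"
        by (rule Lim_transform_eventually)
      then show "((\<lambda>\<alpha>. \<phi> (N \<alpha> x)) \<longlongrightarrow> \<phi> u) (tails A le)" by (simp add: LIM_zero_iff)
    qed
  next
    assume net: "right_ergodic_net scl \<tau> S A le N"
    then have dir: "directed A le" and NK: "\<And>\<alpha>. \<alpha> \<in> A \<Longrightarrow> N \<alpha> \<in> K"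
      and rg: "\<And>y R. R \<in> S \<Longrightarrow> limitin \<tau> (\<lambda>\<alpha>. N \<alpha> (y - R y)) 0 (tails A le)"
      using pointwise_closure_subset_K unfolding right_ergodic_net_def operator_net_def by blast+
    have split': "\<forall>\<^sub>F \<alpha> in tails A le. N \<alpha> x - u = N \<alpha> (x - u)" by (rule split[OF dir NK])
    show "limitin \<tau> (\<lambda>\<alpha>. N \<alpha> x) u (tails A le)"
      unfolding limitin_iff
    proof (intro allI impI)
      fix p assume p: "csn p"
      have "((\<lambda>\<alpha>. p (N \<alpha> (y - R y))) \<longlongrightarrow> 0) (tails A le)" if "R \<in> S" for y R
        unfolding tendsto_iff
        using eventually_csn[OF rg[OF that] p] csnD(6)[OF p] by simp
      then have "((\<lambda>\<alpha>. p (N \<alpha> (x - u))) \<longlongrightarrow> 0) (tails A le)"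
        by (intro net_tendsto_0_on_Ran[OF dir NK p _ u(2)])
      then have "\<forall>\<^sub>F \<alpha> in tails A le. p (N \<alpha> (x - u)) < 1" by (rule order_tendstoD(2)) simp
      with split' show "\<forall>\<^sub>F \<alpha> in tails A le. p (N \<alpha> x - u) < 1"
        by eventually_elim simp
    qed
  }
qed

text \<open>
  The projection onto \<open>Fix\<close> along \<open>Ran\<close>. Such a map belongs to \<open>K\<close>, and is therefore linear and
  continuous.
\<close>

definition mean_ergodic_projection :: "('a \<Rightarrow> 'a) \<Rightarrow> bool" where
  "mean_ergodic_projection P \<longleftrightarrow> (\<forall>x. P x \<in> Fix \<and> x - P x \<in> Ran)"

lemma projection_net:
  assumes P: "mean_ergodic_projection P"
  obtains A :: "('a set \<times> ('a \<Rightarrow> real)) set" and le N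
  where "directed A le" "\<And>\<alpha>. \<alpha> \<in> A \<Longrightarrow> N \<alpha> \<in> coS" "\<And>x. limitin \<tau> (\<lambda>\<alpha>. N \<alpha> x) (P x) (tails A le)"
    "right_ergodic_net scl weak S A le N"
proof -
  obtain A :: "('a set \<times> ('a \<Rightarrow> real)) set" and le N where net: "directed A le"
      "\<And>\<alpha>. \<alpha> \<in> A \<Longrightarrow> N \<alpha> \<in> coS" "\<And>y. y \<in> Ran \<Longrightarrow> limitin \<tau> (\<lambda>\<alpha>. N \<alpha> y) 0 (tails A le)"
    using ergodic_net_exists by blast
  have on: "operator_net scl \<tau> S A le N" "operator_net scl weak S A le N"
    using net(2) by (auto intro: operator_net_coS[OF net(1)])
  have "y - R y \<in> Ran" if "R \<in> S" for y R using rg_subset_Ran that by (auto simp: rg_Id_minus_def)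
  note lim = net(3)[OF this]
  have "right_ergodic_net scl \<tau> S A le N" "right_ergodic_net scl weak S A le N"
    unfolding right_ergodic_net_def using on lim limitin_weak_if_limitin[OF lim] by blast+
  have "limitin \<tau> (\<lambda>\<alpha>. N \<alpha> x) (P x) (tails A le)" for x
    using P \<open>right_ergodic_net scl \<tau> S A le N\<close>
    by (intro right_ergodic_net_converges(2)) (auto simp: mean_ergodic_projection_def)
  from net(1,2) this \<open>right_ergodic_net scl weak S A le N\<close> show thesis by (rule that)
qed

lemma projection_in_K:
  assumes P: "mean_ergodic_projection P"
  shows "P \<in> K"
proof -
  obtain A :: "('a set \<times> ('a \<Rightarrow> real)) set" and le N where net: "directed A le"
      "\<And>\<alpha>. \<alpha> \<in> A \<Longrightarrow> N \<alpha> \<in> coS" "\<And>x. limitin \<tau> (\<lambda>\<alpha>. N \<alpha> x) (P x) (tails A le)"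
    by (rule projection_net[OF P]) (rule that)
  have "limitin (product_topology (\<lambda>_. weak) UNIV) N P (tails A le)"
    unfolding limitin_componentwise using limitin_weak_if_limitin[OF net(3)] by simp
  then show ?thesis
    unfolding K_space_def pointwise_closure_def topspace_weak
    by (rule limitin_in_closure_of[OF _ tails_neq_bot[OF net(1)]])
      (rule eventually_mono[OF eventually_in_tails[OF net(1)] net(2)])
qed

lemma projection_eqI:
  assumes P: "mean_ergodic_projection P" and u: "u \<in> Fix" "x - u \<in> Ran"
  shows "P x = u"
proof -
  have Px: "P x \<in> Fix" "x - P x \<in> Ran" using P by (auto simp: mean_ergodic_projection_def)
  have "P x - u \<in> Fix" using subspace_diff[OF Fix_subspace Px(1) u(1)] .
  moreover have "(x - u) - (x - P x) \<in> Ran" using subspace_diff[OF Ran_subspace u(2) Px(2)] .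
  ultimately show ?thesis using Fix_Ran_trivial[of "P x - u"] by simp
qed

text \<open>
  \<open>R P = P\<close> since \<open>R\<close> is the identity on \<open>Fix\<close>; \<open>P R = P\<close> since \<open>R\<close> also leaves \<open>Ran\<close> invariant, so
  that \<open>x\<close> and \<open>R x\<close> have the same component in \<open>Fix\<close>.
\<close>

lemma projection_zero:
  assumes P: "mean_ergodic_projection P"
  shows "is_zero_on UNIV K P"
  unfolding is_zero_on_def
proof (intro conjI ballI)
  have Px: "P x \<in> Fix" "x - P x \<in> Ran" for x using P by (auto simp: mean_ergodic_projection_def)
  show "P \<in> K" using projection_in_K[OF P] .
  fix R assume R: "R \<in> K"
  have "P (R x) = P x" for x
  proof (rule projection_eqI[OF P Px(1)])
    have "R x - P x = R (x - P x)" by (simp add: K_linear[OF R] K_fix[OF R Px(1)])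
    then show "R x - P x \<in> Ran" using Ran_invariant[OF R Px(2)] by simp
  qed
  then show "compose UNIV P R = P" by (simp add: compose_def fun_eq_iff)
  show "compose UNIV R P = P" using K_fix[OF R Px(1)] by (simp add: compose_def fun_eq_iff)
qed

text \<open>
  The adjoints of a net in \<open>co S\<close> that converges to \<open>P\<close> converge to the adjoint of \<open>P\<close>, whose values
  are fixed functionals. The adjoint \<open>Q\<close> is weak* continuous because \<open>Q \<phi> x\<close> is the value of \<open>\<phi>\<close>
  at \<open>P x\<close>.
\<close>

lemma projection_dual_zero:
  assumes P: "mean_ergodic_projection P"
  shows "is_zero_on X' K' (adjoint_on X' P)" "continuous_map weakstar weakstar (adjoint_on X' P)"
proof -
  define Q where "Q = adjoint_on X' P"
  have Px: "P x \<in> Fix" "x - P x \<in> Ran" for x using P by (auto simp: mean_ergodic_projection_def)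
  have QX: "Q \<phi> \<in> X'" "Q \<phi> x = \<phi> (P x)" if "\<phi> \<in> X'" for \<phi> x
    using dual_comp_K[OF that projection_in_K[OF P]] that by (auto simp: Q_def adjoint_on_def)
  have QE: "Q \<in> extensional X'" by (simp add: Q_def adjoint_on_def)
  obtain A :: "('a set \<times> ('a \<Rightarrow> real)) set" and le N where net: "directed A le"
      "\<And>\<alpha>. \<alpha> \<in> A \<Longrightarrow> N \<alpha> \<in> coS" "\<And>x. limitin \<tau> (\<lambda>\<alpha>. N \<alpha> x) (P x) (tails A le)"
    by (rule projection_net[OF P]) (rule that)
  have co: "\<forall>\<^sub>F \<alpha> in tails A le. adjoint_on X' (N \<alpha>) \<in> coS'"
    using eventually_in_tails[OF net(1)] by (rule eventually_mono) (rule coS'_adjoint[OF net(2)])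
  have "limitin (product_topology (\<lambda>_. weakstar) X') (\<lambda>\<alpha>. adjoint_on X' (N \<alpha>)) Q (tails A le)"
    unfolding limitin_componentwise limitin_weakstar
  proof (intro conjI ballI allI)
    show "Q \<in> extensional X'" by (rule QE)
    show "\<forall>\<^sub>F \<alpha> in tails A le. adjoint_on X' (N \<alpha>) \<in> topspace (product_topology (\<lambda>_. weakstar) X')"
      using co by (rule eventually_mono) (use coS'_maps in \<open>auto simp: PiE_def\<close>)
    fix \<phi> assume \<phi>: "\<phi> \<in> X'"
    show "Q \<phi> \<in> X'" using QX(1)[OF \<phi>] .
    show "\<forall>\<^sub>F \<alpha> in tails A le. adjoint_on X' (N \<alpha>) \<phi> \<in> X'"
      using co by (rule eventually_mono) (use coS'_maps \<phi> in blast)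
    show "((\<lambda>\<alpha>. adjoint_on X' (N \<alpha>) \<phi> x) \<longlongrightarrow> Q \<phi> x) (tails A le)" for x
      using limitin_weak_if_limitin[OF net(3)[of x]] \<phi> QX(2)[OF \<phi>]
      unfolding limitin_weak by (simp add: adjoint_on_def)
  qed
  then have QK: "Q \<in> K'"
    unfolding K_dual_def pointwise_closure_def topspace_weakstar
    by (rule limitin_in_closure_of[OF _ tails_neq_bot[OF net(1)] co])
  have QFix: "Q \<phi> \<in> Fix'" if \<phi>: "\<phi> \<in> X'" for \<phi>
  proof (rule Fix'I[OF QX(1)[OF \<phi>]])
    fix T x assume "T \<in> S"
    then have "T \<in> K" using co_superset coS_subset_K by blast
    then have "compose UNIV P T = P" using projection_zero[OF P] by (simp add: is_zero_on_def)
    then have "P (T x) = P x" by (simp add: compose_def fun_eq_iff)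
    then show "Q \<phi> (T x) = Q \<phi> x" by (simp add: QX(2)[OF \<phi>])
  qed
  show "is_zero_on X' K' (adjoint_on X' P)"
    unfolding is_zero_on_def Q_def[symmetric]
  proof (intro conjI ballI)
    show "Q \<in> K'" by (rule QK)
    fix R assume R: "R \<in> K'"
    have RX: "R \<phi> \<in> X'" if "\<phi> \<in> X'" for \<phi> using K'_maps[OF R] that by blast
    have "Q (R \<phi>) = Q \<phi>" if \<phi>: "\<phi> \<in> X'" for \<phi>
      using K'_fix[OF R Px(1) \<phi>] by (simp add: fun_eq_iff QX(2)[OF RX[OF \<phi>]] QX(2)[OF \<phi>])
    then show "compose X' Q R = Q"
      using QE by (intro extensionalityI[of _ X']) (auto simp: compose_def)
    show "compose X' R Q = Q"
      using QE K'_fix'[OF R QFix] by (intro extensionalityI[of _ X']) (auto simp: compose_def)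
  qed
  show "continuous_map weakstar weakstar (adjoint_on X' P)"
    unfolding Q_def[symmetric]
  proof (subst (2) weakstar_topology_def, rule continuous_on_generated_topo)
    fix U assume "U \<in> {{\<phi> \<in> X'. \<phi> x \<in> U} |x U. open U}"
    then obtain x V where U: "U = {\<phi> \<in> X'. \<phi> x \<in> V}" "open V" by blast
    have "Q -` U \<inter> topspace weakstar = {\<phi> \<in> X'. \<phi> (P x) \<in> V}"
      using QX by (auto simp: U(1))
    then show "openin weakstar (Q -` U \<inter> topspace weakstar)"
      using U(2) unfolding weakstar_topology_def by (auto intro!: topology_generated_by_Basis)
  next
    have "\<Union> {{\<phi> \<in> X'. \<phi> x \<in> U} |x U. open U} = X'"
      using topspace_weakstar unfolding weakstar_topology_def by simp
    then show "Q ` topspace weakstar \<subseteq> \<Union> {{\<phi> \<in> X'. \<phi> x \<in> U} |x U. open U}"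
      using QX(1) by auto
  qed
qed

text \<open>
  A net that converges to \<open>P\<close> is left ergodic because the values of \<open>P\<close> are fixed.
\<close>

lemma two_sided_net_if_projection:
  assumes P: "mean_ergodic_projection P"
  shows "\<exists>(A :: 'a op_index set) le N. two_sided_ergodic_net scl weak S A le N \<and>
    pointwise_convergent_net weak A le N"
proof -
  obtain A :: "('a set \<times> ('a \<Rightarrow> real)) set" and le N where net: "directed A le"
      "\<And>\<alpha>. \<alpha> \<in> A \<Longrightarrow> N \<alpha> \<in> coS" "\<And>x. limitin \<tau> (\<lambda>\<alpha>. N \<alpha> x) (P x) (tails A le)"
      "right_ergodic_net scl weak S A le N"
    by (rule projection_net[OF P]) (rule that)
  note lim = limitin_weak_if_limitin[OF net(3)]
  have "limitin weak (\<lambda>\<alpha>. N \<alpha> y - R (N \<alpha> y)) 0 (tails A le)" if R: "R \<in> S" for y R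
    unfolding limitin_weak
  proof
    fix \<phi> assume \<phi>: "\<phi> \<in> X'"
    have "P y \<in> Fix" using P by (simp add: mean_ergodic_projection_def)
    then have "R (P y) = P y" using R by (simp add: Fix_iff)
    moreover have "((\<lambda>\<alpha>. \<phi> (N \<alpha> y) - (\<phi> \<circ> R) (N \<alpha> y)) \<longlongrightarrow> \<phi> (P y) - (\<phi> \<circ> R) (P y)) (tails A le)"
      using lim[of y] \<phi> dual_comp[OF \<phi> R] unfolding limitin_weak by (intro tendsto_diff) blast+
    ultimately show "((\<lambda>\<alpha>. \<phi> (N \<alpha> y - R (N \<alpha> y))) \<longlongrightarrow> \<phi> 0) (tails A le)"
      by (simp add: dual_linear[OF \<phi>])
  qed
  then have "two_sided_ergodic_net scl weak S A le N"
    using net(4) unfolding two_sided_ergodic_net_def left_ergodic_net_def right_ergodic_net_def by blast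
  moreover have "pointwise_convergent_net weak A le N"
    using lim unfolding pointwise_convergent_net_def by blast
  ultimately show ?thesis by (rule two_sided_convergent_any_index)
qed

lemma mean_ergodic_if_projection:
  assumes P: "mean_ergodic_projection P"
  shows "weakly_mean_ergodic scl \<tau> S" "strongly_mean_ergodic scl \<tau> S"
proof -
  have Px: "P x \<in> Fix" "x - P x \<in> Ran" for x using P by (auto simp: mean_ergodic_projection_def)
  show "weakly_mean_ergodic scl \<tau> S" "strongly_mean_ergodic scl \<tau> S"
    unfolding weakly_mean_ergodic_def strongly_mean_ergodic_def right_mean_ergodic_def
      pointwise_convergent_net_def
    using right_ergodic_net_converges[OF Px] by blast+
qed

lemma direct_sum_iff_projection:
  "direct_sum_decomposition Fix Ran \<longleftrightarrow> (\<exists>P. mean_ergodic_projection P)"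
proof
  assume "direct_sum_decomposition Fix Ran"
  then have "\<exists>u\<in>Fix. \<exists>v\<in>Ran. x = u + v" for x by (simp add: direct_sum_decomposition_def)
  then have "\<exists>u. u \<in> Fix \<and> x - u \<in> Ran" for x by (metis add_diff_cancel_left')
  then show "\<exists>P. mean_ergodic_projection P" unfolding mean_ergodic_projection_def by metis
next
  assume "\<exists>P. mean_ergodic_projection P"
  then obtain P where Px: "\<And>x. P x \<in> Fix" "\<And>x. x - P x \<in> Ran"
    by (auto simp: mean_ergodic_projection_def)
  have "\<exists>u\<in>Fix. \<exists>v\<in>Ran. x = u + v" for x
    using Px[of x] by (intro bexI[of _ "P x"] bexI[of _ "x - P x"]) auto
  moreover have "Fix \<inter> Ran = {0}"
    using Fix_Ran_trivial subspace_0[OF Fix_subspace] subspace_0[OF Ran_subspace] by blast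
  ultimately show "direct_sum_decomposition Fix Ran" by (simp add: direct_sum_decomposition_def)
qed

lemma separates_iff_projection: "Fix_separates_Fix' \<longleftrightarrow> (\<exists>P. mean_ergodic_projection P)"
proof
  assume "Fix_separates_Fix'"
  then have "\<exists>u. u \<in> Fix \<and> x - u \<in> Ran" for x using decomposition_if_separates by blast
  then show "\<exists>P. mean_ergodic_projection P" unfolding mean_ergodic_projection_def by metis
next
  assume "\<exists>P. mean_ergodic_projection P"
  then show "Fix_separates_Fix'" using projection_zero separates_if_zero by blast
qed

lemma zero_unique:
  assumes "is_zero_on UNIV K P" "is_zero_on UNIV K P'"
  shows "P = P'"
  using assms unfolding is_zero_on_def by metis

end

theorem theorem4p7:
  fixes scl :: "complex \<Rightarrow> 'a::ab_group_add \<Rightarrow> 'a"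
    and \<tau> :: "'a topology"
    and S :: "('a \<Rightarrow> 'a) set"
  assumes "complex_lcs scl \<tau>"
    and "barrelled scl \<tau>"
    and "quasi_complete scl \<tau>"
    and "S \<subseteq> continuous_operators scl \<tau>"
    and "operator_semigroup S"
    and "bounded_semigroup scl \<tau> S"
    and "right_amenable_operators \<tau> S"
  shows
    "let X' = dual scl \<tau>;
         weak = weak_topology scl \<tau>;
         weakstar = weakstar_topology scl \<tau>;
         S' = adjoint_semigroup scl \<tau> S;
         K = K_space scl \<tau> S;
         K' = K_dual scl \<tau> S;
         i = (\<exists>(A :: 'a op_index set) le N.
                two_sided_ergodic_net scl weak S A le N \<and>
                (\<forall>x. \<exists>z. limitin weak (\<lambda>\<alpha>. N \<alpha> x) z (tails A le)));
         ii = weakly_mean_ergodic scl \<tau> S;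
         iii = strongly_mean_ergodic scl \<tau> S;
         iv = (\<exists>P. is_zero_on UNIV K P);
         v = (\<exists>Q. is_zero_on X' K' Q \<and> continuous_map weakstar weakstar Q);
         vi = (\<forall>x'\<in>fix_on X' S'. x' \<noteq> 0 \<longrightarrow> (\<exists>x\<in>fix_on UNIV S. x' x \<noteq> 0));
         vii = direct_sum_decomposition (fix_on UNIV S) (closed_lin scl \<tau> (rg_Id_minus S))
     in (i \<longleftrightarrow> ii) \<and> (ii \<longleftrightarrow> iii) \<and> (iii \<longleftrightarrow> iv) \<and> (iv \<longleftrightarrow> v) \<and> (v \<longleftrightarrow> vi) \<and> (vi \<longleftrightarrow> vii) \<and>
        (i \<or> ii \<or> iii \<or> iv \<or> v \<or> vi \<or> vii \<longrightarrow>
           (\<forall>P. is_zero_on UNIV K P \<longrightarrow>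
              (\<forall>(A :: 'i set) le N. right_ergodic_net scl weak S A le N \<longrightarrow>
                 (\<forall>x. limitin weak (\<lambda>\<alpha>. N \<alpha> x) (P x) (tails A le))) \<and>
              (\<forall>(A :: 'i set) le N. right_ergodic_net scl \<tau> S A le N \<longrightarrow>
                 (\<forall>x. limitin \<tau> (\<lambda>\<alpha>. N \<alpha> x) (P x) (tails A le)))))"
proof -
  interpret bounded_amenable_semigroup scl \<tau> S
    by unfold_locales (fact assms)+
  define i where "i \<longleftrightarrow> (\<exists>(A :: 'a op_index set) le N.
      two_sided_ergodic_net scl weak S A le N \<and> (\<forall>x. \<exists>z. limitin weak (\<lambda>\<alpha>. N \<alpha> x) z (tails A le)))"
  define proj where "proj \<longleftrightarrow> (\<exists>P. mean_ergodic_projection P)"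
  have i: "i \<longleftrightarrow> proj"
    unfolding i_def proj_def
    using separates_if_two_sided_net separates_iff_projection two_sided_net_if_projection
    unfolding pointwise_convergent_net_def by blast
  have ii: "weakly_mean_ergodic scl \<tau> S \<longleftrightarrow> proj" and iii: "strongly_mean_ergodic scl \<tau> S \<longleftrightarrow> proj"
    unfolding proj_def
    using separates_if_mean_ergodic separates_iff_projection mean_ergodic_if_projection
    unfolding weakly_mean_ergodic_def strongly_mean_ergodic_def by blast+
  have iv: "(\<exists>P. is_zero_on UNIV K P) \<longleftrightarrow> proj"
    unfolding proj_def using separates_if_zero separates_iff_projection projection_zero by blast
  have v: "(\<exists>Q. is_zero_on X' K' Q \<and> continuous_map weakstar weakstar Q) \<longleftrightarrow> proj"
    unfolding proj_def using separates_if_dual_zero separates_iff_projection projection_dual_zero by blast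
  have vi: "(\<forall>x'\<in>Fix'. x' \<noteq> 0 \<longrightarrow> (\<exists>x\<in>Fix. x' x \<noteq> 0)) \<longleftrightarrow> proj"
    unfolding proj_def using separates_iff_projection unfolding Fix_separates_Fix'_def .
  have vii: "direct_sum_decomposition Fix Ran \<longleftrightarrow> proj"
    unfolding proj_def by (rule direct_sum_iff_projection)
  have limit: "limitin weak (\<lambda>\<alpha>. N \<alpha> x) (P x) (tails A le)" if "right_ergodic_net scl weak S A le N"
      "is_zero_on UNIV K P" proj for A :: "'i set" and le N P x
    using that right_ergodic_net_converges(1) projection_zero zero_unique
    unfolding proj_def mean_ergodic_projection_def by metis
  have limit_\<tau>: "limitin \<tau> (\<lambda>\<alpha>. N \<alpha> x) (P x) (tails A le)" if "right_ergodic_net scl \<tau> S A le N"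
      "is_zero_on UNIV K P" proj for A :: "'i set" and le N P x
    using that right_ergodic_net_converges(2) projection_zero zero_unique
    unfolding proj_def mean_ergodic_projection_def by metis
  show ?thesis
    unfolding Let_def i_def[symmetric] i ii iii iv v vi vii
    using limit limit_\<tau> by blast
qed

end
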